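(* Let $0<\alpha<1$. Assume that $\epsilon_n m^n b(m^n)^{-1}\to+\infty$ and $\epsilon_n\to+\infty$ as $n\to\infty$. If $\gamma>\beta-1$, then $$\lim_{n\to\infty} m^{(\beta-1)n}\,\epsilon_n^{\beta}\,L(\epsilon_n m^n)^{-1}\,P\left(S_{Z_n}/Z_n\ge \epsilon_n\right)=I_\beta .$$
   Context: Galton-Watson process: $(Z_n)_{n\ge0}$ is a Galton-Watson process with $Z_0=1$ and offspring distribution $\{p_k\}_{k\ge0}$ such that $p_0=0$, $0<p_1<1$, with finite mean $m=\sum_{k\ge1}kp_k>1$ and $E[Z_1\log Z_1]<\infty$. Then $W=\lim_{n\to\infty}Z_n/m^n$ exists almost surely and has a continuous density $\omega$ on $(0,\infty)$. The Schröder constant $\gamma>0$ is defined by $p_1=m^{-\gamma}$. For $0\le t<\gamma+1$, $I_t=\int_0^\infty u^{1-t}\omega(u)\,du$ (finite). Sums: $(X_i)_{i\ge1}$ are i.i.d. real random variables, independent of $(Z_n)$, with distribution function $F(x)=P(X_1\le x)$; $S_n=X_1+\cdots+X_n$; $(\epsilon_n)$ is a sequence of positive numbers. Standing Assumption A: (A1) $P(X_1\ge x)\sim x^{-\beta}L(x)$ as $x\to+\infty$, where $\beta>0$ and $L$ is a (positive) slowly varying function. (A2) If $\epsilon_n\to0$, then $L$ is bounded away from $0$ and $\infty$ on every compact subset of $[0,\infty)$. (A3) $X_1$ is in the domain of attraction of an $\alpha$-stable law, $0<\alpha<2$: $b(k)^{-1}S_k\to U_s$ in distribution, where $U_s$ is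 an $\alpha$-stable random variable and $b:[0,\infty)\to[0,\infty)$ is a fixed continuous, increasing, onto function with $b(0)=0$ and $b(x)=x^{1/\alpha}s(x)$ for $x>0$ with $s:(0,\infty)\to(0,\infty)$ slowly varying. (A4) $E[X_1]=0$ if $1<\alpha<2$. Under these assumptions, $p_+=\lim_{x\to+\infty}\frac{1-F(x)}{1-F(x)+F(-x)}$ exists; it follows that $\alpha\le\beta$. Standing Assumption B: (B1) $U_s$ is strictly stable. (B2) If $1<\alpha<2$, then $\liminf_{x\to+\infty}s(x)\in(0,+\infty]$. (B3) If $0<p_+<1$ and $\alpha=1$, then $\int_{-x}^x yF(dy)=0$ for all $x>0$. (B4) If $p_+=0$, then $\alpha<\beta$. (B5) If $1<\alpha<2$ and $p_+>0$, then $\limsup_{n\to+\infty}\frac{F(-b(n)/[\log n]^{1/\alpha})}{(\log n)F(-b(n))}\le1$. *)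

theory Defs
  imports "HOL-Probability.Probability" "HOL-Library.Landau_Symbols"
begin

text \<open>
  A Galton--Watson process started from one individual, as a Markov chain on the naturals: given
  \<open>Z\<^sub>n = k\<close>, the next state is distributed as the sum of \<open>k\<close> independent offspring numbers.  This is a
  property of the law of \<open>Z\<close> only, so the offspring numbers need not be realized on the same space.
\<close>

definition galton_watson :: "'a measure \<Rightarrow> nat pmf \<Rightarrow> (nat \<Rightarrow> 'a \<Rightarrow> nat) \<Rightarrow> bool" where
  "galton_watson M p Z \<longleftrightarrow>
     (\<forall>n. Z n \<in> measurable M (count_space UNIV)) \<and>
     (AE x in M. Z 0 x = 1) \<and>
     (\<forall>n (k :: nat \<Rightarrow> nat).
        measure M {x \<in> space M. \<forall>i\<le>Suc n. Z i x = k i} =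
        measure M {x \<in> space M. \<forall>i\<le>n. Z i x = k i} *
          pmf (map_pmf sum_list (replicate_pmf (k n) p)) (k (Suc n)))"

definition galton_watson_conditions :: "'a measure \<Rightarrow> nat pmf \<Rightarrow> (nat \<Rightarrow> 'a \<Rightarrow> nat) \<Rightarrow> real \<Rightarrow> bool" where
  "galton_watson_conditions M p Z m \<longleftrightarrow>
     galton_watson M p Z \<and>
     pmf p 0 = 0 \<and> 0 < pmf p 1 \<and> pmf p 1 < 1 \<and>
     integrable (measure_pmf p) real \<and> m = measure_pmf.expectation p real \<and> 1 < m \<and>
     integrable M (\<lambda>x. real (Z 1 x) * ln (real (Z 1 x)))"

text \<open>
  \<open>W\<close> is the almost sure limit of \<open>Z\<^sub>n / m\<^sup>n\<close> and \<open>\<omega>\<close> is its continuous density on \<open>(0, \<infinity>)\<close>.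
  Values of \<open>\<omega>\<close> outside \<open>(0, \<infinity>)\<close> are irrelevant.
\<close>

definition gw_limit_density ::
    "'a measure \<Rightarrow> (nat \<Rightarrow> 'a \<Rightarrow> nat) \<Rightarrow> real \<Rightarrow> ('a \<Rightarrow> real) \<Rightarrow> (real \<Rightarrow> real) \<Rightarrow> bool" where
  "gw_limit_density M Z m W \<omega> \<longleftrightarrow>
     (AE x in M. (\<lambda>n. real (Z n x) / m ^ n) \<longlonglongrightarrow> W x) \<and>
     continuous_on {0<..} \<omega> \<and> (\<forall>u>0. 0 \<le> \<omega> u) \<and>
     distributed M lborel W (\<lambda>u. ennreal (indicator {0<..} u * \<omega> u))"

definition density_moment :: "(real \<Rightarrow> real) \<Rightarrow> real \<Rightarrow> real" where
  "density_moment \<omega> t = (LBINT u:{0<..}. u powr (1 - t) * \<omega> u)"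

text \<open>Slow variation at infinity of a positive measurable function on \<open>(0, \<infinity>)\<close>.\<close>

definition slowly_varying :: "(real \<Rightarrow> real) \<Rightarrow> bool" where
  "slowly_varying L \<longleftrightarrow>
     L \<in> borel_measurable (restrict_space borel {0<..}) \<and> (\<forall>x>0. 0 < L x) \<and>
     (\<forall>c>0. ((\<lambda>x. L (c * x) / L x) \<longlongrightarrow> 1) at_top)"

text \<open>
  A law is \<open>\<alpha>\<close>-stable if it is nondegenerate and, for independent copies \<open>U\<^sub>1\<close>, \<open>U\<^sub>2\<close> of a variable
  \<open>U\<close> with that law and all \<open>a, c > 0\<close>, the variable \<open>a U\<^sub>1 + c U\<^sub>2\<close> has the law of
  \<open>(a\<^sup>\<alpha> + c\<^sup>\<alpha>)\<^bsup>1/\<alpha>\<^esup> U + d\<close> for some real \<open>d\<close>; it is strictly stable if \<open>d = 0\<close> always works.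
\<close>

definition alpha_stable :: "real \<Rightarrow> real measure \<Rightarrow> bool" where
  "alpha_stable \<alpha> \<nu> \<longleftrightarrow>
     real_distribution \<nu> \<and> (\<forall>x. measure \<nu> {x} < 1) \<and>
     (\<forall>a>0. \<forall>c>0. \<exists>d.
        distr (\<nu> \<Otimes>\<^sub>M \<nu>) borel (\<lambda>(x, y). a * x + c * y) =
        distr \<nu> borel (\<lambda>x. (a powr \<alpha> + c powr \<alpha>) powr (1 / \<alpha>) * x + d))"

definition strictly_alpha_stable :: "real \<Rightarrow> real measure \<Rightarrow> bool" where
  "strictly_alpha_stable \<alpha> \<nu> \<longleftrightarrow>
     real_distribution \<nu> \<and> (\<forall>x. measure \<nu> {x} < 1) \<and>
     (\<forall>a>0. \<forall>c>0.
        distr (\<nu> \<Otimes>\<^sub>M \<nu>) borel (\<lambda>(x, y). a * x + c * y) =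
        distr \<nu> borel (\<lambda>x. (a powr \<alpha> + c powr \<alpha>) powr (1 / \<alpha>) * x))"

text \<open>\<open>X i\<close> is the \<open>(i+1)\<close>-st summand, so that \<open>partial_sum X n\<close> has \<open>n\<close> terms.\<close>

definition partial_sum :: "(nat \<Rightarrow> 'a \<Rightarrow> real) \<Rightarrow> nat \<Rightarrow> 'a \<Rightarrow> real" where
  "partial_sum X n x = (\<Sum>i<n. X i x)"

definition iid_sequence :: "'a measure \<Rightarrow> (nat \<Rightarrow> 'a \<Rightarrow> real) \<Rightarrow> bool" where
  "iid_sequence M X \<longleftrightarrow>
     prob_space.indep_vars M (\<lambda>_. borel) X UNIV \<and>
     (\<forall>i. distr M borel (X i) = distr M borel (X 0))"

definition indep_sequences :: "'a measure \<Rightarrow> (nat \<Rightarrow> 'a \<Rightarrow> real) \<Rightarrow> (nat \<Rightarrow> 'a \<Rightarrow> nat) \<Rightarrow> bool" where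
  "indep_sequences M X Z \<longleftrightarrow>
     prob_space.indep_var M
       (Pi\<^sub>M UNIV (\<lambda>_. borel)) (\<lambda>x i. X i x)
       (Pi\<^sub>M UNIV (\<lambda>_. count_space UNIV)) (\<lambda>x n. Z n x)"

text \<open>
  The standing assumptions below are stated for the common law \<open>\<mu>\<close> of the \<open>X\<^sub>i\<close>, with
  distribution function \<open>cdf \<mu>\<close>; \<open>\<nu>\<close> is the law of the stable limit \<open>U\<^sub>s\<close>.
\<close>

definition p_plus :: "real measure \<Rightarrow> real" where
  "p_plus \<mu> = Lim at_top (\<lambda>x. (1 - cdf \<mu> x) / (1 - cdf \<mu> x + cdf \<mu> (- x)))"

definition tail_assumption :: "real measure \<Rightarrow> real \<Rightarrow> (real \<Rightarrow> real) \<Rightarrow> bool" where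
  "tail_assumption \<mu> \<beta> L \<longleftrightarrow>
     0 < \<beta> \<and> slowly_varying L \<and>
     (\<lambda>x. measure \<mu> {x..}) \<sim>[at_top] (\<lambda>x. x powr (- \<beta>) * L x)"

definition bounded_away_assumption :: "(nat \<Rightarrow> real) \<Rightarrow> (real \<Rightarrow> real) \<Rightarrow> bool" where
  "bounded_away_assumption \<epsilon> L \<longleftrightarrow>
     (\<epsilon> \<longlonglongrightarrow> 0 \<longrightarrow>
        (\<forall>K. compact K \<and> K \<subseteq> {0..} \<longrightarrow> (\<exists>l>0. \<exists>u. \<forall>x\<in>K. l \<le> L x \<and> L x \<le> u)))"

definition norming_function :: "real \<Rightarrow> (real \<Rightarrow> real) \<Rightarrow> (real \<Rightarrow> real) \<Rightarrow> bool" where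
  "norming_function \<alpha> b s \<longleftrightarrow>
     continuous_on {0..} b \<and> mono_on {0..} b \<and> b ` {0..} = {0..} \<and> b 0 = 0 \<and>
     slowly_varying s \<and> (\<forall>x>0. b x = x powr (1 / \<alpha>) * s x)"

definition stable_attraction ::
    "'a measure \<Rightarrow> (nat \<Rightarrow> 'a \<Rightarrow> real) \<Rightarrow> real \<Rightarrow> (real \<Rightarrow> real) \<Rightarrow> (real \<Rightarrow> real) \<Rightarrow> real measure \<Rightarrow> bool" where
  "stable_attraction M X \<alpha> b s \<nu> \<longleftrightarrow>
     0 < \<alpha> \<and> \<alpha> < 2 \<and> norming_function \<alpha> b s \<and> alpha_stable \<alpha> \<nu> \<and>
     weak_conv_m (\<lambda>k. distr M borel (\<lambda>x. partial_sum X k x / b (real k))) \<nu>"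

definition assumption_A ::
    "'a measure \<Rightarrow> (nat \<Rightarrow> 'a \<Rightarrow> real) \<Rightarrow> (nat \<Rightarrow> real) \<Rightarrow> real \<Rightarrow> real \<Rightarrow> (real \<Rightarrow> real) \<Rightarrow>
     (real \<Rightarrow> real) \<Rightarrow> (real \<Rightarrow> real) \<Rightarrow> real measure \<Rightarrow> bool" where
  "assumption_A M X \<epsilon> \<alpha> \<beta> L b s \<nu> \<longleftrightarrow>
     tail_assumption (distr M borel (X 0)) \<beta> L \<and>
     bounded_away_assumption \<epsilon> L \<and>
     stable_attraction M X \<alpha> b s \<nu> \<and>
     (1 < \<alpha> \<and> \<alpha> < 2 \<longrightarrow> integrable M (X 0) \<and> integral\<^sup>L M (X 0) = 0)"

definition assumption_B ::
    "real measure \<Rightarrow> real \<Rightarrow> real \<Rightarrow> (real \<Rightarrow> real) \<Rightarrow> (real \<Rightarrow> real) \<Rightarrow> real measure \<Rightarrow> bool" where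
  "assumption_B \<mu> \<alpha> \<beta> b s \<nu> \<longleftrightarrow>
     strictly_alpha_stable \<alpha> \<nu> \<and>
     (1 < \<alpha> \<and> \<alpha> < 2 \<longrightarrow> 0 < Liminf at_top (\<lambda>x. ereal (s x))) \<and>
     (0 < p_plus \<mu> \<and> p_plus \<mu> < 1 \<and> \<alpha> = 1 \<longrightarrow> (\<forall>x>0. (LINT y:{-x..x}|\<mu>. y) = 0)) \<and>
     (p_plus \<mu> = 0 \<longrightarrow> \<alpha> < \<beta>) \<and>
     (1 < \<alpha> \<and> \<alpha> < 2 \<and> 0 < p_plus \<mu> \<longrightarrow>
        limsup (\<lambda>n. ereal (cdf \<mu> (- b (real n) / ln (real n) powr (1 / \<alpha>)) /
                           (ln (real n) * cdf \<mu> (- b (real n))))) \<le> 1)"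

end

theory Submission
  imports Defs
begin

text \<open>
  Write \<open>G\<close> for the right tail of \<open>X\<^sub>1\<close> and \<open>a\<^sub>n = m\<^sup>n\<close>.  For \<open>x\<close> much larger than \<open>b(k)\<close> a single big
  jump dominates, \<open>P(S\<^sub>k \<ge> x) \<sim> k G(x)\<close>.  With \<open>k = Z\<^sub>n \<approx> W a\<^sub>n\<close> and \<open>x = k \<epsilon>\<^sub>n\<close>, regular variation turns
  \<open>k G(x)\<close> into \<open>W\<^bsup>1-\<beta>\<^esup> a\<^sub>n G(a\<^sub>n \<epsilon>\<^sub>n)\<close>, and it remains to exchange limit and expectation.  The quotient
  \<open>P(S\<^sub>k \<ge> k \<epsilon>\<^sub>n) / (a\<^sub>n G(a\<^sub>n \<epsilon>\<^sub>n))\<close> is dominated, uniformly in \<open>k\<close>, by \<open>u\<^bsup>-r\<^esup> + u\<^bsup>r'\<^esup>\<close> with \<open>u = k / a\<^sub>n\<close>,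
  \<open>\<beta> - 1 < r < \<gamma>\<close> and \<open>r' < 1\<close>, and \<open>Z\<^sub>n / a\<^sub>n\<close> has bounded mean and bounded moments of every order
  above \<open>-\<gamma>\<close>.  Left tails of the summands cost nothing, because the upper bounds only use the
  positive parts.  The positive parts below \<open>\<eta> x\<close> are controlled by an exponential moment bound: if
  \<open>\<beta> < 1\<close>, their mean is of order \<open>x G(x)\<close>; if \<open>\<beta> \<ge> 1\<close>, the bound is an arbitrarily large power of
  \<open>1 / \<epsilon>\<^sub>n\<close>, which suffices since \<open>\<alpha> < 1\<close> forces \<open>\<epsilon>\<^sub>n\<close> to grow like a power of \<open>a\<^sub>n\<close>.
\<close>

section \<open>Monotone regularly varying functions\<close>

text \<open>Before a single jump can dominate, k G(k eps_n) -> 0 must be known, while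
  \<open>b\<close> is tied to the law of the sums and not directly to the right tail. Tightness
  supplies this: if jumps above 2y among k summands were not rare, one of them, together with a rest
  that is seldom below -y, would make S_k >= y too likely. The second constraint is the offspring
  law: the only positive moment of Z_n / m^n in use is the first. The domination must therefore grow
  slower than linearly in u and leave room for a power q > 1, which gives uniform integrability.
  This is why the estimate for \<beta> \<ge> 1 keeps the exponent of k at 1/2 while the exponent of
  1 / eps_n is free. At the other end, iterates of the generating function decay geometrically at
  every rate above p_1 = m^(-\<gamma>), which yields the negative moments of order below \<gamma>;
  the condition \<gamma> > \<beta> - 1 leaves an interval for r. Regular variation is given
  pointwise in the dilation factor; monotonicity of G and dyadic iteration do the work of uniform
  convergence and of Karamata's theorem.\<close>

lemma powr_between:
  fixes u :: real
  assumes "0 < u" "- r \<le> e" "e \<le> r'"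
  shows "u powr e \<le> u powr (- r) + u powr r'"
proof (cases "u \<le> 1")
  case True
  then have "u powr e \<le> u powr (- r)" using assms by (simp add: powr_mono')
  then show ?thesis by (simp add: add_increasing2)
next
  case False
  then have "u powr e \<le> u powr r'" using assms by (simp add: powr_mono)
  then show ?thesis by (simp add: add_increasing)
qed

lemma dyadic_cover:
  fixes x :: real
  assumes "0 < x0" "x0 \<le> x"
  obtains j where "2 ^ j * x0 \<le> x" "x < 2 ^ Suc j * x0"
proof -
  obtain N where N: "x / x0 < 2 ^ N"
    using real_arch_pow[of 2 "x / x0"] by auto
  define j where "j = (LEAST j. x < 2 ^ Suc j * x0)"
  have ex: "x < 2 ^ Suc N * x0"
  proof -
    have "x < 2 ^ N * x0" using N assms by (simp add: pos_divide_less_eq)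
    also have "\<dots> \<le> 2 ^ Suc N * x0" using assms by simp
    finally show ?thesis .
  qed
  have 1: "x < 2 ^ Suc j * x0" unfolding j_def by (rule LeastI[of _ N]) (rule ex)
  have 2: "2 ^ j * x0 \<le> x"
  proof (cases j)
    case 0 then show ?thesis using assms by simp
  next
    case (Suc i)
    then have "\<not> x < 2 ^ Suc i * x0" using not_less_Least[of i "\<lambda>j. x < 2 ^ Suc j * x0"] j_def by auto
    then show ?thesis using Suc by simp
  qed
  show ?thesis using that 1 2 by blast
qed

text \<open>A discrete form of Karamata's theorem: the increments of \<open>J\<close> over dyadic
  blocks are controlled by \<open>T\<close>, which grows geometrically, so their sum is comparable
  to the last one. It serves to bound truncated means.\<close>

lemma dyadic_bound:
  fixes J T :: "real \<Rightarrow> real"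
  assumes "0 < x0" and "\<kappa> < 1" and "0 \<le> \<kappa>" and "0 \<le> c" and "0 < t"
    and step: "\<And>x. x0 \<le> x \<Longrightarrow> J (2 * x) \<le> J x + c * T x"
    and T: "\<And>x. x0 \<le> x \<Longrightarrow> 0 \<le> T x" "\<And>x. x0 \<le> x \<Longrightarrow> T x \<le> \<kappa> * T (2 * x)"
    and base: "\<And>x. x0 \<le> x \<Longrightarrow> x \<le> 2 * x0 \<Longrightarrow> J x \<le> B" "\<And>x. x0 \<le> x \<Longrightarrow> x \<le> 2 * x0 \<Longrightarrow> t \<le> T x"
  shows "\<exists>C>0. \<forall>x\<ge>x0. J x \<le> C * T x"
proof -
  \<comment> \<open>\<open>\<kappa> * c / (1 - \<kappa>)\<close> is the fixed point of the map
    taking C to \<open>\<kappa> * (C + c)\<close>, so any larger constant survives a doubling;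
    \<open>B / t\<close> starts the induction on the first block.\<close>
  define C where "C = max (max (B / t) (\<kappa> * c / (1 - \<kappa>))) 1"
  have C: "B / t \<le> C" "\<kappa> * c / (1 - \<kappa>) \<le> C" "1 \<le> C" by (auto simp: C_def)
  have C2: "\<kappa> * (C + c) \<le> C" using C(2) assms(2) by (simp add: pos_divide_le_eq algebra_simps)
  have main: "J (2 ^ j * x) \<le> C * T (2 ^ j * x)" if "x0 \<le> x" "x \<le> 2 * x0" for j x
  proof (induction j)
    case 0
    have "J x \<le> B" using base that by blast
    also have "B \<le> C * t" using C(1) assms(5) by (simp add: pos_divide_le_eq)
    also have "\<dots> \<le> C * T x" using base(2)[OF that] C by simp
    finally show ?case by simp
  next
    case (Suc j)
    let ?y = "2 ^ j * x"
    have "1 * x0 \<le> ?y" by (rule mult_mono) (use that assms(1) in auto)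
    then have y: "x0 \<le> ?y" by simp
    have "J (2 * ?y) \<le> (C + c) * T ?y" using step[OF y] Suc.IH by (simp add: algebra_simps)
    also have "\<dots> \<le> (C + c) * (\<kappa> * T (2 * ?y))"
      using T(2)[OF y] C assms(4) by (intro mult_left_mono) auto
    also have "\<dots> = (\<kappa> * (C + c)) * T (2 * ?y)" by simp
    also have "\<dots> \<le> C * T (2 * ?y)"
      using C2 T(1)[of "2 * ?y"] y assms(1) by (intro mult_right_mono) auto
    finally show ?case by (simp add: mult.assoc)
  qed
  have "J x \<le> C * T x" if x: "x0 \<le> x" for x
  proof -
    obtain j where j: "2 ^ j * x0 \<le> x" "x < 2 ^ Suc j * x0" by (rule dyadic_cover[OF assms(1) x])
    have "J (2 ^ j * (x / 2 ^ j)) \<le> C * T (2 ^ j * (x / 2 ^ j))"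
      by (rule main) (use j in \<open>auto simp: field_simps\<close>)
    then show ?thesis by simp
  qed
  then show ?thesis using C(3) by (intro exI[of _ C]) auto
qed

section \<open>Moving dilation factors, Potter bounds, comparison with powers\<close>

locale regularly_varying_tail =
  fixes G :: "real \<Rightarrow> real" and \<beta> :: real
  assumes antimono: "x \<le> y \<Longrightarrow> G y \<le> G x"
    and pos: "0 < G x"
    and index_pos: "0 < \<beta>"
    and ratio: "0 < c \<Longrightarrow> ((\<lambda>x. G (c * x) / G x) \<longlongrightarrow> c powr (- \<beta>)) at_top"
begin

text \<open>Monotonicity gives the local uniformity: \<open>c n\<close> is compared with a fixed
  \<open>d\<close> slightly above or below \<open>c0\<close>, where the pointwise limit applies, and
  the limit constant is continuous in \<open>d\<close>.\<close>

lemma tendsto_ratio: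
  fixes x c :: "nat \<Rightarrow> real"
  assumes x: "filterlim x at_top sequentially" and c: "c \<longlonglongrightarrow> c0" and "0 < c0"
  shows "(\<lambda>n. G (c n * x n) / G (x n)) \<longlonglongrightarrow> c0 powr (- \<beta>)"
proof (rule order_tendstoI)
  have cont: "((\<lambda>d. d powr (- \<beta>)) \<longlongrightarrow> c0 powr (- \<beta>)) (at_right c0)"
    using assms(3) by (auto intro!: tendsto_intros)
  fix a assume a: "a < c0 powr (- \<beta>)"
  have "eventually (\<lambda>d. a < d powr (- \<beta>) \<and> c0 < d) (at_right c0)"
    using order_tendstoD(1)[OF cont a] by (simp add: eventually_conj eventually_at_right_less)
  then obtain d where d: "a < d powr (- \<beta>)" "c0 < d"
    using eventually_happens'[OF trivial_limit_at_right_real[of c0]] by blast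
  have "((\<lambda>n. G (d * x n) / G (x n)) \<longlongrightarrow> d powr (- \<beta>)) sequentially"
    using filterlim_compose[OF ratio x] d assms(3) by simp
  then have "eventually (\<lambda>n. a < G (d * x n) / G (x n)) sequentially" using d order_tendstoD by blast
  moreover have "eventually (\<lambda>n. c n < d) sequentially" using c d order_tendstoD by blast
  moreover have "eventually (\<lambda>n. 0 < x n) sequentially" using x by (simp add: filterlim_at_top_dense)
  ultimately show "eventually (\<lambda>n. a < G (c n * x n) / G (x n)) sequentially"
  proof eventually_elim
    case (elim n)
    have "G (d * x n) \<le> G (c n * x n)" using elim by (intro antimono mult_right_mono) auto
    then show ?case using elim pos[of "x n"] by (meson divide_right_mono less_eq_real_def order_less_le_trans)
  qed
next
  have cont: "((\<lambda>d. d powr (- \<beta>)) \<longlongrightarrow> c0 powr (- \<beta>)) (at_left c0)"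
    using assms(3) by (auto intro!: tendsto_intros)
  fix a assume a: "c0 powr (- \<beta>) < a"
  have "eventually (\<lambda>d. d powr (- \<beta>) < a \<and> d \<in> {0<..<c0}) (at_left c0)"
    using order_tendstoD(2)[OF cont a] eventually_at_left_real[OF assms(3)] by (rule eventually_conj)
  then obtain d where d: "d powr (- \<beta>) < a" "0 < d" "d < c0"
    using eventually_happens'[OF trivial_limit_at_left_real[of c0]] by force
  have "((\<lambda>n. G (d * x n) / G (x n)) \<longlongrightarrow> d powr (- \<beta>)) sequentially"
    using filterlim_compose[OF ratio x] d assms(3) by simp
  then have "eventually (\<lambda>n. G (d * x n) / G (x n) < a) sequentially" using d order_tendstoD by blast
  moreover have "eventually (\<lambda>n. d < c n) sequentially" using c d order_tendstoD by blast
  moreover have "eventually (\<lambda>n. 0 < x n) sequentially" using x by (simp add: filterlim_at_top_dense)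
  ultimately show "eventually (\<lambda>n. G (c n * x n) / G (x n) < a) sequentially"
  proof eventually_elim
    case (elim n)
    have "G (c n * x n) \<le> G (d * x n)" using elim by (intro antimono mult_right_mono) auto
    then show ?case using elim pos[of "x n"] by (meson divide_right_mono less_eq_real_def order_le_less_trans)
  qed
qed

lemma doubling:
  assumes "0 < \<delta>"
  shows "\<exists>x0>0. \<forall>x\<ge>x0. G x \<le> 2 powr (\<beta> + \<delta>) * G (2 * x) \<and> G (2 * x) \<le> 2 powr (\<delta> - \<beta>) * G x"
proof -
  have lim: "((\<lambda>x. G (2 * x) / G x) \<longlongrightarrow> 2 powr (- \<beta>)) at_top" using ratio[of 2] by simp
  have "eventually (\<lambda>x. 2 powr (- (\<beta> + \<delta>)) < G (2 * x) / G x) at_top"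
    by (rule order_tendstoD(1)[OF lim]) (use assms in simp)
  moreover have "eventually (\<lambda>x. G (2 * x) / G x < 2 powr (\<delta> - \<beta>)) at_top"
    by (rule order_tendstoD(2)[OF lim]) (use assms in simp)
  ultimately have "eventually (\<lambda>x. G x \<le> 2 powr (\<beta> + \<delta>) * G (2 * x) \<and> G (2 * x) \<le> 2 powr (\<delta> - \<beta>) * G x) at_top"
  proof eventually_elim
    case (elim x)
    have "2 powr (\<beta> + \<delta>) * (2 powr (- (\<beta> + \<delta>)) * G x) \<le> 2 powr (\<beta> + \<delta>) * G (2 * x)"
      using elim(1) pos[of x] by (intro mult_left_mono) (auto simp: pos_less_divide_eq)
    moreover have "2 powr (\<beta> + \<delta>) * (2 powr (- (\<beta> + \<delta>)) * G x) = G x"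
      by (simp only: mult.assoc[symmetric] powr_add[symmetric]) simp
    ultimately show ?case using elim(2) pos[of x] by (simp only: pos_divide_less_eq) simp
  qed
  then obtain z where z: "\<And>x. z \<le> x \<Longrightarrow> G x \<le> 2 powr (\<beta> + \<delta>) * G (2 * x) \<and> G (2 * x) \<le> 2 powr (\<delta> - \<beta>) * G x"
    by (auto simp: eventually_at_top_linorder)
  show ?thesis by (rule exI[of _ "max z 1"]) (use z in auto)
qed

text \<open>Iterating the doubling bounds over the dyadic steps between the two arguments produces
  powers of \<open>x / y\<close>; rounding to a dyadic scale costs the constant. The sum of both
  powers makes the bound valid whichever argument is larger.\<close>

lemma potter:
  assumes "0 < \<delta>" "\<delta> \<le> \<beta>"
  shows "\<exists>C>0. \<exists>x0>0. \<forall>x\<ge>x0. \<forall>y\<ge>x0.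
    G x \<le> C * ((x / y) powr (- (\<beta> + \<delta>)) + (x / y) powr (\<delta> - \<beta>)) * G y"
proof -
  obtain x0 where x0: "0 < x0" and
    d: "\<And>x. x0 \<le> x \<Longrightarrow> G x \<le> 2 powr (\<beta> + \<delta>) * G (2 * x)"
       "\<And>x. x0 \<le> x \<Longrightarrow> G (2 * x) \<le> 2 powr (\<delta> - \<beta>) * G x"
    using doubling[OF assms(1)] by blast
  have ge: "x0 \<le> 2 ^ j * x" if "x0 \<le> x" for x j
    using mult_mono[of 1 "2 ^ j" x0 x] that x0 by auto
  have it1: "G x \<le> (2 ^ j) powr (\<beta> + \<delta>) * G (2 ^ j * x)" if "x0 \<le> x" for x j
  proof (induction j)
    case (Suc j)
    have "G x \<le> (2 ^ j) powr (\<beta> + \<delta>) * G (2 ^ j * x)" by (rule Suc)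
    also have "\<dots> \<le> (2 ^ j) powr (\<beta> + \<delta>) * (2 powr (\<beta> + \<delta>) * G (2 * (2 ^ j * x)))"
      by (intro mult_left_mono d ge that) simp
    also have "\<dots> = (2 ^ Suc j) powr (\<beta> + \<delta>) * G (2 ^ Suc j * x)"
      by (simp add: powr_mult mult_ac)
    finally show ?case .
  qed simp
  have it2: "G (2 ^ j * x) \<le> (2 ^ j) powr (\<delta> - \<beta>) * G x" if "x0 \<le> x" for x j
  proof (induction j)
    case (Suc j)
    have "G (2 * (2 ^ j * x)) \<le> 2 powr (\<delta> - \<beta>) * G (2 ^ j * x)" by (intro d ge that)
    also have "\<dots> \<le> 2 powr (\<delta> - \<beta>) * ((2 ^ j) powr (\<delta> - \<beta>) * G x)"
      by (intro mult_left_mono Suc) simp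
    also have "\<dots> = (2 ^ Suc j) powr (\<delta> - \<beta>) * G x"
      by (simp add: powr_mult mult_ac)
    finally show ?case by (simp add: mult_ac)
  qed simp
  let ?C = "2 powr (\<beta> + \<delta>)"
  have "G x \<le> ?C * ((x / y) powr (- (\<beta> + \<delta>)) + (x / y) powr (\<delta> - \<beta>)) * G y" if xy: "x0 \<le> x" "x0 \<le> y" for x y
  proof (cases "x \<le> y")
    case True
    have x: "0 < x" "0 < y" using that x0 by auto
    obtain j where j: "2 ^ j * x \<le> y" "y < 2 ^ Suc j * x" by (rule dyadic_cover[OF x(1) True])
    have "G x \<le> (2 ^ Suc j) powr (\<beta> + \<delta>) * G (2 ^ Suc j * x)" by (rule it1) fact
    also have "\<dots> \<le> (2 * (y / x)) powr (\<beta> + \<delta>) * G y"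
      using j x assms pos index_pos by (intro mult_mono powr_mono2 antimono less_imp_le[OF pos]) (auto simp: field_simps)
    also have "\<dots> = ?C * (x / y) powr (- (\<beta> + \<delta>)) * G y"
      using x powr_minus[of "x / y" "\<beta> + \<delta>"] by (simp add: powr_mult powr_divide del: minus_add_distrib)
    also have "\<dots> \<le> ?C * ((x / y) powr (- (\<beta> + \<delta>)) + (x / y) powr (\<delta> - \<beta>)) * G y"
      using less_imp_le[OF pos[of y]] by (intro mult_right_mono mult_left_mono) auto
    finally show ?thesis .
  next
    case False
    have x: "0 < x" "0 < y" using that x0 by auto
    obtain j where j: "2 ^ j * y \<le> x" "x < 2 ^ Suc j * y" using dyadic_cover[OF x(2), of x] False by auto
    have "G x \<le> G (2 ^ j * y)" by (intro antimono j)
    also have "\<dots> \<le> (2 ^ j) powr (\<delta> - \<beta>) * G y" by (rule it2) fact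
    \<comment> \<open>The exponent is nonpositive because \<delta> \<le> \<beta>, so
      \<open>2 ^ j\<close> may be replaced by the smaller number \<open>x / y / 2\<close>.\<close>
    also have "\<dots> \<le> (x / y / 2) powr (\<delta> - \<beta>) * G y"
      using j x assms by (intro mult_right_mono less_imp_le[OF pos] powr_mono2') (auto simp: field_simps)
    also have "\<dots> = 2 powr (\<beta> - \<delta>) * (x / y) powr (\<delta> - \<beta>) * G y"
      using powr_minus_divide[of 2 "\<delta> - \<beta>"] x by (subst powr_divide) auto
    also have "\<dots> \<le> ?C * ((x / y) powr (- (\<beta> + \<delta>)) + (x / y) powr (\<delta> - \<beta>)) * G y"
      using less_imp_le[OF pos[of y]] assms by (intro mult_right_mono mult_mono) auto
    finally show ?thesis .
  qed
  then show ?thesis using x0 by (intro exI[of _ ?C] conjI exI[of _ x0]) auto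
qed

text \<open>Potter's bound with \<delta> = \<beta>, read from the fixed point \<open>x0\<close> to
  the variable \<open>x\<close>. This \<delta> makes the second Potter exponent 0, and that term is
  absorbed by the first.\<close>

lemma polynomial_lower_bound:
  "\<exists>C>0. \<exists>x0>0. \<forall>x\<ge>x0. x powr (- (\<beta> + \<beta>)) \<le> C * G x"
proof -
  obtain C x0 where C: "0 < C" "0 < x0" and
    P: "\<And>x y. x0 \<le> x \<Longrightarrow> x0 \<le> y \<Longrightarrow> G x \<le> C * ((x / y) powr (- (\<beta> + \<beta>)) + (x / y) powr (\<beta> - \<beta>)) * G y"
    using potter[of \<beta>] index_pos by blast
  have "x powr (- (\<beta> + \<beta>)) \<le> (C * 2 * x0 powr (- (\<beta> + \<beta>)) / G x0) * G x" if "x0 \<le> x" for x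
  proof -
    have x: "0 < x" "0 < x0" using that C by auto
    have le: "1 \<le> (x0 / x) powr (- (\<beta> + \<beta>))"
      using x that index_pos powr_mono2'[of "- (\<beta> + \<beta>)" "x0 / x" 1] by auto
    have "G x0 \<le> C * ((x0 / x) powr (- (\<beta> + \<beta>)) + (x0 / x) powr (\<beta> - \<beta>)) * G x"
      by (rule P) (use that in auto)
    also have "\<dots> \<le> C * ((x0 / x) powr (- (\<beta> + \<beta>)) + (x0 / x) powr (- (\<beta> + \<beta>))) * G x"
      using le x C pos[of x] by (intro mult_right_mono mult_left_mono add_left_mono) auto
    also have "\<dots> = C * 2 * x0 powr (- (\<beta> + \<beta>)) * G x / x powr (- (\<beta> + \<beta>))"
      using x by (simp add: powr_divide del: minus_add_distrib)
    finally show ?thesis using x pos[of x0] by (simp add: field_simps)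
  qed
  then show ?thesis using C pos[of x0] by (intro exI[of _ "C * 2 * x0 powr (- (\<beta> + \<beta>)) / G x0"] conjI exI[of _ x0]) auto
qed

lemma polynomial_upper_bound:
  assumes "0 < \<delta>" "\<delta> \<le> \<beta>"
  shows "\<exists>C>0. \<exists>x0>0. \<forall>x\<ge>x0. G x \<le> C * x powr (\<delta> - \<beta>)"
proof -
  obtain C x0 where C: "0 < C" "0 < x0" and
    P: "\<And>x y. x0 \<le> x \<Longrightarrow> x0 \<le> y \<Longrightarrow> G x \<le> C * ((x / y) powr (- (\<beta> + \<delta>)) + (x / y) powr (\<delta> - \<beta>)) * G y"
    using potter[OF assms] by blast
  have "G x \<le> (C * 2 * G x0 / x0 powr (\<delta> - \<beta>)) * x powr (\<delta> - \<beta>)" if "x0 \<le> x" for x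
  proof -
    have x: "0 < x" "0 < x0" using that C by auto
    have le: "(x / x0) powr (- (\<beta> + \<delta>)) \<le> (x / x0) powr (\<delta> - \<beta>)"
      using x that assms by (intro powr_mono) auto
    have "G x \<le> C * ((x / x0) powr (- (\<beta> + \<delta>)) + (x / x0) powr (\<delta> - \<beta>)) * G x0"
      by (rule P) (use that in auto)
    also have "\<dots> \<le> C * ((x / x0) powr (\<delta> - \<beta>) + (x / x0) powr (\<delta> - \<beta>)) * G x0"
      using le x C pos[of x0] by (intro mult_right_mono mult_left_mono add_right_mono) auto
    also have "\<dots> = (C * 2 * G x0 / x0 powr (\<delta> - \<beta>)) * x powr (\<delta> - \<beta>)"
      using x by (subst (1 2) powr_divide) (auto simp: field_simps)
    finally show ?thesis .
  qed
  then show ?thesis using C pos[of x0] by (intro exI[of _ "C * 2 * G x0 / x0 powr (\<delta> - \<beta>)"] conjI exI[of _ x0]) auto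
qed

end

section \<open>Sums of independent identically distributed variables\<close>

text \<open>Bonferroni's inequality with ordered pairs: each intersection is subtracted twice, which
  leaves the surplus \<open>real j * t\<close> in the induction step.\<close>

lemma (in prob_space) prob_UN_ge:
  fixes A :: "nat \<Rightarrow> 'a set"
  assumes "\<And>i. i < j \<Longrightarrow> A i \<in> events"
    and "\<And>i. i < j \<Longrightarrow> r \<le> prob (A i)"
    and "\<And>i l. i < l \<Longrightarrow> l < j \<Longrightarrow> prob (A i \<inter> A l) \<le> t"
  shows "real j * r - real j * (real j - 1) * t \<le> prob (\<Union>i<j. A i)"
  using assms
proof (induction j)
  case (Suc j)
  let ?U = "\<Union>i<j. A i"
  have U: "?U \<in> events" "A j \<in> events" using Suc.prems(1) by auto
  have IH: "real j * r - real j * (real j - 1) * t \<le> prob ?U" using Suc by simp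
  have "prob (?U \<inter> A j) = prob (\<Union>i<j. A i \<inter> A j)" by simp
  also have "\<dots> \<le> (\<Sum>i<j. prob (A i \<inter> A j))"
    using Suc.prems(1) U by (intro finite_measure_subadditive_finite) auto
  also have "\<dots> \<le> (\<Sum>i<j. t)" by (intro sum_mono Suc.prems(3)) auto
  finally have int: "prob (?U \<inter> A j) \<le> real j * t" by simp
  have "prob (\<Union>i<Suc j. A i) = prob (?U \<union> A j)" by (simp add: lessThan_Suc Un_commute)
  also have "\<dots> = prob ?U + prob (A j) - prob (?U \<inter> A j)"
    using U by (simp add: measure_Un3 fmeasurable_eq_sets)
  also have "\<dots> \<ge> (real j * r - real j * (real j - 1) * t) + r - real j * t"
    using IH int Suc.prems(2)[of j] by simp
  finally have "(real j * r - real j * (real j - 1) * t) + r - real j * t \<le> prob (\<Union>i<Suc j. A i)" .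
  moreover have "0 \<le> real j * t"
    using int by (meson measure_nonneg order_trans)
  ultimately show ?case by (simp add: algebra_simps)
qed simp

text \<open>The convex exponential lies below its chord on [0, 1]. This bounds exponential moments
  of variables with values in [0, 1] by their means.\<close>

lemma powr_le_chord:
  fixes A t :: real
  assumes "0 < A" "0 \<le> t" "t \<le> 1"
  shows "A powr t \<le> 1 + t * (A - 1)"
proof -
  have "exp ((1 - t) *\<^sub>R 0 + t *\<^sub>R ln A) \<le> (1 - t) * exp 0 + t * exp (ln A)"
    by (rule convex_onD[OF exp_convex]) (use assms in auto)
  then show ?thesis using assms by (simp add: powr_def algebra_simps)
qed

locale iid_sums = prob_space M for M :: "'a measure" +
  fixes X :: "nat \<Rightarrow> 'a \<Rightarrow> real"
  assumes indep: "indep_vars (\<lambda>_. borel) X UNIV"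
    and ident: "distr M borel (X i) = distr M borel (X 0)"
begin

abbreviation "S k \<equiv> partial_sum X k"

definition tail :: "real \<Rightarrow> real" where "tail z = prob {x \<in> space M. z \<le> X 0 x}"

text \<open>Values from \<open>h\<close> on are sent to 0 and not to \<open>h\<close>, because large
  jumps are counted separately. Negative values are dropped, so a sum of truncations dominates any
  sum whose terms all stay below \<open>h\<close>.\<close>

definition trunc :: "real \<Rightarrow> real \<Rightarrow> real" where "trunc h v = (if v < h then max 0 v else 0)"

definition trunc_mean :: "real \<Rightarrow> real" where "trunc_mean h = expectation (\<lambda>x. trunc h (X 0 x))"

lemma X_measurable [measurable]: "X i \<in> borel_measurable M"
  using indep unfolding indep_vars_def by auto

lemma S_measurable [measurable]: "S k \<in> borel_measurable M"
  unfolding partial_sum_def by measurable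

lemma trunc_measurable [measurable]: "trunc h \<in> borel_measurable borel"
  unfolding trunc_def by measurable

lemma trunc_bounds: "0 \<le> h \<Longrightarrow> 0 \<le> trunc h v" "0 \<le> h \<Longrightarrow> trunc h v \<le> h"
  by (auto simp: trunc_def)

lemma tail_eq: "prob {x \<in> space M. z \<le> X i x} = tail z"
proof -
  have "measure (distr M borel (X i)) {z..} = measure (distr M borel (X 0)) {z..}" by (simp only: ident[of i])
  then show ?thesis
    by (simp add: measure_distr tail_def vimage_def Int_def conj_commute)
qed

lemma tail_eq_distr: "measure (distr M borel (X 0)) {z..} = tail z"
  by (simp add: measure_distr tail_def vimage_def Int_def conj_commute)

lemma tail_antimono: "y \<le> z \<Longrightarrow> tail z \<le> tail y"
  unfolding tail_def by (intro finite_measure_mono) auto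

lemma tail_bounds: "0 \<le> tail z" "tail z \<le> 1" by (auto simp: tail_def)

section \<open>Lower bounds from a single large jump\<close>

text \<open>By independence the law of a sum is a convolution, so only the number of indices
  matters. Thus the sum without one index can be replaced in law by
  \<open>S (k - 1)\<close>.\<close>

lemma distr_sum_eq:
  assumes "finite I" "finite J" "card I = card J"
  shows "distr M borel (\<lambda>x. \<Sum>i\<in>I. X i x) = distr M borel (\<lambda>x. \<Sum>i\<in>J. X i x)"
  using assms
proof (induction I arbitrary: J rule: finite_induct)
  case empty
  then show ?case by simp
next
  case (insert i I)
  have "card J = Suc (card I)" using insert by simp
  then obtain j J' where J: "J = insert j J'" "j \<notin> J'" "card J' = card I" "finite J'"
    using insert.prems by (auto simp: card_Suc_eq)
  have *: "distr M borel (\<lambda>x. \<Sum>i\<in>insert i I. X i x) =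
      convolution (distr M borel (X i)) (distr M borel (\<lambda>x. \<Sum>i\<in>I. X i x))"
    if "finite I" "i \<notin> I" for i I
  proof -
    have "indep_var borel (X i) borel (\<lambda>x. \<Sum>i\<in>I. X i x)"
      using that by (intro indep_vars_sum indep_vars_subset[OF indep]) auto
    from sum_indep_random_variable[OF this] that show ?thesis by simp
  qed
  have "distr M borel (\<lambda>x. \<Sum>i\<in>I. X i x) = distr M borel (\<lambda>x. \<Sum>i\<in>J'. X i x)"
    using insert.IH J insert.prems by simp
  then show ?case
    unfolding J(1) *[OF insert.hyps] *[OF J(4) J(2)] ident[of i] ident[of j] by (rule arg_cong)
qed

lemma prob_jump_and_rest:
  assumes "i < k"
  shows "prob {x \<in> space M. z \<le> X i x \<and> w \<le> (\<Sum>j\<in>{..<k} - {i}. X j x)} =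
    tail z * prob {x \<in> space M. w \<le> S (k - 1) x}"
proof -
  let ?R = "\<lambda>x. \<Sum>j\<in>{..<k} - {i}. X j x"
  have iv: "indep_var borel (X i) borel ?R"
    by (intro indep_vars_sum indep_vars_subset[OF indep]) auto
  have "prob ((\<lambda>x. (X i x, ?R x)) -` ({z..} \<times> {w..}) \<inter> space M) =
      prob (X i -` {z..} \<inter> space M) * prob (?R -` {w..} \<inter> space M)"
    by (rule indep_varD[OF iv]) auto
  moreover have "measure (distr M borel ?R) {w..} = measure (distr M borel (S (k - 1))) {w..}"
    using distr_sum_eq[of "{..<k} - {i}" "{..<k - 1}"] assms
    by (simp add: partial_sum_def[abs_def])
  ultimately show ?thesis using tail_eq[of z i]
    by (simp add: measure_distr vimage_def Int_def conj_commute)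
qed

lemma prob_two_jumps:
  assumes "i \<noteq> l"
  shows "prob {x \<in> space M. z \<le> X i x \<and> z \<le> X l x} = (tail z)\<^sup>2"
proof -
  \<comment> \<open>Writing \<open>X l\<close> as a sum over a singleton reduces pairwise
    independence to the independence of a variable and a disjoint sum.\<close>
  have iv: "indep_var borel (X i) borel (\<lambda>x. \<Sum>j\<in>{l}. X j x)"
    using assms by (intro indep_vars_sum indep_vars_subset[OF indep]) auto
  have "prob ((\<lambda>x. (X i x, \<Sum>j\<in>{l}. X j x)) -` ({z..} \<times> {z..}) \<inter> space M) =
      prob (X i -` {z..} \<inter> space M) * prob ((\<lambda>x. \<Sum>j\<in>{l}. X j x) -` {z..} \<inter> space M)"
    by (rule indep_varD[OF iv]) auto
  then show ?thesis using tail_eq[of z i] tail_eq[of z l]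
    by (simp add: vimage_def Int_def conj_commute power2_eq_square)
qed

lemma prob_sum_ge_lower:
  assumes "j \<le> k"
  shows "real j * (tail z * prob {x \<in> space M. w \<le> S (k - 1) x}) - real j * (real j - 1) * (tail z)\<^sup>2
    \<le> prob {x \<in> space M. z + w \<le> S k x}"
proof -
  define A where "A i = {x \<in> space M. z \<le> X i x \<and> w \<le> (\<Sum>j\<in>{..<k} - {i}. X j x)}" for i
  have A[measurable]: "A i \<in> events" for i unfolding A_def by measurable
  have "real j * (tail z * prob {x \<in> space M. w \<le> S (k - 1) x}) - real j * (real j - 1) * (tail z)\<^sup>2
      \<le> prob (\<Union>i<j. A i)"
  proof (rule prob_UN_ge)
    fix i assume "i < j" then show "tail z * prob {x \<in> space M. w \<le> S (k - 1) x} \<le> prob (A i)"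
      unfolding A_def using assms by (subst prob_jump_and_rest) auto
  next
    fix i l assume "i < l" "l < j"
    then have "prob {x \<in> space M. z \<le> X i x \<and> z \<le> X l x} = (tail z)\<^sup>2" by (intro prob_two_jumps) auto
    moreover have "prob (A i \<inter> A l) \<le> prob {x \<in> space M. z \<le> X i x \<and> z \<le> X l x}"
      by (intro finite_measure_mono) (auto simp: A_def)
    ultimately show "prob (A i \<inter> A l) \<le> (tail z)\<^sup>2" by simp
  qed simp
  also have "\<dots> \<le> prob {x \<in> space M. z + w \<le> S k x}"
  proof (intro finite_measure_mono subsetI)
    fix x assume "x \<in> (\<Union>i<j. A i)"
    then obtain i where i: "i < j" "x \<in> A i" by auto
    then have "S k x = X i x + (\<Sum>j\<in>{..<k} - {i}. X j x)"
      using assms unfolding partial_sum_def by (intro sum.remove) auto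
    then show "x \<in> {x \<in> space M. z + w \<le> S k x}" using i by (auto simp: A_def)
  qed simp
  finally show ?thesis .
qed

text \<open>A jump above \<open>2 * y\<close> and a rest above \<open>- y\<close> put the sum above
  \<open>y\<close>. Read backwards, this extracts smallness of the jump rate from tightness of the
  sums.\<close>

lemma jump_rate_bound:
  assumes k: "1 \<le> k" and small: "prob {x \<in> space M. y \<le> S k x} < 1 / 8"
    and rest: "3 / 4 \<le> prob {x \<in> space M. - y \<le> S (k - 1) x}"
  shows "real k * tail (2 * y) \<le> 2 * prob {x \<in> space M. y \<le> S k x}"
proof -
  let ?q = "tail (2 * y)" and ?P = "prob {x \<in> space M. y \<le> S k x}"
    and ?F = "prob {x \<in> space M. - y \<le> S (k - 1) x}"
  have q: "0 \<le> ?q" by (rule tail_bounds)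
  have low: "real j * ?q * (3 / 4) - real j * (real j - 1) * ?q\<^sup>2 \<le> ?P" if "j \<le> k" for j
  proof -
    have "real j * ?q * (3 / 4) \<le> real j * ?q * ?F" using rest q by (intro mult_left_mono) auto
    then show ?thesis using prob_sum_ge_lower[OF that, of "2 * y" "- y"] by (simp add: mult.assoc)
  qed
  have le: "real k * ?q \<le> 1 / 4"
  proof (rule ccontr)
    assume "\<not> ?thesis"
    then have ex: "1 / 4 \<le> real k * ?q" by simp
    \<comment> \<open>If the rate exceeded 1/4, stop at the first \<open>j\<close> where it reaches
      1/4. The first \<open>j - 1\<close> summands still have rate below 1/4, so the correction is
      at most a third of the main term, and half of \<open>real j * ?q\<close>, hence at least 1/8,
      survives.\<close>
    define j where "j = (LEAST j. 1 / 4 \<le> real j * ?q)"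
    have j: "1 / 4 \<le> real j * ?q" unfolding j_def using ex by (rule LeastI)
    have jk: "j \<le> k" unfolding j_def using ex by (rule Least_le)
    have "j \<noteq> 0" using j by (intro notI) simp
    then obtain i where i: "j = Suc i" by (cases j) auto
    have "\<not> 1 / 4 \<le> real i * ?q" using not_less_Least[of i "\<lambda>j. 1 / 4 \<le> real j * ?q"] i j_def by auto
    then have "real i * ?q * (real j * ?q) \<le> 1 / 4 * (real j * ?q)" using q by (intro mult_right_mono) auto
    then have "real j * (real j - 1) * ?q\<^sup>2 \<le> 1 / 4 * (real j * ?q)"
      by (simp add: i power2_eq_square mult_ac)
    then show False using low[OF jk] j small by simp
  qed
  have "real k * (real k - 1) * ?q\<^sup>2 = (real k - 1) * ?q * (real k * ?q)"
    by (simp add: power2_eq_square mult_ac)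
  also have "\<dots> \<le> 1 / 4 * (real k * ?q)"
    using le q by (intro mult_right_mono) (auto simp: algebra_simps)
  finally show ?thesis using low[of k] by simp
qed

section \<open>Upper bounds through truncated positive parts\<close>

lemma trunc_integrable [simp]: "integrable M (\<lambda>x. trunc h (X i x))" if "0 \<le> h"
  by (rule integrable_const_bound[of _ h]) (use trunc_bounds[OF that] in auto)

lemma trunc_mean_eq: "expectation (\<lambda>x. trunc h (X i x)) = trunc_mean h"
proof -
  have "integral\<^sup>L (distr M borel (X i)) (trunc h) = integral\<^sup>L (distr M borel (X 0)) (trunc h)"
    by (simp only: ident[of i])
  then show ?thesis unfolding trunc_mean_def by (subst (asm) (1 2) integral_distr) auto
qed

lemma trunc_mean_bounds: "0 \<le> h \<Longrightarrow> 0 \<le> trunc_mean h" "0 \<le> h \<Longrightarrow> trunc_mean h \<le> h"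
  unfolding trunc_mean_def
  subgoal by (intro integral_nonneg_AE) (auto simp: trunc_bounds)
  subgoal by (intro integral_le_const) (auto simp: trunc_bounds)
  done

text \<open>Doubling the level only adds values in [h, 2h). This is the recursion to which
  \<open>dyadic_bound\<close> is applied.\<close>

lemma trunc_mean_double:
  assumes "0 \<le> h"
  shows "trunc_mean (2 * h) \<le> trunc_mean h + 2 * h * tail h"
proof -
  have "trunc_mean (2 * h) \<le> expectation (\<lambda>x. trunc h (X 0 x) + 2 * h * indicator {x \<in> space M. h \<le> X 0 x} x)"
    unfolding trunc_mean_def
  proof (rule integral_mono)
    show "integrable M (\<lambda>x. trunc h (X 0 x) + 2 * h * indicator {x \<in> space M. h \<le> X 0 x} x)"
      using assms by (intro Bochner_Integration.integrable_add integrable_mult_right integrable_real_indicator)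
        (auto simp: less_top[symmetric])
    fix x assume "x \<in> space M"
    then show "trunc (2 * h) (X 0 x) \<le> trunc h (X 0 x) + 2 * h * indicator {x \<in> space M. h \<le> X 0 x} x"
      using assms by (auto simp: trunc_def indicator_def)
  qed (use assms in auto)
  also have "\<dots> = trunc_mean h + 2 * h * tail h"
    using assms unfolding trunc_mean_def tail_def
    by (subst Bochner_Integration.integral_add) (auto simp: less_top[symmetric])
  finally show ?thesis .
qed

text \<open>Chernoff's method with base \<open>1 / V\<close>: by the chord inequality each factor
  has mean at most \<open>exp (trunc_mean h / h / V)\<close>, so the product has mean at most
  \<open>exp 1\<close>, and Markov's inequality yields a power of \<open>V\<close> of any order
  \<open>N\<close>. For \<open>V > 1\<close> the bound exceeds 1.\<close>

lemma trunc_sum_exponential_bound: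
  assumes h: "0 < h" and "0 < V" and V: "real k * trunc_mean h / h \<le> V" and "0 \<le> N"
  shows "prob {x \<in> space M. N * h \<le> (\<Sum>i<k. trunc h (X i x))} \<le> exp 1 * V powr N"
proof (cases "1 < V")
  case True
  have "1 * 1 \<le> exp 1 * V powr N" using True assms by (intro mult_mono ge_one_powr_ge_zero) auto
  then show ?thesis by (intro order_trans[OF prob_le_1]) simp
next
  case False
  define A where "A = 1 / V"
  have A: "1 \<le> A" "0 < A" "A * V = 1" using False assms by (auto simp: A_def)
  define E where "E i x = A powr (trunc h (X i x) / h)" for i x
  have [measurable]: "E i \<in> borel_measurable M" for i unfolding E_def by measurable
  have E_le: "E i x \<le> 1 + trunc h (X i x) / h * (A - 1)" for i x
    unfolding E_def using A h trunc_bounds[of h] by (intro powr_le_chord) auto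
  have E0: "0 \<le> E i x" for i x by (simp add: E_def)
  have EA: "E i x \<le> A" for i x
    unfolding E_def using A h trunc_bounds[of h] powr_mono[of "trunc h (X i x) / h" 1 A] by auto
  have E_int: "integrable M (E i)" for i
    by (rule integrable_const_bound[of _ A]) (use E0 EA in auto)
  have E_mean: "expectation (E i) \<le> exp (trunc_mean h / h * A)" for i
  proof -
    have "expectation (E i) \<le> expectation (\<lambda>x. 1 + trunc h (X i x) / h * (A - 1))"
      using h by (intro integral_mono E_int E_le Bochner_Integration.integrable_add integrable_mult_left integrable_divide) auto
    also have "\<dots> = 1 + trunc_mean h / h * (A - 1)"
      using h trunc_mean_eq[of h i]
      by (subst Bochner_Integration.integral_add) (auto simp: prob_space)
    also have "\<dots> \<le> 1 + trunc_mean h / h * A"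
      using h trunc_mean_bounds[of h] by (intro add_left_mono mult_left_mono) auto
    also have "\<dots> \<le> exp (trunc_mean h / h * A)" by (rule exp_ge_add_one_self)
    finally show ?thesis .
  qed
  have iv: "indep_vars (\<lambda>_. borel) E {..<k}"
    unfolding E_def
    by (rule indep_vars_compose2[OF indep_vars_subset[OF indep], where Y = "\<lambda>_ v. A powr (trunc h v / h)"]) auto
  have prod: "expectation (\<lambda>x. \<Prod>i<k. E i x) = (\<Prod>i<k. expectation (E i))"
    and prod_int: "integrable M (\<lambda>x. \<Prod>i<k. E i x)"
    by (rule indep_vars_lebesgue_integral indep_vars_integrable; use iv E_int in simp)+
  have prod_eq: "(\<Prod>i<k. E i x) = A powr ((\<Sum>i<k. trunc h (X i x)) / h)" for x
    unfolding E_def sum_divide_distrib using A by (subst powr_sum) auto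
  have "prob {x \<in> space M. N * h \<le> (\<Sum>i<k. trunc h (X i x))} \<le> prob {x \<in> space M. A powr N \<le> (\<Prod>i<k. E i x)}"
    using h A by (intro finite_measure_mono) (auto simp: prod_eq pos_le_divide_eq intro!: powr_mono)
  also have "\<dots> \<le> expectation (\<lambda>x. \<Prod>i<k. E i x) / A powr N"
    by (rule integral_Markov_inequality_measure[where A = "space M"]) (use prod_int A in \<open>auto intro: prod_nonneg E0\<close>)
  also have "\<dots> \<le> exp 1 / A powr N"
  proof (rule divide_right_mono)
    have "(\<Prod>i<k. expectation (E i)) \<le> (\<Prod>i<k. exp (trunc_mean h / h * A))"
      by (intro prod_mono conjI E_mean integral_nonneg_AE) (auto simp: E0)
    also have "\<dots> = exp (real k * (trunc_mean h / h * A))"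
      by (subst exp_of_nat_mult) simp
    also have "\<dots> \<le> exp 1"
      using mult_left_mono[OF V less_imp_le[OF A(2)]] A by (simp add: mult_ac)
    finally show "expectation (\<lambda>x. \<Prod>i<k. E i x) \<le> exp 1" by (simp add: prod)
  qed simp
  also have "\<dots> = exp 1 * V powr N" using assms by (simp add: A_def powr_divide)
  finally show ?thesis .
qed

lemma prob_some_jump_le: "prob {x \<in> space M. \<exists>i<k. z \<le> X i x} \<le> real k * tail z"
proof -
  have "{x \<in> space M. \<exists>i<k. z \<le> X i x} = (\<Union>i<k. {x \<in> space M. z \<le> X i x})" by auto
  also have "prob \<dots> \<le> (\<Sum>i<k. prob {x \<in> space M. z \<le> X i x})"
    by (rule finite_measure_subadditive_finite) auto
  also have "\<dots> = real k * tail z" by (simp only: tail_eq) simp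
  finally show ?thesis .
qed

lemma prob_sum_ge_upper1:
  "prob {x \<in> space M. y \<le> S k x} \<le> real k * tail h + prob {x \<in> space M. y \<le> (\<Sum>i<k. trunc h (X i x))}"
proof -
  have "prob {x \<in> space M. y \<le> S k x}
      \<le> prob ({x \<in> space M. \<exists>i<k. h \<le> X i x} \<union> {x \<in> space M. y \<le> (\<Sum>i<k. trunc h (X i x))})"
  proof (intro finite_measure_mono subsetI)
    fix x assume x: "x \<in> {x \<in> space M. y \<le> S k x}"
    show "x \<in> {x \<in> space M. \<exists>i<k. h \<le> X i x} \<union> {x \<in> space M. y \<le> (\<Sum>i<k. trunc h (X i x))}"
    proof (cases "\<exists>i<k. h \<le> X i x")
      case False
      then have "S k x \<le> (\<Sum>i<k. trunc h (X i x))"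
        unfolding partial_sum_def by (intro sum_mono) (auto simp: trunc_def)
      then show ?thesis using x by auto
    qed (use x in auto)
  qed auto
  also have "\<dots> \<le> prob {x \<in> space M. \<exists>i<k. h \<le> X i x} + prob {x \<in> space M. y \<le> (\<Sum>i<k. trunc h (X i x))}"
    by (rule measure_Un_le) auto
  finally show ?thesis using prob_some_jump_le[of k h] by simp
qed

text \<open>Three ways to reach \<open>y\<close>: a summand of size at least \<open>c\<close>, two
  summands of size at least \<open>h\<close>, or at most one of size at least \<open>h\<close>,
  which stays below \<open>c\<close> and leaves \<open>y - c\<close> to the truncated summands. Only
  the first is of leading order in the application.\<close>

lemma prob_sum_ge_upper2:
  assumes "0 \<le> h" "h \<le> c"
  shows "prob {x \<in> space M. y \<le> S k x} \<le> real k * tail c + (real k * tail h)\<^sup>2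
    + prob {x \<in> space M. y - c \<le> (\<Sum>i<k. trunc h (X i x))}"
proof -
  define A where "A = {x \<in> space M. \<exists>i<k. c \<le> X i x}"
  define T where "T i l = {x \<in> space M. h \<le> X i x \<and> h \<le> X l x}" for i l
  define B where "B = (\<Union>i<k. \<Union>l\<in>{..<k} - {i}. T i l)"
  define C where "C = {x \<in> space M. y - c \<le> (\<Sum>i<k. trunc h (X i x))}"
  have [measurable]: "A \<in> events" "C \<in> events" unfolding A_def C_def by measurable
  have T: "T i l \<in> events" for i l unfolding T_def by measurable
  have U: "(\<Union>l\<in>{..<k} - {i}. T i l) \<in> events" for i using T by (intro sets.finite_UN) auto
  have [measurable]: "B \<in> events" unfolding B_def using T by (intro sets.finite_UN) auto
  have "prob B \<le> (\<Sum>i<k. prob (\<Union>l\<in>{..<k} - {i}. T i l))"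
    unfolding B_def using U by (intro finite_measure_subadditive_finite) blast+
  also have "\<dots> \<le> (\<Sum>i<k. real k * (tail h)\<^sup>2)"
  proof (rule sum_mono)
    fix i
    have "prob (\<Union>l\<in>{..<k} - {i}. T i l)
        \<le> (\<Sum>l\<in>{..<k} - {i}. prob (T i l))"
      using T by (intro finite_measure_subadditive_finite) auto
    also have "\<dots> = (\<Sum>l\<in>{..<k} - {i}. (tail h)\<^sup>2)"
      unfolding T_def by (intro sum.cong refl prob_two_jumps) blast
    also have "\<dots> = real (card ({..<k} - {i})) * (tail h)\<^sup>2" by simp
    also have "\<dots> \<le> real k * (tail h)\<^sup>2"
      using card_mono[of "{..<k}" "{..<k} - {i}"] by (intro mult_right_mono) auto
    finally show "prob (\<Union>l\<in>{..<k} - {i}. T i l) \<le> real k * (tail h)\<^sup>2" .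
  qed
  finally have B: "prob B \<le> (real k * tail h)\<^sup>2" by (simp add: power2_eq_square mult_ac)
  have "prob {x \<in> space M. y \<le> S k x} \<le> prob (A \<union> B \<union> C)"
  proof (intro finite_measure_mono subsetI)
    fix x assume x: "x \<in> {x \<in> space M. y \<le> S k x}"
    show "x \<in> A \<union> B \<union> C"
    proof (rule ccontr)
      assume neg: "x \<notin> A \<union> B \<union> C"
      have xM: "x \<in> space M" using x by blast
      have c: "X i x < c" if "i < k" for i
      proof (rule ccontr)
        assume "\<not> X i x < c"
        then have "x \<in> A" using xM that by (auto simp: A_def not_less)
        then show False using neg by blast
      qed
      have two: "X l x < h" if "i < k" "h \<le> X i x" "l \<in> {..<k} - {i}" for i l
      proof (rule ccontr)
        assume "\<not> X l x < h"
        then have "x \<in> T i l" using xM that by (simp add: T_def)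
        then have "x \<in> B" unfolding B_def using that by blast
        then show False using neg by blast
      qed
      have "S k x \<le> c + (\<Sum>i<k. trunc h (X i x))"
      proof (cases "\<exists>i<k. h \<le> X i x")
        case True
        then obtain i where i: "i < k" "h \<le> X i x" by auto
        have "S k x = X i x + (\<Sum>j\<in>{..<k} - {i}. X j x)"
          unfolding partial_sum_def using i by (intro sum.remove) auto
        also have "(\<Sum>j\<in>{..<k} - {i}. X j x) \<le> (\<Sum>j\<in>{..<k} - {i}. trunc h (X j x))"
        proof (rule sum_mono)
          fix j assume "j \<in> {..<k} - {i}"
          then have "X j x < h" using two i by blast
          then show "X j x \<le> trunc h (X j x)" by (simp add: trunc_def)
        qed
        also have "\<dots> \<le> (\<Sum>j<k. trunc h (X j x))"
          by (rule sum_mono2) (use trunc_bounds(1)[OF assms(1)] in auto)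
        finally show ?thesis using c[OF i(1)] by simp
      next
        case False
        then have "S k x \<le> (\<Sum>i<k. trunc h (X i x))"
          unfolding partial_sum_def by (intro sum_mono) (auto simp: trunc_def)
        then show ?thesis using assms by simp
      qed
      then have "x \<in> C" using x by (auto simp: C_def)
      then show False using neg by blast
    qed
  qed measurable
  also have "\<dots> \<le> prob (A \<union> B) + prob C"
    by (rule measure_Un_le) measurable
  also have "prob (A \<union> B) \<le> prob A + prob B"
    by (rule measure_Un_le) measurable
  finally show ?thesis using B prob_some_jump_le[of k c] by (simp add: A_def C_def)
qed

end

section \<open>Convergence of expectations and tightness\<close>

lemma uniform_bound_below_limit:
  fixes a :: "nat \<Rightarrow> real"
  assumes "a \<longlonglongrightarrow> l" "l < c" "\<And>n. a n < c"
  shows "\<exists>q<c. \<forall>n. a n \<le> q"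
proof -
  obtain d where d: "l < d" "d < c" using dense assms(2) by blast
  have "eventually (\<lambda>n. a n < d) sequentially" using assms(1) d(1) by (rule order_tendstoD)
  then obtain N where N: "\<And>n. N \<le> n \<Longrightarrow> a n < d" by (auto simp: eventually_sequentially)
  define q where "q = Max (insert d (a ` {..<N}))"
  have "q < c" unfolding q_def using d assms(3) by (subst Max_less_iff) auto
  moreover have "a n \<le> q" for n
  proof (cases "N \<le> n")
    case True
    then have "a n \<le> d" using N by (simp add: less_imp_le)
    also have "d \<le> q" unfolding q_def by (intro Max_ge) auto
    finally show ?thesis .
  next
    case False
    then show ?thesis unfolding q_def by (intro Max_ge) auto
  qed
  ultimately show ?thesis by blast
qed

text \<open>A bounded moment of order above 1 gives uniform integrability: cutting at
  \<open>K\<close> changes every expectation by at most \<open>B' * K powr (1 - q)\<close>, and the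
  cut variables converge by dominated convergence.\<close>

lemma (in prob_space) tendsto_expectation_bounded_moment:
  fixes Y :: "nat \<Rightarrow> 'a \<Rightarrow> real" and U :: "'a \<Rightarrow> real"
  assumes [measurable]: "\<And>n. Y n \<in> borel_measurable M" "U \<in> borel_measurable M"
    and nonneg: "\<And>n x. 0 \<le> Y n x" "\<And>x. 0 \<le> U x"
    and lim: "AE x in M. (\<lambda>n. Y n x) \<longlonglongrightarrow> U x"
    and q: "1 < q" and B: "\<And>n. (\<integral>\<^sup>+x. ennreal (Y n x powr q) \<partial>M) \<le> ennreal B"
  shows "(\<lambda>n. expectation (Y n)) \<longlonglongrightarrow> expectation U"
proof -
  \<comment> \<open>\<open>ennreal\<close> sends negative reals to 0, so the bound can be taken
    nonnegative, as its reading as a real number requires.\<close>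
  define B' where "B' = max B 0"
  have B': "0 \<le> B'" "\<And>n. (\<integral>\<^sup>+x. ennreal (Y n x powr q) \<partial>M) \<le> ennreal B'"
    using B by (auto simp: B'_def intro: order_trans ennreal_leI)
  \<comment> \<open>Fatou's lemma hands the moment bound on to the limit.\<close>
  have BU: "(\<integral>\<^sup>+x. ennreal (U x powr q) \<partial>M) \<le> ennreal B'"
  proof -
    have "AE x in M. liminf (\<lambda>n. ennreal (Y n x powr q)) = ennreal (U x powr q)"
      using lim
    proof eventually_elim
      case (elim x)
      have "(\<lambda>n. Y n x powr q) \<longlonglongrightarrow> U x powr q"
        using elim nonneg q by (intro tendsto_powr') (auto intro!: always_eventually tendsto_intros)
      then have "(\<lambda>n. ennreal (Y n x powr q)) \<longlonglongrightarrow> ennreal (U x powr q)" by (rule tendsto_ennrealI)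
      then show ?case by (intro lim_imp_Liminf) auto
    qed
    then have "(\<integral>\<^sup>+x. ennreal (U x powr q) \<partial>M) = (\<integral>\<^sup>+x. liminf (\<lambda>n. ennreal (Y n x powr q)) \<partial>M)"
      by (intro nn_integral_cong_AE) auto
    also have "\<dots> \<le> liminf (\<lambda>n. \<integral>\<^sup>+x. ennreal (Y n x powr q) \<partial>M)"
      by (rule nn_integral_liminf) measurable
    also have "\<dots> \<le> ennreal B'"
      using B' by (intro Liminf_le) (auto intro!: always_eventually)
    finally show ?thesis .
  qed
  have cut: "integrable M V \<and> expectation V \<le> expectation (\<lambda>x. min (V x) K) + B' * K powr (1 - q)"
    if V[measurable]: "V \<in> borel_measurable M" and V0: "\<And>x. 0 \<le> V x"
      and VB: "(\<integral>\<^sup>+x. ennreal (V x powr q) \<partial>M) \<le> ennreal B'" and K: "0 < K" for V :: "'a \<Rightarrow> real" and K :: real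
  proof -
    have Vq: "integrable M (\<lambda>x. V x powr q)"
      using VB by (intro integrableI_nonneg) (auto intro: le_less_trans)
    have Vq_le: "expectation (\<lambda>x. V x powr q) \<le> B'"
      using VB Vq B'(1) by (subst (asm) nn_integral_eq_integral) auto
    have "V x \<le> 1 + V x powr q" for x
    proof (cases "V x \<le> 1")
      case False
      then have "V x powr 1 \<le> V x powr q" using q by (intro powr_mono) auto
      then show ?thesis using V0[of x] by simp
    qed (simp add: add_increasing2)
    then have Vi: "integrable M V"
      using V0 Vq by (intro Bochner_Integration.integrable_bound[of M "\<lambda>x. 1 + V x powr q" V]) auto
    have mi: "integrable M (\<lambda>x. min (V x) K)"
      using V0 K by (intro integrable_const_bound[of _ K]) auto
    have pt: "V x \<le> min (V x) K + V x powr q * K powr (1 - q)" for x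
    proof (cases "V x \<le> K")
      case False
      then have "V x powr (1 - q) \<le> K powr (1 - q)" using K q by (intro powr_mono2') auto
      then have "V x powr q * V x powr (1 - q) \<le> V x powr q * K powr (1 - q)" by (intro mult_left_mono) auto
      also have "V x powr q * V x powr (1 - q) = V x" using False K by (simp add: powr_add[symmetric])
      finally show ?thesis using K by (simp add: min_def split: if_splits)
    qed simp
    have "expectation V \<le> expectation (\<lambda>x. min (V x) K + V x powr q * K powr (1 - q))"
      using pt Vi mi Vq by (intro integral_mono Bochner_Integration.integrable_add integrable_mult_left) auto
    also have "\<dots> = expectation (\<lambda>x. min (V x) K) + expectation (\<lambda>x. V x powr q) * K powr (1 - q)"
      using mi Vq by (subst Bochner_Integration.integral_add) auto
    also have "\<dots> \<le> expectation (\<lambda>x. min (V x) K) + B' * K powr (1 - q)"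
      using Vq_le by (intro add_left_mono mult_right_mono) auto
    finally show ?thesis using Vi by simp
  qed
  have cut_le: "expectation (\<lambda>x. min (V x) K) \<le> expectation V"
    if "integrable M V" "\<And>x. 0 \<le> V x" "0 < K" for V :: "'a \<Rightarrow> real" and K :: real
    using that by (intro integral_mono Bochner_Integration.integrable_bound[OF that(1), of "\<lambda>x. min (V x) K"]) auto
  have mins: "(\<lambda>n. expectation (\<lambda>x. min (Y n x) K)) \<longlonglongrightarrow> expectation (\<lambda>x. min (U x) K)" if K: "0 < K" for K :: real
  proof (rule integral_dominated_convergence[where w = "\<lambda>_. K"])
    show "AE x in M. (\<lambda>n. min (Y n x) K) \<longlonglongrightarrow> min (U x) K"
      using lim by eventually_elim (intro tendsto_min tendsto_const)
    show "AE x in M. norm (min (Y n x) K) \<le> K" for n using nonneg K by auto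
  qed auto
  show ?thesis
  proof (rule LIMSEQ_I)
    fix e :: real assume e: "0 < e"
    have "((\<lambda>K. B' * K powr (1 - q)) \<longlongrightarrow> B' * 0) at_top"
      using q by (intro tendsto_intros tendsto_neg_powr filterlim_ident) auto
    then have "eventually (\<lambda>K. B' * K powr (1 - q) < e / 3 \<and> 0 < K) at_top"
      using e by (intro eventually_conj eventually_gt_at_top order_tendstoD(2)) auto
    then obtain K where K: "B' * K powr (1 - q) < e / 3" "0 < K"
      by (auto dest: eventually_happens)
    obtain N where N: "\<And>n. N \<le> n \<Longrightarrow>
        norm (expectation (\<lambda>x. min (Y n x) K) - expectation (\<lambda>x. min (U x) K)) < e / 3"
      using LIMSEQ_D[OF mins[OF K(2)], of "e / 3"] e by auto
    have cY: "integrable M (Y n)" "expectation (Y n) \<le> expectation (\<lambda>x. min (Y n x) K) + B' * K powr (1 - q)" for n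
      using cut[OF assms(1) nonneg(1) B'(2) K(2)] by blast+
    have cU: "integrable M U" "expectation U \<le> expectation (\<lambda>x. min (U x) K) + B' * K powr (1 - q)"
      using cut[OF assms(2) nonneg(2) BU K(2)] by blast+
    have lY: "expectation (\<lambda>x. min (Y n x) K) \<le> expectation (Y n)" for n
      by (rule cut_le[OF cY(1) nonneg(1) K(2)])
    have lU: "expectation (\<lambda>x. min (U x) K) \<le> expectation U"
      by (rule cut_le[OF cU(1) nonneg(2) K(2)])
    have "norm (expectation (Y n) - expectation U) < e" if "N \<le> n" for n
      using N[OF that] K(1) e cY(2)[of n] cU(2) lY[of n] lU
      unfolding real_norm_def abs_less_iff by linarith
    then show "\<exists>N. \<forall>n\<ge>N. norm (expectation (Y n) - expectation U) < e" by blast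
  qed
qed

context iid_sums
begin

text \<open>Tightness at both ends: on the scale of \<open>b\<close> the levels pass every fixed
  point, in particular continuity points where the limiting distribution function is close to 1 or
  to 0.\<close>

lemma prob_sum_tendsto:
  assumes conv: "weak_conv_m (\<lambda>k. distr M borel (\<lambda>x. S k x / b (real k))) \<nu>"
    and "real_distribution \<nu>"
    and b: "\<And>k. 1 \<le> k \<Longrightarrow> 0 < b (real k)"
    and k: "filterlim k at_top sequentially"
    and y: "filterlim (\<lambda>n. y n / b (real (k n))) at_top sequentially"
  shows "(\<lambda>n. prob {x \<in> space M. y n \<le> S (k n) x}) \<longlonglongrightarrow> 0"
    and "(\<lambda>n. prob {x \<in> space M. - y n \<le> S (k n) x}) \<longlonglongrightarrow> 1"
proof -
  interpret \<nu>: real_distribution \<nu> by fact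
  let ?F = "\<lambda>k z. prob {x \<in> space M. S k x / b (real k) \<le> z}"
  have cdf_eq: "cdf (distr M borel (\<lambda>x. S k x / b (real k))) z = ?F k z" for k z
    by (simp add: cdf_def measure_distr vimage_def Int_def conj_commute)
  have F: "(\<lambda>k. ?F k z) \<longlonglongrightarrow> cdf \<nu> z" if "isCont (cdf \<nu>) z" for z
    using conv that by (simp add: weak_conv_m_def weak_conv_def cdf_eq)
  have ctble: "countable {a. \<not> isCont (cdf \<nu>) a}"
    by (intro mono_ctble_discont monoI \<nu>.cdf_nondecreasing)
  have k1: "eventually (\<lambda>n. 1 \<le> k n) sequentially" using k by (simp add: filterlim_at_top)
  have small: "eventually (\<lambda>n. prob {x \<in> space M. y n \<le> S (k n) x} < e) sequentially" if e: "0 < e" for e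
  proof -
    have "eventually (\<lambda>z. 1 - e < cdf \<nu> z) at_top"
      using \<nu>.cdf_lim_at_top_prob e by (intro order_tendstoD(1)) auto
    then obtain z0 where z0: "\<And>z. z0 \<le> z \<Longrightarrow> 1 - e < cdf \<nu> z" by (auto simp: eventually_at_top_linorder)
    \<comment> \<open>Convergence is available at continuity points only; a monotone function has
      countably many discontinuities, so every interval contains such a point.\<close>
    obtain z where z: "z0 < z" "isCont (cdf \<nu>) z"
      using real_interval_avoid_countable_set[OF _ ctble, of z0 "z0 + 1"] by auto
    have "eventually (\<lambda>n. 1 - e < ?F (k n) z) sequentially"
      using order_tendstoD(1)[OF filterlim_compose[OF F[OF z(2)] k]] z0[of z] z by simp
    moreover have "eventually (\<lambda>n. z < y n / b (real (k n))) sequentially"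
      using y by (simp add: filterlim_at_top_dense)
    ultimately show ?thesis using k1
    proof eventually_elim
      case (elim n)
      have "prob {x \<in> space M. y n \<le> S (k n) x} \<le> prob (space M - {x \<in> space M. S (k n) x / b (real (k n)) \<le> z})"
        using elim b[of "k n"] by (intro finite_measure_mono) (auto simp: field_simps)
      also have "\<dots> = 1 - ?F (k n) z" by (rule prob_compl) measurable
      finally show ?case using elim by simp
    qed
  qed
  have small': "eventually (\<lambda>n. 1 - e < prob {x \<in> space M. - y n \<le> S (k n) x}) sequentially" if e: "0 < e" for e
  proof -
    have "eventually (\<lambda>z. cdf \<nu> z < e) at_bot"
      using \<nu>.cdf_lim_at_bot e by (intro order_tendstoD(2)) auto
    then obtain z0 where z0: "\<And>z. z \<le> z0 \<Longrightarrow> cdf \<nu> z < e" by (auto simp: eventually_at_bot_linorder)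
    obtain z where z: "z < z0" "isCont (cdf \<nu>) z"
      using real_interval_avoid_countable_set[OF _ ctble, of "z0 - 1" z0] by auto
    have "eventually (\<lambda>n. ?F (k n) z < e) sequentially"
      using order_tendstoD(2)[OF filterlim_compose[OF F[OF z(2)] k]] z0[of z] z by simp
    moreover have "eventually (\<lambda>n. - z < y n / b (real (k n))) sequentially"
      using y by (simp add: filterlim_at_top_dense)
    ultimately show ?thesis using k1
    proof eventually_elim
      case (elim n)
      have "1 - ?F (k n) z = prob (space M - {x \<in> space M. S (k n) x / b (real (k n)) \<le> z})"
        by (rule prob_compl[symmetric]) measurable
      also have "\<dots> \<le> prob {x \<in> space M. - y n \<le> S (k n) x}"
        using elim b[of "k n"] by (intro finite_measure_mono) (auto simp: field_simps)
      finally show ?case using elim by simp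
    qed
  qed
  show "(\<lambda>n. prob {x \<in> space M. y n \<le> S (k n) x}) \<longlonglongrightarrow> 0"
  proof (rule order_tendstoI)
    fix a :: real assume "a < 0"
    then show "eventually (\<lambda>n. a < prob {x \<in> space M. y n \<le> S (k n) x}) sequentially"
      by (intro always_eventually) (auto intro: less_le_trans)
  qed (rule small)
  show "(\<lambda>n. prob {x \<in> space M. - y n \<le> S (k n) x}) \<longlonglongrightarrow> 1"
  proof (rule order_tendstoI)
    fix a :: real assume "a < 1"
    then show "eventually (\<lambda>n. a < prob {x \<in> space M. - y n \<le> S (k n) x}) sequentially"
      using small'[of "1 - a"] by simp
  next
    fix a :: real assume "1 < a"
    then show "eventually (\<lambda>n. prob {x \<in> space M. - y n \<le> S (k n) x} < a) sequentially"
      by (intro always_eventually) (auto intro: le_less_trans)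
  qed
qed

end

section \<open>Galton--Watson laws\<close>

definition offspring_sum :: "nat pmf \<Rightarrow> nat \<Rightarrow> nat pmf" where
  "offspring_sum p k = map_pmf sum_list (replicate_pmf k p)"

primrec gw_pmf :: "nat pmf \<Rightarrow> nat \<Rightarrow> nat pmf" where
  "gw_pmf p 0 = return_pmf 1"
| "gw_pmf p (Suc n) = bind_pmf (gw_pmf p n) (offspring_sum p)"

definition pgf :: "nat pmf \<Rightarrow> real \<Rightarrow> real" where
  "pgf p s = measure_pmf.expectation p (\<lambda>k. s ^ k)"

lemma offspring_sum_0 [simp]: "offspring_sum p 0 = return_pmf 0"
  by (simp add: offspring_sum_def)

lemma offspring_sum_Suc:
  "offspring_sum p (Suc k) = bind_pmf p (\<lambda>x. map_pmf ((+) x) (offspring_sum p k))"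
  by (simp add: offspring_sum_def map_bind_pmf map_pmf_comp o_def map_pmf_def bind_assoc_pmf bind_return_pmf)

text \<open>In \<open>ennreal\<close> the induction is free of integrability conditions;
  \<open>ennreal_pgf\<close> transfers the result to real generating functions.\<close>

lemma nn_integral_power_offspring_sum:
  fixes s :: ennreal
  shows "(\<integral>\<^sup>+l. s ^ l \<partial>offspring_sum p k) = (\<integral>\<^sup>+j. s ^ j \<partial>p) ^ k"
  by (induction k) (simp_all add: offspring_sum_Suc power_add nn_integral_cmult nn_integral_multc)

lemma nn_integral_offspring_sum:
  "(\<integral>\<^sup>+l. of_nat l \<partial>offspring_sum p k) = of_nat k * (\<integral>\<^sup>+j. of_nat j \<partial>p)"
  by (induction k)
    (simp_all add: offspring_sum_Suc nn_integral_add algebra_simps measure_pmf.emeasure_space_1)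

lemma nn_integral_gw_pmf:
  "(\<integral>\<^sup>+k. of_nat k \<partial>gw_pmf p n) = (\<integral>\<^sup>+j. of_nat j \<partial>p) ^ n"
  by (induction n) (simp_all add: nn_integral_offspring_sum nn_integral_multc mult.commute)

section \<open>Generating functions and their iterates\<close>

lemma pgf_bounds:
  assumes "0 \<le> s" "s \<le> 1"
  shows "0 \<le> pgf p s" "pgf p s \<le> 1" "integrable (measure_pmf p) (\<lambda>k. s ^ k)"
proof -
  show int: "integrable (measure_pmf p) (\<lambda>k. s ^ k)"
    by (rule measure_pmf.integrable_const_bound[of _ 1]) (use assms in \<open>auto intro: power_le_one\<close>)
  show "0 \<le> pgf p s" unfolding pgf_def using assms by (intro integral_nonneg_AE) auto
  show "pgf p s \<le> 1" unfolding pgf_def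
    using int assms by (intro measure_pmf.integral_le_const) (auto intro: power_le_one)
qed

lemma ennreal_pgf:
  assumes "0 \<le> s" "s \<le> 1"
  shows "ennreal (pgf p s) = (\<integral>\<^sup>+k. ennreal s ^ k \<partial>p)"
proof -
  have "ennreal (pgf p s) = (\<integral>\<^sup>+k. ennreal (s ^ k) \<partial>p)"
    unfolding pgf_def using assms pgf_bounds(3)[OF assms]
    by (intro nn_integral_eq_integral[symmetric]) auto
  then show ?thesis using assms by (simp add: ennreal_power)
qed

lemma pgf_gw_pmf:
  assumes "0 \<le> s" "s \<le> 1"
  shows "pgf (gw_pmf p n) s = (pgf p ^^ n) s"
  using assms
proof (induction n arbitrary: s)
  case 0
  then show ?case by (simp add: pgf_def)
next
  case (Suc n)
  note b = pgf_bounds[OF Suc.prems]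
  have "ennreal (pgf (gw_pmf p (Suc n)) s) = ennreal (pgf (gw_pmf p n) (pgf p s))"
    using Suc.prems b by (simp add: ennreal_pgf nn_integral_power_offspring_sum)
  then have "pgf (gw_pmf p (Suc n)) s = pgf (gw_pmf p n) (pgf p s)"
    using b Suc.prems pgf_bounds by (subst (asm) ennreal_inj) auto
  then show ?case using Suc.IH b by (simp add: funpow_swap1)
qed

text \<open>With no mass at 0, every term of degree at least 2 is bounded by the square of
  \<open>s\<close>. Near 0 the generating function thus behaves at most like a line of slope
  \<open>pmf p 1\<close>.\<close>

lemma pgf_le_quadratic:
  assumes "pmf p 0 = 0" "0 \<le> s" "s \<le> 1"
  shows "pgf p s \<le> s * (pmf p 1 + (1 - pmf p 1) * s)"
proof -
  have "pgf p s \<le> measure_pmf.expectation p (\<lambda>k. s\<^sup>2 + (s - s\<^sup>2) * indicator {1} k)"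
    unfolding pgf_def
  proof (rule integral_mono_AE)
    show "AE k in measure_pmf p. s ^ k \<le> s\<^sup>2 + (s - s\<^sup>2) * indicator {1} k"
    proof (rule AE_pmfI)
      fix k assume "k \<in> set_pmf p"
      then have "k \<noteq> 0" using assms(1) by (metis pmf_eq_0_set_pmf)
      show "s ^ k \<le> s\<^sup>2 + (s - s\<^sup>2) * indicator {1} k"
      proof (cases "k = 1")
        case False
        then have "2 \<le> k" using \<open>k \<noteq> 0\<close> by simp
        then show ?thesis using False assms power_decreasing[of 2 k s] by simp
      qed simp
    qed
  qed (use pgf_bounds(3)[OF assms(2,3)] in \<open>auto intro!: integrable_real_indicator simp: less_top[symmetric]\<close>)
  also have "\<dots> = s\<^sup>2 + (s - s\<^sup>2) * pmf p 1"
    by (subst Bochner_Integration.integral_add)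
      (auto intro!: integrable_real_indicator simp: less_top[symmetric] measure_pmf_single)
  also have "\<dots> = s * (pmf p 1 + (1 - pmf p 1) * s)"
    by (simp add: algebra_simps power2_eq_square)
  finally show ?thesis .
qed

text \<open>A one-sided form of Schroeder's asymptotics. Iterates first contract by the fixed factor
  \<open>c\<close>; once small, they shrink per step by any factor \<open>\<rho>\<close> above the
  slope \<open>pmf p 1\<close> at 0. The number \<open>j0\<close> of initial steps does not depend
  on \<open>s\<close>.\<close>

lemma pgf_iterate_geometric:
  assumes "pmf p 0 = 0" "pmf p 1 < \<rho>" "\<rho> < 1" "q < 1" "0 \<le> q"
  shows "\<exists>C>0. \<forall>j. \<forall>s\<in>{0..q}. (pgf p ^^ j) s \<le> C * \<rho> ^ j"
proof -
  let ?a = "pmf p 1"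
  have a: "0 \<le> ?a" "?a < 1" "0 < \<rho>" using assms pmf_nonneg[of p 1] by linarith+
  define c where "c = ?a + (1 - ?a) * q"
  have "(1 - ?a) * q < (1 - ?a) * 1" using a assms by (intro mult_strict_left_mono) auto
  then have "c < 1" by (simp add: c_def algebra_simps)
  moreover have "0 \<le> c" using a assms by (simp add: c_def)
  ultimately have c: "0 \<le> c" "c < 1" by auto
  have "(\<lambda>j. ?a + (1 - ?a) * c ^ j) \<longlonglongrightarrow> ?a + (1 - ?a) * 0"
    using c by (intro tendsto_intros LIMSEQ_power_zero) auto
  then have "eventually (\<lambda>j. ?a + (1 - ?a) * c ^ j < \<rho>) sequentially"
    using assms order_tendstoD(2) by fastforce
  then obtain j0 where j0: "?a + (1 - ?a) * c ^ j0 < \<rho>"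
    by (auto simp: eventually_sequentially)
  \<comment> \<open>The constant \<open>1 / \<rho> ^ j0\<close> pays for the first \<open>j0\<close>
    steps, over which iterates are merely bounded by 1.\<close>
  have "(pgf p ^^ j) s \<le> (1 / \<rho> ^ j0) * \<rho> ^ j" if s: "0 \<le> s" "s \<le> q" for s j
  proof -
    let ?f = "\<lambda>j. (pgf p ^^ j) s"
    have f01: "0 \<le> ?f j" "?f j \<le> 1" for j
      by (induction j) (use s assms pgf_bounds in auto)
    have step: "?f (Suc j) \<le> ?f j * (?a + (1 - ?a) * ?f j)" for j
      using pgf_le_quadratic[OF assms(1) f01[of j]] by simp
    have fc: "?f j \<le> q \<and> ?f j \<le> c ^ j" for j
    proof (induction j)
      case (Suc j)
      have "?f j * (?a + (1 - ?a) * ?f j) \<le> ?f j * c"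
        unfolding c_def using Suc a f01[of j] by (intro mult_left_mono add_left_mono) auto
      then have 1: "?f (Suc j) \<le> ?f j * c" using step[of j] by linarith
      moreover have "?f j * c \<le> c ^ j * c" using Suc c by (intro mult_right_mono) auto
      moreover have "?f j * c \<le> ?f j * 1" using c f01[of j] by (intro mult_left_mono) auto
      ultimately have "?f (Suc j) \<le> q" "?f (Suc j) \<le> c ^ j * c" using Suc by linarith+
      then show ?case by (simp add: mult.commute)
    qed (use s assms in auto)
    have late: "?f (j0 + i) \<le> \<rho> ^ i" for i
    proof (induction i)
      case (Suc i)
      have "c ^ (j0 + i) \<le> c ^ j0" using c by (intro power_decreasing) auto
      then have "(1 - ?a) * ?f (j0 + i) \<le> (1 - ?a) * c ^ j0"
        using fc[of "j0 + i"] a by (intro mult_left_mono) linarith+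
      then have "?a + (1 - ?a) * ?f (j0 + i) \<le> \<rho>" using j0 by linarith
      then have "?f (j0 + i) * (?a + (1 - ?a) * ?f (j0 + i)) \<le> \<rho> ^ i * \<rho>"
        using Suc a f01[of "j0 + i"] by (intro mult_mono) auto
      then show ?case using step[of "j0 + i"] by (simp add: mult.commute)
    qed (use f01[of j0] in simp)
    show ?thesis
    proof (cases "j0 \<le> j")
      case True
      then obtain i where "j = j0 + i" using le_Suc_ex by blast
      then show ?thesis using late[of i] a by (simp add: power_add)
    next
      case False
      then have "\<rho> ^ j0 \<le> \<rho> ^ j" using a assms by (intro power_decreasing) auto
      then have "1 \<le> (1 / \<rho> ^ j0) * \<rho> ^ j" using a by (simp add: pos_le_divide_eq)
      then show ?thesis using f01(2)[of j] by linarith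
    qed
  qed
  then show ?thesis using a by (intro exI[of _ "1 / \<rho> ^ j0"]) auto
qed

text \<open>The left tail of \<open>Z\<^sub>n / m\<^sup>n\<close> at \<open>m\<^sup>-\<^sup>j\<close> is read off the generating function at
  \<open>exp (- m\<^sup>j\<^sup>-\<^sup>n)\<close>, which is the \<open>j\<close>-th iterate of \<open>pgf p\<close> at \<open>E exp (- Z\<^sub>n\<^sub>-\<^sub>j / m\<^sup>n\<^sup>-\<^sup>j)\<close>.\<close>

lemma gw_pmf_negative_moment:
  assumes p0: "pmf p 0 = 0" and m: "1 < m" and r: "0 < r" "pmf p 1 < m powr (- r)"
    and q: "\<And>n. pgf (gw_pmf p n) (exp (- 1 / m ^ n)) \<le> q" "q < 1"
  shows "\<exists>B. \<forall>n. (\<integral>\<^sup>+k. ennreal ((real k / m ^ n) powr (- r)) \<partial>gw_pmf p n) \<le> ennreal B"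
proof -
  obtain \<rho> where \<rho>: "pmf p 1 < \<rho>" "\<rho> < m powr (- r)" using dense r(2) by blast
  have \<rho>0: "0 < \<rho>" using \<rho> pmf_nonneg[of p 1] by linarith
  have "m powr (- r) < m powr 0" using m r by (intro powr_less_mono) auto
  then have \<rho>1: "\<rho> < 1" using \<rho> m by simp
  have q0: "0 \<le> q" using q(1)[of 0] pgf_bounds(1)[of "exp (- 1 / m ^ 0)" "gw_pmf p 0"] by simp
  obtain C where C: "0 < C" "\<And>j s. 0 \<le> s \<Longrightarrow> s \<le> q \<Longrightarrow> (pgf p ^^ j) s \<le> C * \<rho> ^ j"
    using pgf_iterate_geometric[OF p0 \<rho>(1) \<rho>1 q(2) q0] by auto
  let ?M = "m powr r"
  have M\<rho>: "0 < ?M * \<rho>" "?M * \<rho> < 1"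
    using \<rho> \<rho>0 m by (auto simp: powr_minus field_simps)
  have tail: "measure (gw_pmf p n) {k. real k \<le> m ^ (n - j)} \<le> exp 1 * C * \<rho> ^ j" if "j \<le> n" for n j
  proof -
    let ?s = "exp (- 1 / m ^ (n - j))"
    have s: "0 \<le> ?s" "?s \<le> 1" using m by auto
    have "measure (gw_pmf p n) {k. real k \<le> m ^ (n - j)} =
        measure_pmf.expectation (gw_pmf p n) (indicator {k. real k \<le> m ^ (n - j)})" by simp
    also have "\<dots> \<le> measure_pmf.expectation (gw_pmf p n) (\<lambda>k. exp 1 * ?s ^ k)"
    proof (rule integral_mono)
      show "integrable (measure_pmf (gw_pmf p n)) (\<lambda>k. exp 1 * ?s ^ k)"
        using pgf_bounds(3)[OF s] by simp
      \<comment> \<open>On the event, \<open>?s ^ k\<close> is at least \<open>exp (- 1)\<close>, so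
        the generating function dominates the left tail up to the factor
        \<open>exp 1\<close>.\<close>
      show "indicator {k. real k \<le> m ^ (n - j)} k \<le> exp 1 * ?s ^ k" for k
      proof (cases "real k \<le> m ^ (n - j)")
        case True
        then have "0 \<le> 1 + real k * (- 1 / m ^ (n - j))" using m by (simp add: field_simps)
        then have "1 \<le> exp (1 + real k * (- 1 / m ^ (n - j)))" by simp
        also have "\<dots> = exp 1 * ?s ^ k" by (simp only: exp_add exp_of_nat_mult)
        finally show ?thesis using True by simp
      qed simp
    qed (auto intro!: integrable_real_indicator simp: less_top[symmetric])
    also have "\<dots> = exp 1 * (pgf p ^^ n) ?s"
      using pgf_gw_pmf[OF s, of p n] by (simp add: pgf_def)
    also have "(pgf p ^^ n) ?s = (pgf p ^^ j) ((pgf p ^^ (n - j)) ?s)"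
      using that funpow_add[of j "n - j" "pgf p"] by simp
    also have "\<dots> = (pgf p ^^ j) (pgf (gw_pmf p (n - j)) ?s)"
      by (simp only: pgf_gw_pmf[OF s])
    also have "\<dots> \<le> C * \<rho> ^ j" using q(1)[of "n - j"] pgf_bounds(1)[OF s] by (intro C) auto
    finally show ?thesis by simp
  qed
  \<comment> \<open>Layers of ratio \<open>m\<close>: for \<open>k\<close> between m^(n-j-1) and
    m^(n-j) the negative power is at most \<open>?M ^ Suc j\<close>. Such a layer has probability of
    order at most \<open>\<rho> ^ j\<close>, and \<open>?M * \<rho> < 1\<close> makes the sum
    bounded.\<close>
  have point: "(real k / m ^ n) powr (- r)
      \<le> 1 + (\<Sum>j<n. ?M ^ Suc j * indicator {k. real k \<le> m ^ (n - j)} k)" if "k \<noteq> 0" for k n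
  proof (cases "m ^ n \<le> real k")
    case True
    then have "(real k / m ^ n) powr (- r) \<le> 1"
      using m r powr_mono2'[of "- r" 1 "real k / m ^ n"] by (auto simp: field_simps)
    moreover have "0 \<le> (\<Sum>j<n. ?M ^ Suc j * indicator {k. real k \<le> m ^ (n - j)} k)"
      by (intro sum_nonneg) auto
    ultimately show ?thesis by linarith
  next
    case False
    have k: "1 \<le> real k" using that by simp
    then have n: "m ^ n \<le> real k * m ^ n" using m by simp
    define j where "j = (LEAST j. m ^ n \<le> real k * m ^ j)"
    have j1: "m ^ n \<le> real k * m ^ j" unfolding j_def using n by (rule LeastI)
    have jn: "j \<le> n" unfolding j_def using n by (rule Least_le)
    have "j \<noteq> 0" using j1 False by (intro notI) simp
    then obtain i where i: "j = Suc i" by (cases j) auto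
    have "\<not> m ^ n \<le> real k * m ^ i" using not_less_Least[of i "\<lambda>j. m ^ n \<le> real k * m ^ j"] i j_def by auto
    then have "real k * m ^ i \<le> m ^ (n - i) * m ^ i" using jn i by (simp add: power_add[symmetric])
    then have ki: "real k \<le> m ^ (n - i)" using m by simp
    have "(real k / m ^ n) powr (- r) = (m ^ n / real k) powr r"
      using k m by (simp add: powr_minus powr_divide)
    also have "\<dots> \<le> (m ^ j) powr r" using j1 k m r by (intro powr_mono2) (auto simp: field_simps)
    also have "\<dots> = ?M ^ Suc i" using m unfolding i
      by (induction i) (simp_all add: powr_mult)
    also have "\<dots> = ?M ^ Suc i * indicator {k. real k \<le> m ^ (n - i)} k" using ki by simp
    also have "\<dots> \<le> (\<Sum>j<n. ?M ^ Suc j * indicator {k. real k \<le> m ^ (n - j)} k)"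
      using i jn by (intro member_le_sum[of i "{..<n}" "\<lambda>j. ?M ^ Suc j * indicator {k. real k \<le> m ^ (n - j)} k"]) auto
    finally show ?thesis by simp
  qed
  \<comment> \<open>Since \<open>0 ^ 0 = 1\<close>, the generating function at 0 is the mass at 0,
    and 0 is a fixed point of \<open>pgf p\<close>.\<close>
  have nz: "0 \<notin> set_pmf (gw_pmf p n)" for n
  proof -
    have "(pgf p ^^ n) 0 = 0"
    proof (induction n)
      case (Suc n)
      then show ?case using pgf_le_quadratic[OF p0, of 0] pgf_bounds(1)[of 0 p] by simp
    qed simp
    then have "measure_pmf.expectation (gw_pmf p n) (\<lambda>k. (0 :: real) ^ k) = 0"
      using pgf_gw_pmf[of 0 p n] by (simp add: pgf_def)
    moreover have "(\<lambda>k::nat. (0 :: real) ^ k) = indicator {0}" by (auto simp: indicator_def power_0_left)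
    ultimately have "pmf (gw_pmf p n) 0 = 0" by (simp add: measure_pmf_single)
    then show ?thesis by (simp add: set_pmf_eq)
  qed
  define B where "B = 1 + ?M * exp 1 * C * (1 / (1 - ?M * \<rho>))"
  have "(\<integral>\<^sup>+k. ennreal ((real k / m ^ n) powr (- r)) \<partial>gw_pmf p n) \<le> ennreal B" for n
  proof -
    have int: "integrable (measure_pmf (gw_pmf p n)) (\<lambda>k. ?M ^ Suc j * indicator {k. real k \<le> m ^ (n - j)} k)" for j
      by (intro integrable_mult_right integrable_real_indicator) (auto simp: less_top[symmetric])
    have "(\<integral>\<^sup>+k. ennreal ((real k / m ^ n) powr (- r)) \<partial>gw_pmf p n)
        \<le> (\<integral>\<^sup>+k. ennreal (1 + (\<Sum>j<n. ?M ^ Suc j * indicator {k. real k \<le> m ^ (n - j)} k)) \<partial>gw_pmf p n)"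
      by (intro nn_integral_mono_AE AE_pmfI ennreal_leI point) (metis nz)
    also have "\<dots> = ennreal (measure_pmf.expectation (gw_pmf p n)
        (\<lambda>k. 1 + (\<Sum>j<n. ?M ^ Suc j * indicator {k. real k \<le> m ^ (n - j)} k)))"
      using int by (intro nn_integral_eq_integral Bochner_Integration.integrable_add Bochner_Integration.integrable_sum)
        (auto intro!: add_nonneg_nonneg sum_nonneg)
    also have "\<dots> \<le> ennreal B"
    proof (rule ennreal_leI)
      have "measure_pmf.expectation (gw_pmf p n)
          (\<lambda>k. 1 + (\<Sum>j<n. ?M ^ Suc j * indicator {k. real k \<le> m ^ (n - j)} k)) =
          1 + (\<Sum>j<n. ?M ^ Suc j * measure (gw_pmf p n) {k. real k \<le> m ^ (n - j)})"
        by (subst Bochner_Integration.integral_add, simp, rule Bochner_Integration.integrable_sum, rule int,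
            subst Bochner_Integration.integral_sum, rule int) simp
      also have "\<dots> \<le> 1 + (\<Sum>j<n. ?M ^ Suc j * (exp 1 * C * \<rho> ^ j))"
        by (intro add_left_mono sum_mono mult_left_mono tail) auto
      also have "\<dots> = 1 + ?M * exp 1 * C * (\<Sum>j<n. (?M * \<rho>) ^ j)"
        by (simp add: sum_distrib_left power_mult_distrib mult_ac)
      also have "\<dots> \<le> 1 + ?M * exp 1 * C * (\<Sum>j. (?M * \<rho>) ^ j)"
        using M\<rho> C by (intro add_left_mono mult_left_mono sum_le_suminf summable_geometric) auto
      also have "\<dots> = B" using M\<rho> by (subst suminf_geometric) (auto simp: B_def)
      finally show "measure_pmf.expectation (gw_pmf p n)
          (\<lambda>k. 1 + (\<Sum>j<n. ?M ^ Suc j * indicator {k. real k \<le> m ^ (n - j)} k)) \<le> B" .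
    qed
    finally show ?thesis .
  qed
  then show ?thesis by blast
qed

text \<open>The law of the whole history \<open>[Z\<^sub>n, \<dots>, Z\<^sub>0]\<close>, latest generation first.\<close>

primrec gw_history :: "nat pmf \<Rightarrow> nat \<Rightarrow> nat list pmf" where
  "gw_history p 0 = return_pmf [1]"
| "gw_history p (Suc n) = bind_pmf (gw_history p n) (\<lambda>ks. map_pmf (\<lambda>l. l # ks) (offspring_sum p (hd ks)))"

lemma map_hd_gw_history: "map_pmf hd (gw_history p n) = gw_pmf p n"
proof (induction n)
  case (Suc n)
  have "map_pmf hd (gw_history p (Suc n)) = bind_pmf (gw_history p n) (\<lambda>ks. offspring_sum p (hd ks))"
    by (simp add: map_bind_pmf map_pmf_comp)
  also have "\<dots> = bind_pmf (map_pmf hd (gw_history p n)) (offspring_sum p)"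
    by (simp add: bind_map_pmf)
  finally show ?case by (simp add: Suc)
qed simp

text \<open>The new history determines the old one, so exactly one term of the mixture
  contributes.\<close>

lemma pmf_gw_history_Suc:
  "pmf (gw_history p (Suc n)) (l # ks) = pmf (gw_history p n) ks * pmf (offspring_sum p (hd ks)) l"
proof -
  have "pmf (gw_history p (Suc n)) (l # ks) =
      measure_pmf.expectation (gw_history p n) (\<lambda>ks'. pmf (offspring_sum p (hd ks)) l * indicator {ks} ks')"
    unfolding gw_history.simps pmf_bind
  proof (intro Bochner_Integration.integral_cong refl)
    fix ks'
    have inj: "inj (\<lambda>l. l # ks)" by (auto simp: inj_def)
    show "pmf (map_pmf (\<lambda>l. l # ks') (offspring_sum p (hd ks'))) (l # ks) =
        pmf (offspring_sum p (hd ks)) l * indicator {ks} ks'"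
    proof (cases "ks' = ks")
      case True
      then show ?thesis using pmf_map_inj'[OF inj, of "offspring_sum p (hd ks)" l] by simp
    next
      case False
      then have "l # ks \<notin> set_pmf (map_pmf (\<lambda>l. l # ks') (offspring_sum p (hd ks')))" by auto
      then show ?thesis using False by (simp add: pmf_eq_0_set_pmf)
    qed
  qed
  then show ?thesis by (simp add: measure_pmf_single mult.commute)
qed

lemma set_gw_history: "ks \<in> set_pmf (gw_history p n) \<Longrightarrow> length ks = Suc n"
  by (induction n arbitrary: ks) auto

text \<open>The process is given by probabilities of complete paths, so the law of the history is
  matched point by point through the recursion of \<open>gw_history\<close>; taking heads gives a
  single generation.\<close>

lemma (in prob_space) distr_galton_watson:
  assumes "galton_watson M p Z"
  shows "distr M (count_space UNIV) (Z n) = measure_pmf (gw_pmf p n)"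
proof -
  have Z[measurable]: "Z n \<in> measurable M (count_space UNIV)" for n
    using assms by (auto simp: galton_watson_def)
  define H where "H n x = rev (map (\<lambda>i. Z i x) [0..<Suc n])" for n x
  have H_Suc: "H (Suc n) x = Z (Suc n) x # H n x" for n x by (simp add: H_def)
  have H_hd: "hd (H n x) = Z n x" for n x by (simp add: H_def)
  have H_len: "length (H n x) = Suc n" for n x by (simp add: H_def)
  have H_nth: "H n x ! i = Z (n - i) x" if "i \<le> n" for n x i
    using that nth_upt[of 0 "n - i" "Suc n"] unfolding H_def by (subst rev_nth) (auto simp del: upt_Suc map_append)
  have H_eq: "H n x = ks \<longleftrightarrow> (\<forall>i\<le>n. Z i x = ks ! (n - i))" if "length ks = Suc n" for n x ks
  proof
    assume "H n x = ks"
    then show "\<forall>i\<le>n. Z i x = ks ! (n - i)" by (auto simp: H_nth)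
  next
    assume *: "\<forall>i\<le>n. Z i x = ks ! (n - i)"
    show "H n x = ks" using that by (intro nth_equalityI) (auto simp: H_len H_nth * less_Suc_eq_le)
  qed
  have HM[measurable]: "H n \<in> measurable M (count_space UNIV)" for n
  proof (subst measurable_count_space_eq_countable, simp, intro conjI ballI)
    fix ks :: "nat list"
    show "H n -` {ks} \<inter> space M \<in> events"
    proof (cases "length ks = Suc n")
      case True
      have "H n -` {ks} \<inter> space M = {x \<in> space M. \<forall>i\<le>n. Z i x = ks ! (n - i)}"
        using H_eq[OF True] by auto
      also have "\<dots> \<in> events" by measurable
      finally show ?thesis .
    next
      case False
      then have "H n -` {ks} \<inter> space M = {}" using H_len by auto
      then show ?thesis by simp
    qed
  qed simp
  have law: "prob {x \<in> space M. H n x = ks} = pmf (gw_history p n) ks" for n ks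
  proof (induction n arbitrary: ks)
    case 0
    have "AE x in M. Z 0 x = 1" using assms by (auto simp: galton_watson_def)
    then have "prob {x \<in> space M. H 0 x = ks} = prob {x \<in> space M. [1] = ks}"
      by (intro measure_eq_AE) (auto simp: H_def)
    then show ?case by (auto simp: prob_space indicator_def)
  next
    case (Suc n)
    show ?case
    proof (cases "length ks = Suc (Suc n)")
      case False
      then have "{x \<in> space M. H (Suc n) x = ks} = {}" using H_len by auto
      moreover have "pmf (gw_history p (Suc n)) ks = 0"
        using False set_gw_history by (auto simp: pmf_eq_0_set_pmf simp del: gw_history.simps)
      ultimately show ?thesis by (simp only: measure_empty)
    next
      case True
      then obtain l ks' where ks: "ks = l # ks'" "length ks' = Suc n" by (cases ks) auto
      \<comment> \<open>The list is reversed in time, so generation \<open>i\<close> stands at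
        position \<open>Suc n - i\<close>.\<close>
      define k where "k i = ks ! (Suc n - i)" for i
      have 1: "H (Suc n) x = ks \<longleftrightarrow> (\<forall>i\<le>Suc n. Z i x = k i)" for x using H_eq[OF True] by (simp add: k_def)
      have 2: "H n x = ks' \<longleftrightarrow> (\<forall>i\<le>n. Z i x = k i)" for x
        using H_eq[OF ks(2)] ks by (auto simp: k_def Suc_diff_le)
      have 3: "k n = hd ks'" "k (Suc n) = l" using ks hd_conv_nth[of ks'] by (cases ks'; simp add: k_def)+
      have "prob {x \<in> space M. \<forall>i\<le>Suc n. Z i x = k i} =
          prob {x \<in> space M. \<forall>i\<le>n. Z i x = k i} * pmf (offspring_sum p (k n)) (k (Suc n))"
        using assms by (simp only: galton_watson_def offspring_sum_def)
      then show ?thesis using Suc[of ks'] unfolding 1 2 3 by (simp add: ks(1) pmf_gw_history_Suc del: gw_history.simps)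
    qed
  qed
  have eq: "distr M (count_space UNIV) (H n) = measure_pmf (gw_history p n)"
  proof (rule measure_eqI_countable[where A = UNIV])
    fix ks
    show "emeasure (distr M (count_space UNIV) (H n)) {ks} = emeasure (measure_pmf (gw_history p n)) {ks}"
      using law[of n ks]
      by (simp add: emeasure_distr emeasure_pmf_single emeasure_eq_measure vimage_def Int_def conj_commute)
  qed auto
  have "distr M (count_space UNIV) (Z n) = distr (distr M (count_space UNIV) (H n)) (count_space UNIV) hd"
    by (subst distr_distr) (auto simp: o_def H_hd)
  also have "\<dots> = measure_pmf (map_pmf hd (gw_history p n))" by (simp add: eq map_pmf_rep_eq)
  finally show ?thesis by (simp add: map_hd_gw_history)
qed

section \<open>One big jump\<close>

lemma powr_minus_one_mult:
  fixes h :: real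
  assumes "0 < h"
  shows "h powr t = h powr (t - 1) * h"
  using assms powr_add[of h "t - 1" 1] by simp

text \<open>Indices are deterministic here: \<open>a\<close> stands for the powers of
  \<open>m\<close>, and \<open>k\<close> for one frozen path of \<open>Z\<close>.
  \<open>level\<close> places \<open>real (k n) * \<epsilon> n\<close> far above the fluctuations of
  the sum, and \<open>polynomial_level\<close> is the form in which \<alpha> < 1 enters.\<close>

locale sum_large_deviation = iid_sums M X + regularly_varying_tail "iid_sums.tail M X" \<beta>
  for M :: "'a measure" and X :: "nat \<Rightarrow> 'a \<Rightarrow> real" and \<beta> :: real +
  fixes a \<epsilon> :: "nat \<Rightarrow> real" and b :: "real \<Rightarrow> real" and \<nu> :: "real measure"
  assumes conv: "weak_conv_m (\<lambda>k. distr M borel (\<lambda>x. S k x / b (real k))) \<nu>"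
    and \<nu>: "real_distribution \<nu>"
    and b_pos: "\<And>j. 1 \<le> j \<Longrightarrow> 0 < b (real j)"
    and a_ge: "1 \<le> a n" and a_top: "filterlim a at_top sequentially"
    and \<epsilon>_pos: "0 < \<epsilon> n" and \<epsilon>_top: "filterlim \<epsilon> at_top sequentially"
    and level: "\<And>k u. (\<lambda>n. real (k n) / a n) \<longlonglongrightarrow> u \<Longrightarrow> 0 < u \<Longrightarrow>
      filterlim (\<lambda>n. real (k n) * \<epsilon> n / b (real (k n))) at_top sequentially"
    and polynomial_level: "\<exists>D. eventually (\<lambda>n. a n \<le> \<epsilon> n powr D) sequentially"
begin

section \<open>Jump rates at deterministic indices\<close>

definition rate :: "nat \<Rightarrow> real" where "rate n = a n * tail (a n * \<epsilon> n)"

lemma a_pos: "0 < a n" using a_ge[of n] by linarith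

lemma rate_pos: "0 < rate n" using a_pos pos by (simp add: rate_def)

lemma a_eps_top: "filterlim (\<lambda>n. a n * \<epsilon> n) at_top sequentially"
  by (intro filterlim_at_top_mult_at_top a_top \<epsilon>_top)

lemma k_top:
  fixes k :: "nat \<Rightarrow> nat"
  assumes "(\<lambda>n. real (k n) / a n) \<longlonglongrightarrow> u" "0 < u"
  shows "filterlim k at_top sequentially"
proof -
  have "filterlim (\<lambda>n. real (k n) / a n * a n) at_top sequentially"
    by (rule filterlim_tendsto_pos_mult_at_top[OF assms a_top])
  then have "filterlim (\<lambda>n. real (k n)) at_top sequentially"
    using a_pos by (simp add: less_imp_neq[symmetric] order.strict_implies_not_eq)
  then show ?thesis by (simp add: filterlim_sequentially_iff_filterlim_real)
qed

text \<open>The level is the moving factor \<open>c * (real (k n) / a n)\<close> times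
  \<open>a n * \<epsilon> n\<close>, which is the situation of \<open>tendsto_ratio\<close>; the
  leading \<open>u\<close> counts the summands.\<close>

lemma tail_rate:
  fixes k :: "nat \<Rightarrow> nat"
  assumes "(\<lambda>n. real (k n) / a n) \<longlonglongrightarrow> u" "0 < u" "0 < c"
  shows "(\<lambda>n. real (k n) * tail (c * (real (k n) * \<epsilon> n)) / rate n) \<longlonglongrightarrow> u * (c * u) powr (- \<beta>)"
proof -
  have "(\<lambda>n. (real (k n) / a n) * (tail ((c * (real (k n) / a n)) * (a n * \<epsilon> n)) / tail (a n * \<epsilon> n)))
      \<longlonglongrightarrow> u * (c * u) powr (- \<beta>)"
    by (intro tendsto_intros tendsto_ratio a_eps_top assms) (use assms in auto)
  moreover have "c * (real (k n) / a n) * (a n * \<epsilon> n) = c * (real (k n) * \<epsilon> n)" for n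
    using a_pos[of n] by simp
  ultimately show ?thesis by (simp add: rate_def)
qed

lemma level_scaled:
  fixes k :: "nat \<Rightarrow> nat"
  assumes "(\<lambda>n. real (k n) / a n) \<longlonglongrightarrow> u" "0 < u" "0 < c"
  shows "filterlim (\<lambda>n. c * (real (k n) * \<epsilon> n) / b (real (k n))) at_top sequentially"
  using filterlim_tendsto_pos_mult_at_top[OF tendsto_const assms(3) level[OF assms(1,2)]] by simp

text \<open>Tightness is applied along \<open>k n - 1\<close>, whose ratio to \<open>a n\<close> has
  the same limit; replacing \<open>k n - 1\<close> by \<open>k n\<close> in the level only enlarges
  the event.\<close>

lemma prob_rest:
  fixes k :: "nat \<Rightarrow> nat"
  assumes "(\<lambda>n. real (k n) / a n) \<longlonglongrightarrow> u" "0 < u" "0 < c"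
  shows "(\<lambda>n. prob {x \<in> space M. - (c * (real (k n) * \<epsilon> n)) \<le> S (k n - 1) x}) \<longlonglongrightarrow> 1"
proof -
  have lim1: "(\<lambda>n. real (k n - 1) / a n) \<longlonglongrightarrow> u"
  proof -
    have "(\<lambda>n. real (k n) / a n - 1 / a n) \<longlonglongrightarrow> u - 0"
      using a_top by (intro tendsto_intros assms tendsto_divide_0[OF tendsto_const])
        (auto intro: filterlim_at_top_imp_at_infinity)
    moreover have "eventually (\<lambda>n. real (k n) / a n - 1 / a n = real (k n - 1) / a n) sequentially"
      using k_top[OF assms(1,2)] unfolding filterlim_at_top
      by (elim allE[of _ 1]) (auto elim!: eventually_mono simp: of_nat_diff diff_divide_distrib)
    ultimately show ?thesis by (simp add: tendsto_cong)
  qed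
  have l: "(\<lambda>n. prob {x \<in> space M. - (c * (real (k n - 1) * \<epsilon> n)) \<le> S (k n - 1) x}) \<longlonglongrightarrow> 1"
    by (rule prob_sum_tendsto(2)[OF conv \<nu> b_pos k_top[OF lim1 assms(2)] level_scaled[OF lim1 assms(2,3)]])
  show ?thesis
  proof (rule tendsto_sandwich[OF _ _ l tendsto_const])
    show "eventually (\<lambda>n. prob {x \<in> space M. - (c * (real (k n - 1) * \<epsilon> n)) \<le> S (k n - 1) x}
        \<le> prob {x \<in> space M. - (c * (real (k n) * \<epsilon> n)) \<le> S (k n - 1) x}) sequentially"
    proof (intro always_eventually allI finite_measure_mono subsetI)
      fix n x assume x: "x \<in> {x \<in> space M. - (c * (real (k n - 1) * \<epsilon> n)) \<le> S (k n - 1) x}"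
      have "c * (real (k n - 1) * \<epsilon> n) \<le> c * (real (k n) * \<epsilon> n)"
        using assms(3) \<epsilon>_pos[of n] by (intro mult_left_mono mult_right_mono) auto
      then show "x \<in> {x \<in> space M. - (c * (real (k n) * \<epsilon> n)) \<le> S (k n - 1) x}" using x by auto
    qed measurable
  qed (auto intro: always_eventually)
qed

text \<open>\<open>jump_rate_bound\<close> is used at half the level, where the sum and its rest are
  controlled by tightness.\<close>

lemma jump_rate_tendsto_0:
  fixes k :: "nat \<Rightarrow> nat"
  assumes "(\<lambda>n. real (k n) / a n) \<longlonglongrightarrow> u" "0 < u" "0 < c"
  shows "(\<lambda>n. real (k n) * tail (c * (real (k n) * \<epsilon> n))) \<longlonglongrightarrow> 0"
proof -
  let ?y = "\<lambda>n. c / 2 * (real (k n) * \<epsilon> n)"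
  let ?P = "\<lambda>n. prob {x \<in> space M. ?y n \<le> S (k n) x}"
  have c: "0 < c / 2" using assms by simp
  have P: "?P \<longlonglongrightarrow> 0"
    by (rule prob_sum_tendsto(1)[OF conv \<nu> b_pos k_top[OF assms(1,2)] level_scaled[OF assms(1,2) c]])
  have "eventually (\<lambda>n. ?P n < 1 / 8) sequentially" by (rule order_tendstoD(2)[OF P]) simp
  moreover have "eventually (\<lambda>n. 3 / 4 < prob {x \<in> space M. - ?y n \<le> S (k n - 1) x}) sequentially"
    by (rule order_tendstoD(1)[OF prob_rest[OF assms(1,2) c]]) simp
  moreover have "eventually (\<lambda>n. 1 \<le> k n) sequentially"
    using k_top[OF assms(1,2)] by (simp add: filterlim_at_top)
  ultimately have ev: "eventually (\<lambda>n. real (k n) * tail (c * (real (k n) * \<epsilon> n)) \<le> 2 * ?P n) sequentially"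
  proof eventually_elim
    case (elim n)
    show ?case using jump_rate_bound[OF elim(3,1) less_imp_le[OF elim(2)]] by simp
  qed
  have lim: "(\<lambda>n. 2 * ?P n) \<longlonglongrightarrow> 0" by (rule tendsto_mult_right_zero[OF P])
  have nonneg: "eventually (\<lambda>n. 0 \<le> real (k n) * tail (c * (real (k n) * \<epsilon> n))) sequentially"
    by (intro always_eventually allI mult_nonneg_nonneg tail_bounds) simp
  show ?thesis by (rule tendsto_sandwich[OF nonneg ev tendsto_const lim])
qed

text \<open>Potter's bound with \<delta> so small that, after the factor \<open>real k\<close>
  raises them by 1, both exponents lie in [-r, r']. For large \<open>\<epsilon> n\<close> both
  arguments are in Potter's range for all \<open>k \<ge> 1\<close> at once.\<close>

lemma jump_rate_dominated:
  assumes r: "\<beta> - 1 < r" "1 - \<beta> < r'" and "0 < \<eta>"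
  shows "\<exists>C>0. eventually (\<lambda>n. \<forall>k\<ge>1. real k * tail (\<eta> * (real k * \<epsilon> n))
    \<le> C * rate n * ((real k / a n) powr (- r) + (real k / a n) powr r')) sequentially"
proof -
  define \<delta> where "\<delta> = min \<beta> (min (r - (\<beta> - 1)) (r' - (1 - \<beta>)))"
  have \<delta>: "0 < \<delta>" "\<delta> \<le> \<beta>" "\<delta> \<le> r - (\<beta> - 1)" "\<delta> \<le> r' - (1 - \<beta>)" using index_pos r by (auto simp: \<delta>_def)
  obtain C x0 where C: "0 < C" "0 < x0" and
    P: "\<And>x y. x0 \<le> x \<Longrightarrow> x0 \<le> y \<Longrightarrow> tail x \<le> C * ((x / y) powr (- (\<beta> + \<delta>)) + (x / y) powr (\<delta> - \<beta>)) * tail y"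
    using potter[OF \<delta>(1,2)] by blast
  define C' where "C' = C * (\<eta> powr (- (\<beta> + \<delta>)) + \<eta> powr (\<delta> - \<beta>))"
  have C': "0 < C'" using C assms(3) by (simp add: C'_def add_pos_pos)
  have "eventually (\<lambda>n. max (x0 / \<eta>) x0 \<le> \<epsilon> n) sequentially"
    using \<epsilon>_top unfolding filterlim_at_top by blast
  then have "eventually (\<lambda>n. \<forall>k\<ge>1. real k * tail (\<eta> * (real k * \<epsilon> n))
    \<le> C' * rate n * ((real k / a n) powr (- r) + (real k / a n) powr r')) sequentially"
  proof eventually_elim
    case (elim n)
    show ?case
    proof (intro allI impI)
      fix k :: nat assume k: "1 \<le> k"
      let ?u = "real k / a n"
      have u: "0 < ?u" using k a_pos[of n] by simp
      have "x0 \<le> \<epsilon> n * \<eta>" using elim assms(3) by (simp add: pos_divide_le_eq)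
      also have "\<dots> * 1 \<le> \<epsilon> n * \<eta> * real k" using k assms(3) \<epsilon>_pos[of n] by (intro mult_left_mono) auto
      finally have 1: "x0 \<le> \<eta> * (real k * \<epsilon> n)" by (simp add: mult_ac)
      have "x0 \<le> 1 * \<epsilon> n" using elim by simp
      also have "\<dots> \<le> a n * \<epsilon> n" using a_ge[of n] \<epsilon>_pos[of n] by (intro mult_right_mono) auto
      finally have 2: "x0 \<le> a n * \<epsilon> n" .
      have q: "\<eta> * (real k * \<epsilon> n) / (a n * \<epsilon> n) = \<eta> * ?u" using \<epsilon>_pos[of n] by simp
      have le: "(\<eta> * ?u) powr e * ?u \<le> \<eta> powr e * (?u powr (- r) + ?u powr r')"
        if "- r \<le> e + 1" "e + 1 \<le> r'" for e
      proof -
        have "(\<eta> * ?u) powr e * ?u = \<eta> powr e * ?u powr (e + 1)"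
          using u assms(3) by (simp only: powr_mult powr_add powr_one mult.assoc less_imp_le)
        also have "\<dots> \<le> \<eta> powr e * (?u powr (- r) + ?u powr r')"
          using u that by (intro mult_left_mono powr_between) auto
        finally show ?thesis .
      qed
      have "real k * tail (\<eta> * (real k * \<epsilon> n))
          \<le> real k * (C * ((\<eta> * ?u) powr (- (\<beta> + \<delta>)) + (\<eta> * ?u) powr (\<delta> - \<beta>)) * tail (a n * \<epsilon> n))"
        using P[OF 1 2] unfolding q by (intro mult_left_mono) auto
      also have "\<dots> = C * ((\<eta> * ?u) powr (- (\<beta> + \<delta>)) * ?u + (\<eta> * ?u) powr (\<delta> - \<beta>) * ?u) * rate n"
        using a_pos[of n] by (simp add: rate_def field_simps)
      also have "\<dots> \<le> C * (\<eta> powr (- (\<beta> + \<delta>)) * (?u powr (- r) + ?u powr r')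
          + \<eta> powr (\<delta> - \<beta>) * (?u powr (- r) + ?u powr r')) * rate n"
        using C \<delta> rate_pos[of n] by (intro mult_right_mono mult_left_mono add_mono le) auto
      also have "\<dots> = C' * rate n * (?u powr (- r) + ?u powr r')"
        by (simp add: C'_def algebra_simps)
      finally show "real k * tail (\<eta> * (real k * \<epsilon> n)) \<le> C' * rate n * (?u powr (- r) + ?u powr r')" .
    qed
  qed
  then show ?thesis using C' by blast
qed

section \<open>Small jumps\<close>

text \<open>For \<beta> < 1 the last dyadic block carries the truncated mean, because
  \<open>h * tail h\<close> grows geometrically under doubling. Taking half the distance from
  \<beta> to 1 as \<delta> keeps the ratio below 1.\<close>

lemma trunc_mean_le_tail:
  assumes "\<beta> < 1"
  shows "\<exists>C>0. \<exists>x0>0. \<forall>h\<ge>x0. trunc_mean h \<le> C * (h * tail h)"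
proof -
  define \<delta> where "\<delta> = (1 - \<beta>) / 2"
  have \<delta>: "0 < \<delta>" using assms by (simp add: \<delta>_def)
  obtain x0 where x0: "0 < x0" and d: "\<And>x. x0 \<le> x \<Longrightarrow> tail x \<le> 2 powr (\<beta> + \<delta>) * tail (2 * x)"
    using doubling[OF \<delta>] by blast
  have "\<exists>C>0. \<forall>h\<ge>x0. trunc_mean h \<le> C * (h * tail h)"
  proof (rule dyadic_bound[where \<kappa> = "2 powr (\<beta> + \<delta> - 1)" and c = 2 and t = "x0 * tail (2 * x0)" and B = "2 * x0"])
    have "2 powr (\<beta> + \<delta> - 1) < 2 powr (0 :: real)" using assms by (intro powr_less_mono) (auto simp: \<delta>_def field_simps)
    then show "2 powr (\<beta> + \<delta> - 1) < (1 :: real)" by simp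
    show "trunc_mean (2 * h) \<le> trunc_mean h + 2 * (h * tail h)" if "x0 \<le> h" for h
      using trunc_mean_double[of h] x0 that by simp
    show "h * tail h \<le> 2 powr (\<beta> + \<delta> - 1) * (2 * h * tail (2 * h))" if "x0 \<le> h" for h
    proof -
      have "h * tail h \<le> h * (2 powr (\<beta> + \<delta>) * tail (2 * h))"
        using d[OF that] x0 that by (intro mult_left_mono) auto
      also have "2 powr (\<beta> + \<delta>) = 2 powr (\<beta> + \<delta> - 1) * 2" by (simp add: powr_diff)
      finally show ?thesis by (simp only: mult_ac)
    qed
    show "trunc_mean h \<le> 2 * x0" if "x0 \<le> h" "h \<le> 2 * x0" for h
      using trunc_mean_bounds(2)[of h] x0 that by simp
    show "x0 * tail (2 * x0) \<le> h * tail h" if "x0 \<le> h" "h \<le> 2 * x0" for h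
      using x0 that tail_bounds(1) by (intro mult_mono tail_antimono) auto
    show "0 \<le> h * tail h" if "x0 \<le> h" for h using x0 that tail_bounds(1)[of h] by simp
    show "0 < x0 * tail (2 * x0)" using x0 pos[of "2 * x0"] by simp
  qed (use x0 in simp_all)
  then show ?thesis using x0 by blast
qed

text \<open>For \<beta> \<ge> 1 a small power of \<open>h\<close> takes the place of
  \<open>h * tail h\<close>; this includes the borderline \<beta> = 1, where the positive part may
  have infinite mean.\<close>

lemma trunc_mean_le_powr:
  assumes "1 \<le> \<beta>" "0 < \<theta>" "\<theta> < 1"
  shows "\<exists>C>0. \<exists>x0>0. \<forall>h\<ge>x0. trunc_mean h \<le> C * h powr \<theta>"
proof -
  obtain C x1 where C: "0 < C" "0 < x1" and up: "\<And>x. x1 \<le> x \<Longrightarrow> tail x \<le> C * x powr (\<theta> - \<beta>)"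
    using polynomial_upper_bound[OF assms(2)] assms(1,3) by (metis less_imp_le order_trans)
  define x0 where "x0 = max x1 1"
  have x0: "x1 \<le> x0" "1 \<le> x0" by (auto simp: x0_def)
  have "\<exists>C>0. \<forall>h\<ge>x0. trunc_mean h \<le> C * h powr \<theta>"
  proof (rule dyadic_bound[where \<kappa> = "2 powr (- \<theta>)" and c = "2 * C" and t = 1 and B = "2 * x0"])
    have "2 powr (- \<theta>) < 2 powr (0 :: real)" using assms by (intro powr_less_mono) auto
    then show "2 powr (- \<theta>) < (1 :: real)" by simp
    show "trunc_mean (2 * h) \<le> trunc_mean h + 2 * C * h powr \<theta>" if h: "x0 \<le> h" for h
    proof -
      have "h * tail h \<le> h * (C * h powr (\<theta> - \<beta>))" using up x0 h by (intro mult_left_mono) auto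
      also have "\<dots> = C * h powr (\<theta> - \<beta> + 1)" using x0 h by (simp add: powr_add)
      also have "\<dots> \<le> C * h powr \<theta>" using C x0 h assms by (intro mult_left_mono powr_mono) auto
      finally show ?thesis using trunc_mean_double[of h] x0 h by simp
    qed
    show "h powr \<theta> \<le> 2 powr (- \<theta>) * (2 * h) powr \<theta>" if "x0 \<le> h" for h
      using x0 that by (simp add: powr_mult powr_minus)
    show "trunc_mean h \<le> 2 * x0" if "x0 \<le> h" "h \<le> 2 * x0" for h
      using trunc_mean_bounds(2)[of h] x0 that by simp
    show "1 \<le> h powr \<theta>" if "x0 \<le> h" "h \<le> 2 * x0" for h
      using x0 that assms by (intro ge_one_powr_ge_zero) auto
    show "0 \<le> h powr \<theta>" for h by simp
  qed (use x0 C in simp_all)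
  moreover have "0 < x0" using x0 by linarith
  ultimately show ?thesis by blast
qed

text \<open>The square is the point: the base is of the order of the main term, so one factor
  compares with \<open>rate\<close> and the other tends to 0.\<close>

lemma small_jumps_heavy:
  assumes \<beta>: "\<beta> < 1" and \<delta>: "0 < \<delta>"
  shows "\<exists>C>0. eventually (\<lambda>n. \<forall>k\<ge>1.
      prob {x \<in> space M. \<delta> * (real k * \<epsilon> n) \<le> (\<Sum>i<k. trunc (\<delta> / 2 * (real k * \<epsilon> n)) (X i x))}
      \<le> exp 1 * (C * (real k * tail (\<delta> / 2 * (real k * \<epsilon> n)))) powr 2) sequentially"
proof -
  obtain C x0 where C: "0 < C" "0 < x0" and J: "\<And>h. x0 \<le> h \<Longrightarrow> trunc_mean h \<le> C * (h * tail h)"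
    using trunc_mean_le_tail[OF \<beta>] by blast
  have "eventually (\<lambda>n. x0 / (\<delta> / 2) \<le> \<epsilon> n) sequentially" using \<epsilon>_top unfolding filterlim_at_top by blast
  then have "eventually (\<lambda>n. \<forall>k\<ge>1.
      prob {x \<in> space M. \<delta> * (real k * \<epsilon> n) \<le> (\<Sum>i<k. trunc (\<delta> / 2 * (real k * \<epsilon> n)) (X i x))}
      \<le> exp 1 * (C * (real k * tail (\<delta> / 2 * (real k * \<epsilon> n)))) powr 2) sequentially"
  proof eventually_elim
    case (elim n)
    show ?case
    proof (intro allI impI)
      fix k :: nat assume k: "1 \<le> k"
      let ?h = "\<delta> / 2 * (real k * \<epsilon> n)"
      have "x0 \<le> \<epsilon> n * (\<delta> / 2)" using elim \<delta> by (simp add: pos_divide_le_eq)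
      also have "\<dots> * 1 \<le> \<epsilon> n * (\<delta> / 2) * real k" using k \<delta> \<epsilon>_pos[of n] by (intro mult_left_mono) auto
      finally have h: "x0 \<le> ?h" by (simp add: mult_ac)
      then have h0: "0 < ?h" using C by linarith
      have "real k * trunc_mean ?h \<le> real k * (C * (?h * tail ?h))" using J[OF h] by (intro mult_left_mono) auto
      then have "real k * trunc_mean ?h / ?h \<le> C * (real k * tail ?h)"
        using h0 by (simp only: pos_divide_le_eq) (simp add: mult_ac)
      then have "prob {x \<in> space M. 2 * ?h \<le> (\<Sum>i<k. trunc ?h (X i x))} \<le> exp 1 * (C * (real k * tail ?h)) powr 2"
        using C h0 k pos by (intro trunc_sum_exponential_bound) auto
      then show "prob {x \<in> space M. \<delta> * (real k * \<epsilon> n) \<le> (\<Sum>i<k. trunc ?h (X i x))}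
          \<le> exp 1 * (C * (real k * tail ?h)) powr 2" by simp
    qed
  qed
  then show ?thesis using C by blast
qed

text \<open>Cutting at \<open>\<delta> / N\<close> of the level makes the target equal to
  \<open>N\<close> cutting heights, so the exponential bound returns an \<open>N\<close>-th
  power.\<close>

lemma small_jumps_light:
  assumes \<beta>: "1 \<le> \<beta>" and \<delta>: "0 < \<delta>" and N: "1 \<le> N"
  shows "\<exists>C>0. eventually (\<lambda>n. \<forall>k\<ge>1.
      prob {x \<in> space M. \<delta> * (real k * \<epsilon> n) \<le> (\<Sum>i<k. trunc (\<delta> / N * (real k * \<epsilon> n)) (X i x))}
      \<le> C * (real k powr (1 / 2) * \<epsilon> n powr (1 / 2 - N))) sequentially"
proof -
  \<comment> \<open>With \<theta> N = 1/2 the exponent of \<open>k\<close> stays at 1/2 for every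
    \<open>N\<close>, within reach of the first moment of \<open>Z\<close>, while the exponent 1/2 -
    N of \<epsilon> becomes arbitrarily negative.\<close>
  define \<theta> where "\<theta> = 1 / (2 * N)"
  have \<theta>: "0 < \<theta>" "\<theta> < 1" "\<theta> * N = 1 / 2" using N by (auto simp: \<theta>_def)
  then have \<theta>4: "(\<theta> - 1) * N = 1 / 2 - N" by (simp add: algebra_simps)
  obtain C x0 where C: "0 < C" "0 < x0" and J: "\<And>h. x0 \<le> h \<Longrightarrow> trunc_mean h \<le> C * h powr \<theta>"
    using trunc_mean_le_powr[OF \<beta> \<theta>(1,2)] by blast
  let ?\<eta> = "\<delta> / N"
  have \<eta>: "0 < ?\<eta>" using \<delta> N by simp
  define C' where "C' = exp 1 * (C * ?\<eta> powr (\<theta> - 1)) powr N"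
  have C': "0 < C'" using C \<delta> N by (simp add: C'_def)
  have "eventually (\<lambda>n. x0 / ?\<eta> \<le> \<epsilon> n) sequentially" using \<epsilon>_top unfolding filterlim_at_top by blast
  then have "eventually (\<lambda>n. \<forall>k\<ge>1.
      prob {x \<in> space M. \<delta> * (real k * \<epsilon> n) \<le> (\<Sum>i<k. trunc (?\<eta> * (real k * \<epsilon> n)) (X i x))}
      \<le> C' * (real k powr (1 / 2) * \<epsilon> n powr (1 / 2 - N))) sequentially"
  proof eventually_elim
    case (elim n)
    show ?case
    proof (intro allI impI)
      fix k :: nat assume k: "1 \<le> k"
      let ?h = "?\<eta> * (real k * \<epsilon> n)"
      define V where "V = C * real k * ?h powr (\<theta> - 1)"
      have "x0 \<le> \<epsilon> n * ?\<eta>" using elim \<eta> by (simp only: pos_divide_le_eq)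
      also have "\<dots> * 1 \<le> \<epsilon> n * ?\<eta> * real k" using k \<delta> N \<epsilon>_pos[of n] by (intro mult_left_mono) auto
      finally have h: "x0 \<le> ?h" by (simp add: mult_ac)
      then have h0: "0 < ?h" using C by linarith
      have "real k * trunc_mean ?h \<le> real k * (C * ?h powr \<theta>)" using J[OF h] by (intro mult_left_mono) auto
      also have "?h powr \<theta> = ?h powr (\<theta> - 1) * ?h" by (rule powr_minus_one_mult[OF h0])
      also have "real k * (C * (?h powr (\<theta> - 1) * ?h)) = V * ?h" unfolding V_def by (simp only: mult_ac)
      finally have V: "real k * trunc_mean ?h / ?h \<le> V" using h0 by (simp only: pos_divide_le_eq)
      have "0 < ?h powr (\<theta> - 1)" unfolding powr_gt_zero using h0 by (rule less_imp_neq[THEN not_sym])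
      then have V0: "0 < V" unfolding V_def using C k by (intro mult_pos_pos) auto
      have "prob {x \<in> space M. N * ?h \<le> (\<Sum>i<k. trunc ?h (X i x))} \<le> exp 1 * V powr N"
        using N by (intro trunc_sum_exponential_bound h0 V0 V) auto
      also have "N * ?h = \<delta> * (real k * \<epsilon> n)" using N by simp
      also have "V = (C * ?\<eta> powr (\<theta> - 1)) * (real k powr \<theta> * \<epsilon> n powr (\<theta> - 1))"
        unfolding V_def powr_mult using powr_minus_one_mult[of "real k" \<theta>] k by simp
      also have "\<dots> powr N = (C * ?\<eta> powr (\<theta> - 1)) powr N * (real k powr (1 / 2) * \<epsilon> n powr (1 / 2 - N))"
        unfolding powr_mult powr_powr \<theta>(3) \<theta>4 by (simp only: mult_ac)
      finally show "prob {x \<in> space M. \<delta> * (real k * \<epsilon> n) \<le> (\<Sum>i<k. trunc ?h (X i x))}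
          \<le> C' * (real k powr (1 / 2) * \<epsilon> n powr (1 / 2 - N))" by (simp add: C'_def mult_ac)
    qed
  qed
  then show ?thesis using C' by blast
qed

text \<open>\<open>rate\<close> is bounded below by powers of \<open>a\<close> and \<epsilon>, and
  \<open>a\<close> is at most a power of \<epsilon>; a sufficiently negative power of \<epsilon>
  therefore wins.\<close>

lemma polynomial_negligible:
  "\<exists>N\<ge>1. (\<lambda>n. a n powr (1 / 2) * \<epsilon> n powr (1 / 2 - N) / rate n) \<longlonglongrightarrow> 0"
proof -
  obtain D' where D': "eventually (\<lambda>n. a n \<le> \<epsilon> n powr D') sequentially" using polynomial_level by blast
  define D where "D = max D' 0"
  obtain C x0 where C: "0 < C" "0 < x0" and low: "\<And>x. x0 \<le> x \<Longrightarrow> x powr (- (\<beta> + \<beta>)) \<le> C * tail x"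
    using polynomial_lower_bound by blast
  \<comment> \<open>Once \<open>a n\<close> is replaced by \<open>\<epsilon> n powr D\<close>, this
    \<open>N\<close> makes the total exponent of \<open>\<epsilon> n\<close> equal to -1.\<close>
  define N where "N = D * (2 * \<beta>) + 2 * \<beta> + 1 / 2 + 1"
  have "0 \<le> D * (2 * \<beta>)" using index_pos by (intro mult_nonneg_nonneg) (auto simp: D_def)
  then have N: "1 \<le> N" using index_pos by (simp add: N_def)
  have "eventually (\<lambda>n. max x0 1 \<le> \<epsilon> n) sequentially" using \<epsilon>_top unfolding filterlim_at_top by blast
  with D' have "eventually (\<lambda>n. a n powr (1 / 2) * \<epsilon> n powr (1 / 2 - N) / rate n \<le> C * \<epsilon> n powr (- 1)) sequentially"
  proof eventually_elim
    case (elim n)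
    have e: "1 \<le> \<epsilon> n" "0 < \<epsilon> n" using elim by auto
    have aD: "a n \<le> \<epsilon> n powr D" using elim(1) e powr_mono[of D' D "\<epsilon> n"] by (simp add: D_def)
    have "x0 \<le> 1 * \<epsilon> n" using elim by simp
    also have "\<dots> \<le> a n * \<epsilon> n" using a_ge[of n] e by (intro mult_right_mono) auto
    finally have y: "(a n * \<epsilon> n) powr (- (\<beta> + \<beta>)) \<le> C * tail (a n * \<epsilon> n)" by (rule low)
    have "a n powr (1 / 2) * \<epsilon> n powr (1 / 2 - N)
        = a n powr (1 / 2 - 1 + 2 * \<beta>) * \<epsilon> n powr (1 / 2 - N + 2 * \<beta>) * (a n * (a n * \<epsilon> n) powr (- (\<beta> + \<beta>)))"
    proof -
      have "a n powr (1 / 2) = a n powr (1 / 2 - 1 + 2 * \<beta>) * (a n * a n powr (- (\<beta> + \<beta>)))"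
        using a_pos[of n] powr_add[of "a n" "1 / 2 - 1 + 2 * \<beta>" "1 + (- (\<beta> + \<beta>))"]
          powr_add[of "a n" 1 "- (\<beta> + \<beta>)"] by simp
      moreover have "\<epsilon> n powr (1 / 2 - N) = \<epsilon> n powr (1 / 2 - N + 2 * \<beta>) * \<epsilon> n powr (- (\<beta> + \<beta>))"
        unfolding powr_add[symmetric] by simp
      ultimately show ?thesis using a_pos[of n] unfolding powr_mult by (simp only: mult_ac)
    qed
    also have "\<dots> \<le> a n powr (2 * \<beta>) * \<epsilon> n powr (1 / 2 - N + 2 * \<beta>) * (a n * (C * tail (a n * \<epsilon> n)))"
    proof (rule mult_mono)
      have "a n powr (1 / 2 - 1 + 2 * \<beta>) \<le> a n powr (2 * \<beta>)" using a_ge[of n] by (intro powr_mono) auto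
      then show "a n powr (1 / 2 - 1 + 2 * \<beta>) * \<epsilon> n powr (1 / 2 - N + 2 * \<beta>)
          \<le> a n powr (2 * \<beta>) * \<epsilon> n powr (1 / 2 - N + 2 * \<beta>)" by (rule mult_right_mono) simp
      show "a n * (a n * \<epsilon> n) powr (- (\<beta> + \<beta>)) \<le> a n * (C * tail (a n * \<epsilon> n))"
        using y a_pos[of n] by (intro mult_left_mono) auto
    qed (use a_pos[of n] in auto)
    also have "\<dots> = a n powr (2 * \<beta>) * \<epsilon> n powr (1 / 2 - N + 2 * \<beta>) * C * rate n"
      by (simp add: rate_def)
    also have "\<dots> \<le> (\<epsilon> n powr D) powr (2 * \<beta>) * \<epsilon> n powr (1 / 2 - N + 2 * \<beta>) * C * rate n"
      using aD a_pos[of n] index_pos C rate_pos[of n] by (intro mult_right_mono powr_mono2) auto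
    also have "(\<epsilon> n powr D) powr (2 * \<beta>) * \<epsilon> n powr (1 / 2 - N + 2 * \<beta>) = \<epsilon> n powr (- 1)"
      unfolding powr_powr powr_add[symmetric] by (simp add: N_def)
    finally show ?case using rate_pos[of n] by (simp add: pos_divide_le_eq mult_ac)
  qed
  note upper = this
  have "(\<lambda>n. \<epsilon> n powr (- 1)) \<longlonglongrightarrow> 0" by (rule tendsto_neg_powr[OF _ \<epsilon>_top]) simp
  then have lim: "(\<lambda>n. C * \<epsilon> n powr (- 1)) \<longlonglongrightarrow> 0" by (rule tendsto_mult_right_zero)
  have lower: "eventually (\<lambda>n. 0 \<le> a n powr (1 / 2) * \<epsilon> n powr (1 / 2 - N) / rate n) sequentially"
    by (intro always_eventually allI divide_nonneg_pos rate_pos) simp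
  show ?thesis using N tendsto_sandwich[OF lower upper tendsto_const lim] by blast
qed

text \<open>Both ranges of \<beta> are brought to one form. The domination uniform in
  \<open>k\<close> serves the exchange of limit and expectation, and the negligibility along
  sequences serves the limit at a fixed path; both hold for the same \<eta>.\<close>

lemma small_jumps:
  assumes r: "0 < r" "\<beta> - 1 < r" "1 - \<beta> < r'" "1 / 2 \<le> r'" and \<delta>: "0 < \<delta>"
  shows "\<exists>\<eta>\<in>{0<..\<delta>}.
    (\<exists>C>0. eventually (\<lambda>n. \<forall>k\<ge>1.
      prob {x \<in> space M. \<delta> * (real k * \<epsilon> n) \<le> (\<Sum>i<k. trunc (\<eta> * (real k * \<epsilon> n)) (X i x))}
      \<le> C * rate n * ((real k / a n) powr (- r) + (real k / a n) powr r')) sequentially) \<and>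
    (\<forall>k u. (\<lambda>n. real (k n) / a n) \<longlonglongrightarrow> u \<longrightarrow> 0 < u \<longrightarrow>
      (\<lambda>n. prob {x \<in> space M. \<delta> * (real (k n) * \<epsilon> n) \<le> (\<Sum>i<k n. trunc (\<eta> * (real (k n) * \<epsilon> n)) (X i x))}
        / rate n) \<longlonglongrightarrow> 0)"
proof (cases "\<beta> < 1")
  case True
  let ?\<eta> = "\<delta> / 2"
  let ?P = "\<lambda>n k. prob {x \<in> space M. \<delta> * (real k * \<epsilon> n) \<le> (\<Sum>i<k. trunc (?\<eta> * (real k * \<epsilon> n)) (X i x))}"
  let ?T = "\<lambda>n k. real k * tail (?\<eta> * (real k * \<epsilon> n))"
  have \<eta>: "0 < ?\<eta>" using \<delta> by simp
  obtain C where C: "0 < C" and ev: "eventually (\<lambda>n. \<forall>k\<ge>1. ?P n k \<le> exp 1 * (C * ?T n k) powr 2) sequentially"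
    using small_jumps_heavy[OF True \<delta>] by blast
  obtain C2 where C2: "0 < C2" and ev2: "eventually (\<lambda>n. \<forall>k\<ge>1. ?T n k
    \<le> C2 * rate n * ((real k / a n) powr (- r) + (real k / a n) powr r')) sequentially"
    using jump_rate_dominated[OF r(2,3) \<eta>] by blast
  from ev ev2 have dominated: "eventually (\<lambda>n. \<forall>k\<ge>1. ?P n k
      \<le> (exp 1 * C * C2) * rate n * ((real k / a n) powr (- r) + (real k / a n) powr r')) sequentially"
  proof eventually_elim
    case (elim n)
    show ?case
    proof (intro allI impI)
      fix k :: nat assume k: "1 \<le> k"
      let ?V = "C * ?T n k"
      have V: "0 < ?V" using C k pos by simp
      \<comment> \<open>For domination the first power suffices: it bounds the square when
        \<open>?V \<le> 1\<close>, and otherwise the right side exceeds 1.\<close>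
      have "?P n k \<le> exp 1 * ?V"
      proof (cases "?V \<le> 1")
        case True
        then have "?V powr 2 \<le> ?V powr 1" using V powr_mono'[of 1 2 ?V] by simp
        then have "exp 1 * ?V powr 2 \<le> exp 1 * ?V" using V by simp
        then show ?thesis using elim(1) k by (meson order_trans)
      next
        case False
        then have "1 * 1 \<le> exp 1 * ?V" by (intro mult_mono) auto
        then show ?thesis by (intro order_trans[OF prob_le_1]) simp
      qed
      also have "\<dots> \<le> exp 1 * (C * (C2 * rate n * ((real k / a n) powr (- r) + (real k / a n) powr r')))"
        using elim(2) k C by (intro mult_left_mono) auto
      finally show "?P n k \<le> (exp 1 * C * C2) * rate n * ((real k / a n) powr (- r) + (real k / a n) powr r')"
        by (simp add: mult_ac)
    qed
  qed
  have negligible: "(\<lambda>n. ?P n (k n) / rate n) \<longlonglongrightarrow> 0"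
    if k: "(\<lambda>n. real (k n) / a n) \<longlonglongrightarrow> u" "0 < u" for k :: "nat \<Rightarrow> nat" and u
  proof -
    have "(\<lambda>n. exp 1 * C\<^sup>2 * (?T n (k n) * (?T n (k n) / rate n))) \<longlonglongrightarrow> exp 1 * C\<^sup>2 * (0 * (u * (?\<eta> * u) powr (- \<beta>)))"
      by (intro tendsto_intros jump_rate_tendsto_0[OF k \<eta>] tail_rate[OF k \<eta>])
    then have lim: "(\<lambda>n. exp 1 * C\<^sup>2 * (?T n (k n) * (?T n (k n) / rate n))) \<longlonglongrightarrow> 0" by simp
    have "eventually (\<lambda>n. 1 \<le> k n) sequentially" using k_top[OF k] by (simp add: filterlim_at_top)
    with ev have "eventually (\<lambda>n. ?P n (k n) / rate n \<le> exp 1 * C\<^sup>2 * (?T n (k n) * (?T n (k n) / rate n))) sequentially"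
    proof eventually_elim
      case (elim n)
      have V: "0 \<le> C * ?T n (k n)" using C tail_bounds by simp
      have "?P n (k n) \<le> exp 1 * (C * ?T n (k n)) powr 2" using elim by blast
      also have "\<dots> = exp 1 * C\<^sup>2 * (?T n (k n) * ?T n (k n))"
        using V by (subst powr_numeral) (simp_all add: power2_eq_square mult_ac)
      finally have "?P n (k n) / rate n \<le> exp 1 * C\<^sup>2 * (?T n (k n) * ?T n (k n)) / rate n"
        using rate_pos[of n] by (intro divide_right_mono) auto
      then show ?case by simp
    qed
    note upper = this
    have "eventually (\<lambda>n. 0 \<le> ?P n (k n) / rate n) sequentially"
      by (intro always_eventually allI divide_nonneg_pos rate_pos measure_nonneg)
    then show ?thesis by (rule tendsto_sandwich[OF _ upper tendsto_const lim])
  qed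
  show ?thesis
  proof (intro bexI[of _ ?\<eta>] conjI exI[of _ "exp 1 * C * C2"] allI impI)
    show "0 < exp 1 * C * C2" using C C2 by simp
    show "?\<eta> \<in> {0<..\<delta>}" using \<delta> by simp
  qed (fact dominated, fact negligible)
next
  case False
  obtain N where N: "1 \<le> N" and lim: "(\<lambda>n. a n powr (1 / 2) * \<epsilon> n powr (1 / 2 - N) / rate n) \<longlonglongrightarrow> 0"
    using polynomial_negligible by blast
  let ?\<eta> = "\<delta> / N"
  let ?P = "\<lambda>n k. prob {x \<in> space M. \<delta> * (real k * \<epsilon> n) \<le> (\<Sum>i<k. trunc (?\<eta> * (real k * \<epsilon> n)) (X i x))}"
  have \<eta>: "0 < ?\<eta>" "?\<eta> \<le> \<delta>" using \<delta> N by (auto simp: pos_divide_le_eq)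
  obtain C where C: "0 < C" and ev: "eventually (\<lambda>n. \<forall>k\<ge>1. ?P n k
      \<le> C * (real k powr (1 / 2) * \<epsilon> n powr (1 / 2 - N))) sequentially"
    using small_jumps_light[OF _ \<delta> N] False by auto
  have ev': "eventually (\<lambda>n. \<forall>k\<ge>1. ?P n k / rate n \<le> C * (real k / a n) powr (1 / 2)
      * (a n powr (1 / 2) * \<epsilon> n powr (1 / 2 - N) / rate n)) sequentially"
    using ev
  proof eventually_elim
    case (elim n)
    show ?case
    proof (intro allI impI)
      fix k :: nat assume "1 \<le> k"
      then have "?P n k / rate n \<le> C * (real k powr (1 / 2) * \<epsilon> n powr (1 / 2 - N)) / rate n"
        using elim rate_pos[of n] by (intro divide_right_mono) auto
      also have "\<dots> = C * (real k / a n) powr (1 / 2) * (a n powr (1 / 2) * \<epsilon> n powr (1 / 2 - N) / rate n)"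
        using a_pos[of n] by (simp add: powr_divide)
      finally show "?P n k / rate n
          \<le> C * (real k / a n) powr (1 / 2) * (a n powr (1 / 2) * \<epsilon> n powr (1 / 2 - N) / rate n)" .
    qed
  qed
  have "eventually (\<lambda>n. a n powr (1 / 2) * \<epsilon> n powr (1 / 2 - N) / rate n < 1) sequentially"
    by (rule order_tendstoD(2)[OF lim]) simp
  with ev' have dominated: "eventually (\<lambda>n. \<forall>k\<ge>1. ?P n k
      \<le> C * rate n * ((real k / a n) powr (- r) + (real k / a n) powr r')) sequentially"
  proof eventually_elim
    case (elim n)
    show ?case
    proof (intro allI impI)
      fix k :: nat assume k: "1 \<le> k"
      have "?P n k / rate n \<le> C * (real k / a n) powr (1 / 2) * (a n powr (1 / 2) * \<epsilon> n powr (1 / 2 - N) / rate n)"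
        using elim(1) k by blast
      also have "\<dots> \<le> C * (real k / a n) powr (1 / 2) * 1"
        using C elim(2) by (intro mult_left_mono) auto
      also have "\<dots> \<le> C * ((real k / a n) powr (- r) + (real k / a n) powr r')"
        using C k a_pos[of n] r powr_between[of "real k / a n" r "1 / 2" r'] by simp
      finally show "?P n k \<le> C * rate n * ((real k / a n) powr (- r) + (real k / a n) powr r')"
        using rate_pos[of n] by (simp add: pos_divide_le_eq mult_ac)
    qed
  qed
  have negligible: "(\<lambda>n. ?P n (k n) / rate n) \<longlonglongrightarrow> 0"
    if k: "(\<lambda>n. real (k n) / a n) \<longlonglongrightarrow> u" "0 < u" for k :: "nat \<Rightarrow> nat" and u
  proof -
    have "(\<lambda>n. C * (real (k n) / a n) powr (1 / 2) * (a n powr (1 / 2) * \<epsilon> n powr (1 / 2 - N) / rate n))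
        \<longlonglongrightarrow> C * u powr (1 / 2) * 0"
      using k by (intro tendsto_intros lim) auto
    then have lim': "(\<lambda>n. C * (real (k n) / a n) powr (1 / 2) * (a n powr (1 / 2) * \<epsilon> n powr (1 / 2 - N) / rate n))
        \<longlonglongrightarrow> 0" by simp
    have "eventually (\<lambda>n. 1 \<le> k n) sequentially" using k_top[OF k] by (simp add: filterlim_at_top)
    with ev' have "eventually (\<lambda>n. ?P n (k n) / rate n
        \<le> C * (real (k n) / a n) powr (1 / 2) * (a n powr (1 / 2) * \<epsilon> n powr (1 / 2 - N) / rate n)) sequentially"
      by eventually_elim blast
    note upper = this
    have "eventually (\<lambda>n. 0 \<le> ?P n (k n) / rate n) sequentially"
      by (intro always_eventually allI divide_nonneg_pos rate_pos measure_nonneg)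
    then show ?thesis by (rule tendsto_sandwich[OF _ upper tendsto_const lim'])
  qed
  show ?thesis
  proof (intro bexI[of _ ?\<eta>] conjI exI[of _ C] allI impI)
    show "0 < C" by (rule C)
    show "?\<eta> \<in> {0<..\<delta>}" using \<eta> by simp
  qed (fact dominated, fact negligible)
qed

section \<open>Domination and exact asymptotics at a deterministic index\<close>

lemma prob_mean_ge_dominated:
  assumes r: "0 < r" "\<beta> - 1 < r" "1 - \<beta> < r'" "1 / 2 \<le> r'"
  shows "\<exists>C>0. eventually (\<lambda>n. \<forall>k\<ge>1. prob {x \<in> space M. real k * \<epsilon> n \<le> S k x} / rate n
    \<le> C * ((real k / a n) powr (- r) + (real k / a n) powr r')) sequentially"
proof -
  obtain \<eta> C where "\<eta> \<in> {0<..1}" and C: "0 < C" and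
    ev: "eventually (\<lambda>n. \<forall>k\<ge>1.
      prob {x \<in> space M. 1 * (real k * \<epsilon> n) \<le> (\<Sum>i<k. trunc (\<eta> * (real k * \<epsilon> n)) (X i x))}
      \<le> C * rate n * ((real k / a n) powr (- r) + (real k / a n) powr r')) sequentially"
    using small_jumps[OF r zero_less_one] by blast
  then have \<eta>: "0 < \<eta>" by simp
  obtain C2 where C2: "0 < C2" and ev2: "eventually (\<lambda>n. \<forall>k\<ge>1. real k * tail (\<eta> * (real k * \<epsilon> n))
    \<le> C2 * rate n * ((real k / a n) powr (- r) + (real k / a n) powr r')) sequentially"
    using jump_rate_dominated[OF r(2,3) \<eta>] by blast
  from ev ev2 have "eventually (\<lambda>n. \<forall>k\<ge>1. prob {x \<in> space M. real k * \<epsilon> n \<le> S k x} / rate n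
    \<le> (C + C2) * ((real k / a n) powr (- r) + (real k / a n) powr r')) sequentially"
  proof eventually_elim
    case (elim n)
    show ?case
    proof (intro allI impI)
      fix k :: nat assume k: "1 \<le> k"
      let ?H = "(real k / a n) powr (- r) + (real k / a n) powr r'"
      have "prob {x \<in> space M. real k * \<epsilon> n \<le> (\<Sum>i<k. trunc (\<eta> * (real k * \<epsilon> n)) (X i x))} \<le> C * rate n * ?H"
        using elim(1) k by (simp only: mult_1)
      moreover have "real k * tail (\<eta> * (real k * \<epsilon> n)) \<le> C2 * rate n * ?H" using elim(2) k by blast
      ultimately have "prob {x \<in> space M. real k * \<epsilon> n \<le> S k x} \<le> C2 * rate n * ?H + C * rate n * ?H"
        using prob_sum_ge_upper1[of "real k * \<epsilon> n" k "\<eta> * (real k * \<epsilon> n)"] by linarith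
      then show "prob {x \<in> space M. real k * \<epsilon> n \<le> S k x} / rate n \<le> (C + C2) * ?H"
        using rate_pos[of n] by (simp add: pos_divide_le_eq algebra_simps)
    qed
  qed
  then show ?thesis using C C2 by (intro exI[of _ "C + C2"]) auto
qed

text \<open>From below, a jump above (1 + \<delta>) times the level leaves the rest a margin; from
  above, a jump below (1 - \<delta>) times the level leaves a share \<delta> to the small jumps.
  Continuity of the limit constant removes \<delta>.\<close>

theorem prob_mean_ge_asymp:
  fixes k :: "nat \<Rightarrow> nat"
  assumes k: "(\<lambda>n. real (k n) / a n) \<longlonglongrightarrow> u" "0 < u"
  shows "(\<lambda>n. prob {x \<in> space M. real (k n) * \<epsilon> n \<le> S (k n) x} / rate n) \<longlonglongrightarrow> u powr (1 - \<beta>)"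
proof -
  let ?x = "\<lambda>n. real (k n) * \<epsilon> n"
  let ?P = "\<lambda>n. prob {x \<in> space M. ?x n \<le> S (k n) x}"
  have val: "u * (1 * u) powr (- \<beta>) = u powr (1 - \<beta>)" using k(2) powr_add[of u 1 "- \<beta>"] by simp
  have cont: "((\<lambda>\<delta>. u * ((1 + s * \<delta>) * u) powr (- \<beta>)) \<longlongrightarrow> u powr (1 - \<beta>)) (at_right 0)" for s :: real
  proof -
    have "((\<lambda>\<delta>. u * ((1 + s * \<delta>) * u) powr (- \<beta>)) \<longlongrightarrow> u * ((1 + s * 0) * u) powr (- \<beta>)) (at_right 0)"
      using k(2) by (intro tendsto_intros) auto
    then show ?thesis using val by simp
  qed
  show ?thesis
  proof (rule order_tendstoI)
    fix v assume v: "v < u powr (1 - \<beta>)"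
    have "eventually (\<lambda>\<delta>. v < u * ((1 + 1 * \<delta>) * u) powr (- \<beta>) \<and> 0 < \<delta>) (at_right 0)"
      by (rule eventually_conj[OF order_tendstoD(1)[OF cont v] eventually_at_right_less])
    then obtain \<delta> where \<delta>: "v < u * ((1 + \<delta>) * u) powr (- \<beta>)" "0 < \<delta>"
      using eventually_happens'[OF trivial_limit_at_right_real[of 0]] by force
    let ?q = "\<lambda>n. tail ((1 + \<delta>) * ?x n)" and ?F = "\<lambda>n. prob {x \<in> space M. - (\<delta> * ?x n) \<le> S (k n - 1) x}"
    have c: "0 < 1 + \<delta>" using \<delta> by simp
    have "(\<lambda>n. real (k n) * ?q n / rate n * (?F n - real (k n) * ?q n))
        \<longlonglongrightarrow> u * ((1 + \<delta>) * u) powr (- \<beta>) * (1 - 0)"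
      by (intro tendsto_intros tail_rate[OF k c] prob_rest[OF k \<delta>(2)] jump_rate_tendsto_0[OF k c])
    then have "eventually (\<lambda>n. v < real (k n) * ?q n / rate n * (?F n - real (k n) * ?q n)) sequentially"
      using \<delta>(1) by (intro order_tendstoD(1)) auto
    then show "eventually (\<lambda>n. v < ?P n / rate n) sequentially"
    proof eventually_elim
      case (elim n)
      have "real (k n) * ?q n * (?F n - real (k n) * ?q n)
          \<le> real (k n) * (?q n * ?F n) - real (k n) * (real (k n) - 1) * (?q n)\<^sup>2"
        by (simp add: algebra_simps power2_eq_square)
      also have "\<dots> \<le> ?P n"
      proof -
        have "(1 + \<delta>) * ?x n + - (\<delta> * ?x n) = ?x n" by (simp add: algebra_simps)
        then show ?thesis
          using prob_sum_ge_lower[of "k n" "k n" "(1 + \<delta>) * ?x n" "- (\<delta> * ?x n)"] by (simp only: order_refl)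
      qed
      finally have "real (k n) * ?q n * (?F n - real (k n) * ?q n) / rate n \<le> ?P n / rate n"
        using rate_pos[of n] by (intro divide_right_mono) auto
      then show ?case using elim by simp
    qed
  next
    fix v assume v: "u powr (1 - \<beta>) < v"
    \<comment> \<open>The bound 1/2 ensures \<eta> \<le> \<delta> \<le> 1 - \<delta>, so the
      truncation height stays below the height of the dominating jump.\<close>
    have "eventually (\<lambda>\<delta>. u * ((1 + (- 1) * \<delta>) * u) powr (- \<beta>) < v \<and> \<delta> \<in> {0<..<1 / 2}) (at_right 0)"
      by (rule eventually_conj[OF order_tendstoD(2)[OF cont v] eventually_at_right_real]) simp
    then obtain \<delta> where \<delta>: "u * ((1 - \<delta>) * u) powr (- \<beta>) < v" "0 < \<delta>" "\<delta> < 1 / 2"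
      using eventually_happens'[OF trivial_limit_at_right_real[of 0]] by force
    \<comment> \<open>Only negligibility is wanted here, so any admissible pair of exponents
      serves.\<close>
    define r where "r = max \<beta> 1"
    have r: "0 < r" "\<beta> - 1 < r" "1 - \<beta> < 1" "1 / 2 \<le> (1 :: real)" using index_pos by (auto simp: r_def)
    obtain \<eta> where "\<eta> \<in> {0<..\<delta>}" and sj: "(\<lambda>n. prob {x \<in> space M. \<delta> * ?x n \<le>
        (\<Sum>i<k n. trunc (\<eta> * ?x n) (X i x))} / rate n) \<longlonglongrightarrow> 0"
      using small_jumps[OF r \<delta>(2)] k by blast
    then have \<eta>: "0 < \<eta>" "\<eta> \<le> \<delta>" by auto
    let ?J = "\<lambda>n. prob {x \<in> space M. \<delta> * ?x n \<le> (\<Sum>i<k n. trunc (\<eta> * ?x n) (X i x))}"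
    let ?T = "\<lambda>n. real (k n) * tail (\<eta> * ?x n)"
    have c: "0 < 1 - \<delta>" using \<delta> by simp
    have "(\<lambda>n. real (k n) * tail ((1 - \<delta>) * ?x n) / rate n + ?T n * (?T n / rate n) + ?J n / rate n)
        \<longlonglongrightarrow> u * ((1 - \<delta>) * u) powr (- \<beta>) + 0 * (u * (\<eta> * u) powr (- \<beta>)) + 0"
      by (intro tendsto_intros tail_rate[OF k] jump_rate_tendsto_0[OF k] sj c \<eta>)
    then have "eventually (\<lambda>n. real (k n) * tail ((1 - \<delta>) * ?x n) / rate n + ?T n * (?T n / rate n) + ?J n / rate n < v) sequentially"
      using \<delta>(1) by (intro order_tendstoD(2)) auto
    then show "eventually (\<lambda>n. ?P n / rate n < v) sequentially"
    proof eventually_elim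
      case (elim n)
      have x: "0 \<le> ?x n" using \<epsilon>_pos[of n] by simp
      have "?P n \<le> real (k n) * tail ((1 - \<delta>) * ?x n) + (?T n)\<^sup>2 + ?J n"
      proof -
        have "0 \<le> \<eta> * ?x n" by (rule mult_nonneg_nonneg[OF less_imp_le[OF \<eta>(1)] x])
        moreover have "\<eta> \<le> 1 - \<delta>" using \<eta>(2) \<delta>(3) by simp
        then have "\<eta> * ?x n \<le> (1 - \<delta>) * ?x n" using x by (rule mult_right_mono)
        moreover have "?x n - (1 - \<delta>) * ?x n = \<delta> * ?x n" by (simp add: algebra_simps)
        ultimately show ?thesis
          using prob_sum_ge_upper2[of "\<eta> * ?x n" "(1 - \<delta>) * ?x n" "?x n" "k n"] by metis
      qed
      then have "?P n / rate n \<le> (real (k n) * tail ((1 - \<delta>) * ?x n) + (?T n)\<^sup>2 + ?J n) / rate n"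
        using rate_pos[of n] by (intro divide_right_mono) auto
      then show ?case using elim by (simp add: add_divide_distrib power2_eq_square)
    qed
  qed
qed

end

section \<open>Tails and norming functions\<close>

text \<open>Asymptotic equivalence transfers the ratio limits from \<open>L\<close> to the tail.
  Being eventually positive and antitone, the tail is positive everywhere.\<close>

lemma (in iid_sums) tail_regularly_varying:
  assumes "tail_assumption (distr M borel (X 0)) \<beta> L"
  shows "((\<lambda>x. tail x / (x powr (- \<beta>) * L x)) \<longlongrightarrow> 1) at_top"
    and "regularly_varying_tail tail \<beta>"
proof -
  let ?H = "\<lambda>x. x powr (- \<beta>) * L x"
  have \<beta>: "0 < \<beta>" and L: "\<And>x. 0 < x \<Longrightarrow> 0 < L x"
    and sv: "\<And>c. 0 < c \<Longrightarrow> ((\<lambda>x. L (c * x) / L x) \<longlongrightarrow> 1) at_top"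
    and eq: "tail \<sim>[at_top] ?H"
    using assms by (auto simp: tail_assumption_def slowly_varying_def tail_eq_distr)
  have H: "0 < ?H x" if "0 < x" for x using L[OF that] that by simp
  have "eventually (\<lambda>x. tail x \<noteq> 0 \<or> ?H x \<noteq> 0) at_top"
    using eventually_gt_at_top[of 0] by eventually_elim (use H in force)
  then show R: "((\<lambda>x. tail x / ?H x) \<longlongrightarrow> 1) at_top" by (rule asymp_equivD_strong[OF eq])
  have "eventually (\<lambda>x. 1 / 2 < tail x / ?H x) at_top" by (rule order_tendstoD(1)[OF R]) simp
  then have ev: "eventually (\<lambda>x. 0 < tail x) at_top"
    using eventually_gt_at_top[of 0]
  proof eventually_elim
    case (elim x)
    have "tail x \<noteq> 0" using elim(1) by (intro notI) simp
    then show ?case using tail_bounds(1)[of x] by simp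
  qed
  have pos: "0 < tail x" for x
  proof -
    obtain z where "0 < tail z" "x \<le> z"
      using eventually_happens[OF eventually_conj[OF ev eventually_ge_at_top[of x]]] by auto
    then show ?thesis using tail_antimono by (meson less_le_trans)
  qed
  show "regularly_varying_tail tail \<beta>"
  proof
    fix c :: real assume c: "0 < c"
    have cx: "filterlim (\<lambda>x. c * x) at_top at_top"
      by (rule filterlim_tendsto_pos_mult_at_top[OF tendsto_const c filterlim_ident])
    have "((\<lambda>x. (tail (c * x) / ?H (c * x)) / (tail x / ?H x) * (c powr (- \<beta>) * (L (c * x) / L x)))
        \<longlongrightarrow> 1 / 1 * (c powr (- \<beta>) * 1)) at_top"
      by (intro tendsto_intros filterlim_compose[OF R cx] R sv c) simp
    moreover have "eventually (\<lambda>x. (tail (c * x) / ?H (c * x)) / (tail x / ?H x) * (c powr (- \<beta>) * (L (c * x) / L x))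
        = tail (c * x) / tail x) at_top"
      using eventually_gt_at_top[of 0]
    proof eventually_elim
      case (elim x)
      have "L x \<noteq> 0" "L (c * x) \<noteq> 0" using L[of x] L[of "c * x"] c elim by auto
      then show ?case using c elim pos[of x] by (simp add: powr_mult field_simps)
    qed
    ultimately show "((\<lambda>x. tail (c * x) / tail x) \<longlongrightarrow> c powr (- \<beta>)) at_top"
      by (simp add: tendsto_cong)
  qed (use \<beta> pos tail_antimono in auto)
qed

section \<open>Norming function and growth of the level\<close>

lemma filterlim_power_at_top:
  fixes m :: real
  assumes "1 < m"
  shows "filterlim (\<lambda>n. m ^ n) at_top sequentially"
  using assms
  by (intro filterlim_at_infinity_imp_filterlim_at_top filterlim_realpow_sequentially_gt1) (auto intro!: always_eventually)

lemma norming_function_ratio: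
  assumes "norming_function \<alpha> b s" "0 < c" and a: "filterlim a at_top sequentially"
  shows "(\<lambda>n. b (c * a n) / b (a n)) \<longlonglongrightarrow> c powr (1 / \<alpha>)"
proof -
  have b: "\<And>x. 0 < x \<Longrightarrow> b x = x powr (1 / \<alpha>) * s x" and s: "\<And>x. 0 < x \<Longrightarrow> 0 < s x"
    and sv: "((\<lambda>x. s (c * x) / s x) \<longlongrightarrow> 1) at_top"
    using assms by (auto simp: norming_function_def slowly_varying_def)
  have "(\<lambda>n. c powr (1 / \<alpha>) * (s (c * a n) / s (a n))) \<longlonglongrightarrow> c powr (1 / \<alpha>) * 1"
    by (intro tendsto_intros filterlim_compose[OF sv a])
  moreover have "eventually (\<lambda>n. 0 < a n) sequentially"
    using a by (simp add: filterlim_at_top_dense)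
  then have "eventually (\<lambda>n. c powr (1 / \<alpha>) * (s (c * a n) / s (a n)) = b (c * a n) / b (a n)) sequentially"
  proof eventually_elim
    case (elim n)
    then show ?case using assms(2) by (simp add: b powr_mult)
  qed
  ultimately show ?thesis by (simp add: tendsto_cong)
qed

lemma norming_function_pos: "norming_function \<alpha> b s \<Longrightarrow> 0 < x \<Longrightarrow> 0 < b x"
  by (simp add: norming_function_def slowly_varying_def)

text \<open>Eventually \<open>k n\<close> lies between u/2 and 2u times \<open>a n\<close>.
  Monotonicity bounds \<open>b\<close> at \<open>k n\<close> by \<open>b\<close> at the upper end,
  and regular variation compares that with \<open>b (a n)\<close>.\<close>

lemma level_comparable:
  assumes nf: "norming_function \<alpha> b s" and a: "filterlim a at_top sequentially"
    and \<epsilon>: "\<And>n. 0 < \<epsilon> n"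
    and growth: "filterlim (\<lambda>n. \<epsilon> n * a n * inverse (b (a n))) at_top sequentially"
    and k: "(\<lambda>n. real (k n) / a n) \<longlonglongrightarrow> u" "0 < u"
  shows "filterlim (\<lambda>n. real (k n) * \<epsilon> n / b (real (k n))) at_top sequentially"
proof -
  have a0: "eventually (\<lambda>n. 0 < a n) sequentially" using a by (simp add: filterlim_at_top_dense)
  have u: "0 < 2 * u" "0 < u / 2" using k by auto
  have "(\<lambda>n. u / 2 * inverse (b (2 * u * a n) / b (a n))) \<longlonglongrightarrow> u / 2 * inverse ((2 * u) powr (1 / \<alpha>))"
    using u by (intro tendsto_intros norming_function_ratio[OF nf _ a]) auto
  from filterlim_tendsto_pos_mult_at_top[OF this _ growth] u
  have big: "filterlim (\<lambda>n. u / 2 * inverse (b (2 * u * a n) / b (a n)) * (\<epsilon> n * a n * inverse (b (a n)))) at_top sequentially"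
    by simp
  have "eventually (\<lambda>n. real (k n) / a n < 2 * u) sequentially" "eventually (\<lambda>n. u / 2 < real (k n) / a n) sequentially"
    using order_tendstoD(2)[OF k(1), of "2 * u"] order_tendstoD(1)[OF k(1), of "u / 2"] k(2) by simp_all
  with a0 have "eventually (\<lambda>n. u / 2 * inverse (b (2 * u * a n) / b (a n)) * (\<epsilon> n * a n * inverse (b (a n)))
      \<le> real (k n) * \<epsilon> n / b (real (k n))) sequentially"
  proof eventually_elim
    case (elim n)
    have 1: "real (k n) \<le> 2 * u * a n" "u / 2 * a n \<le> real (k n)"
      using elim by (auto simp: pos_divide_less_eq pos_less_divide_eq)
    have k0: "0 < real (k n)" using 1(2) u(2) elim(1) by (meson less_le_trans mult_pos_pos)
    have "mono_on {0..} b" using nf by (simp add: norming_function_def)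
    then have "b (real (k n)) \<le> b (2 * u * a n)"
      by (rule mono_onD) (use 1 k0 in auto)
    then have "u / 2 * a n * \<epsilon> n / b (2 * u * a n) \<le> real (k n) * \<epsilon> n / b (real (k n))"
      using 1 k0 less_imp_le[OF \<epsilon>[of n]] norming_function_pos[OF nf k0] by (intro frac_le mult_right_mono mult_nonneg_nonneg) auto
    then show ?case using norming_function_pos[OF nf elim(1)] by (simp add: field_simps)
  qed
  then show ?thesis by (rule filterlim_at_top_mono[OF big])
qed

text \<open>The index 1/\<alpha> of \<open>b\<close> exceeds 1, so \<open>b (m ^ n) / m ^ n\<close>
  grows at least like a positive power of \<open>m ^ n\<close>, and \<open>\<epsilon> n\<close> lies
  above it.\<close>

lemma polynomial_level_of_norming:
  assumes nf: "norming_function \<alpha> b s" and m: "1 < m" and \<alpha>: "0 < \<alpha>" "\<alpha> < 1"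
    and \<epsilon>: "\<And>n. 0 < \<epsilon> n"
    and growth: "filterlim (\<lambda>n. \<epsilon> n * m ^ n * inverse (b (m ^ n))) at_top sequentially"
  shows "\<exists>D. eventually (\<lambda>n. m ^ n \<le> \<epsilon> n powr D) sequentially"
proof -
  \<comment> \<open>\<open>1 + e\<close> is the midpoint of 1 and 1/\<alpha>; the gap absorbs the
    slowly varying factor.\<close>
  define e where "e = (1 / \<alpha> - 1) / 2"
  have e: "0 < e" "1 + e < 1 / \<alpha>" using \<alpha> by (auto simp: e_def field_simps)
  have mtop: "filterlim (\<lambda>n. m ^ n) at_top sequentially" by (rule filterlim_power_at_top[OF m])
  have bpos: "0 < b (m ^ n)" for n using m by (intro norming_function_pos[OF nf]) simp
  let ?q = "m powr (1 + e)"
  have "(\<lambda>n. b (m * m ^ n) / b (m ^ n)) \<longlonglongrightarrow> m powr (1 / \<alpha>)"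
    using m by (intro norming_function_ratio[OF nf _ mtop]) simp
  then have "eventually (\<lambda>n. ?q < b (m * m ^ n) / b (m ^ n)) sequentially"
    by (rule order_tendstoD(1)) (use m e in simp)
  then obtain N where N: "\<And>n. N \<le> n \<Longrightarrow> ?q < b (m * m ^ n) / b (m ^ n)" by (auto simp: eventually_sequentially)
  define c where "c = b (m ^ N) / ?q ^ N"
  have c: "0 < c" using bpos[of N] m by (simp add: c_def)
  have low: "c * ?q ^ n \<le> b (m ^ n)" if "N \<le> n" for n
    using that
  proof (induction n rule: dec_induct)
    case base
    then show ?case using m by (simp add: c_def)
  next
    case (step n)
    have "c * ?q ^ Suc n \<le> ?q * b (m ^ n)" using step.IH m by simp
    also have "\<dots> \<le> b (m ^ Suc n)" using N[OF step.hyps(1)] bpos[of n] by (simp add: pos_less_divide_eq)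
    finally show ?case .
  qed
  have "eventually (\<lambda>n. 1 / c \<le> \<epsilon> n * m ^ n * inverse (b (m ^ n))) sequentially"
    using growth unfolding filterlim_at_top by blast
  then have "eventually (\<lambda>n. m ^ n \<le> \<epsilon> n powr (1 / e)) sequentially"
    using eventually_ge_at_top[of N]
  proof eventually_elim
    case (elim n)
    have "?q ^ n * c \<le> b (m ^ n)" using low[OF elim(2)] by (simp add: mult.commute)
    also have "b (m ^ n) \<le> \<epsilon> n * m ^ n * c"
      using elim(1) bpos[of n] c by (simp add: field_simps)
    finally have "?q ^ n \<le> \<epsilon> n * m ^ n" using c by simp
    also have "?q ^ n = m ^ n * (m powr e) ^ n" using m by (simp add: powr_add power_mult_distrib)
    finally have "(m powr e) ^ n \<le> \<epsilon> n" using m by simp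
    then have "((m powr e) ^ n) powr (1 / e) \<le> \<epsilon> n powr (1 / e)" using e m by (intro powr_mono2) auto
    also have "((m powr e) ^ n) powr (1 / e) = m ^ n"
      using e m by (induction n) (simp_all add: powr_mult powr_powr)
    finally show ?case .
  qed
  then show ?thesis by blast
qed

section \<open>Conditioning on the index\<close>

lemma (in iid_sums) prob_random_index:
  fixes Z :: "nat \<Rightarrow> 'a \<Rightarrow> nat"
  assumes ind: "indep_sequences M X Z" and Z[measurable]: "Z n \<in> measurable M (count_space UNIV)"
  shows "prob {x \<in> space M. e \<le> partial_sum X (Z n x) x / real (Z n x)} =
    expectation (\<lambda>x. prob {y \<in> space M. e \<le> S (Z n x) y / real (Z n x)})"
proof -
  let ?Q = "\<lambda>k. prob {y \<in> space M. e \<le> S k y / real k}"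
  let ?A = "\<lambda>k. {x \<in> space M. e \<le> S k x / real k \<and> Z n x = k}"
  have A: "?A k \<in> events" for k by measurable
  have prod: "prob (?A k) = ?Q k * prob {x \<in> space M. Z n x = k}" for k
  proof -
    \<comment> \<open>\<open>indep_var\<close> takes both variables in one codomain type, so
      \<open>Z\<close> appears as a real-valued sequence with the discrete sigma-algebra.\<close>
    have "indep_var borel ((\<lambda>f. (\<Sum>i<k. f i) / real k) \<circ> (\<lambda>x i. X i x))
        (count_space UNIV) ((\<lambda>z. z n) \<circ> (\<lambda>x n. real (Z n x)))"
      using ind unfolding indep_sequences_def by (rule indep_var_compose) measurable
    then have iv: "indep_var borel (\<lambda>x. S k x / real k) (count_space UNIV) (\<lambda>x. real (Z n x))"
      by (simp add: comp_def partial_sum_def)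
    show ?thesis
      using indep_varD[OF iv, of "{e..}" "{real k}"] by (simp add: vimage_def Int_def conj_ac)
  qed
  have "ennreal (prob {x \<in> space M. e \<le> partial_sum X (Z n x) x / real (Z n x)}) =
      emeasure M (\<Union>k. ?A k)"
    unfolding emeasure_eq_measure[symmetric] by (intro arg_cong[where f = "emeasure M"]) auto
  also have "\<dots> = (\<Sum>k. emeasure M (?A k))"
    by (rule suminf_emeasure[symmetric]) (use A in \<open>auto simp: disjoint_family_on_def\<close>)
  also have "\<dots> = (\<Sum>k. ennreal (?Q k) * emeasure M {x \<in> space M. Z n x = k})"
    using prod by (simp add: emeasure_eq_measure ennreal_mult')
  also have "\<dots> = (\<Sum>k. \<integral>\<^sup>+x. ennreal (?Q k) * indicator {x \<in> space M. Z n x = k} x \<partial>M)"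
    by (simp add: nn_integral_cmult_indicator)
  also have "\<dots> = (\<integral>\<^sup>+x. (\<Sum>k. ennreal (?Q k) * indicator {x \<in> space M. Z n x = k} x) \<partial>M)"
    by (rule nn_integral_suminf[symmetric]) measurable
  also have "\<dots> = (\<integral>\<^sup>+x. ennreal (?Q (Z n x)) \<partial>M)"
  proof (rule nn_integral_cong)
    fix x assume x: "x \<in> space M"
    have "(\<Sum>k. ennreal (?Q k) * indicator {x \<in> space M. Z n x = k} x) =
        (\<Sum>k\<in>{Z n x}. ennreal (?Q k) * indicator {x \<in> space M. Z n x = k} x)"
      by (rule suminf_finite) auto
    then show "(\<Sum>k. ennreal (?Q k) * indicator {x \<in> space M. Z n x = k} x) = ennreal (?Q (Z n x))"
      using x by simp
  qed
  also have "\<dots> = ennreal (expectation (\<lambda>x. ?Q (Z n x)))"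
  proof (rule nn_integral_eq_integral)
    have "(\<lambda>x. ?Q (Z n x)) \<in> borel_measurable M" by (rule measurable_compose[OF Z]) simp
    then show "integrable M (\<lambda>x. ?Q (Z n x))" by (intro integrable_const_bound[of _ 1]) auto
  qed simp
  finally show ?thesis by (subst (asm) ennreal_inj) (auto intro!: integral_nonneg_AE)
qed

section \<open>Random index\<close>

lemma (in prob_space) nn_integral_galton_watson:
  assumes "galton_watson M p Z"
  shows "(\<integral>\<^sup>+x. f (Z n x) \<partial>M) = (\<integral>\<^sup>+k. f k \<partial>gw_pmf p n)"
proof -
  have [measurable]: "Z n \<in> measurable M (count_space UNIV)" using assms by (auto simp: galton_watson_def)
  have "(\<integral>\<^sup>+k. f k \<partial>distr M (count_space UNIV) (Z n)) = (\<integral>\<^sup>+x. f (Z n x) \<partial>M)"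
    by (rule nn_integral_distr) auto
  then show ?thesis by (simp add: distr_galton_watson[OF assms])
qed

lemma (in prob_space) galton_watson_mean:
  assumes "galton_watson_conditions M p Z m"
  shows "(\<integral>\<^sup>+x. ennreal (real (Z n x) / m ^ n) \<partial>M) = 1"
proof -
  have gw: "galton_watson M p Z" and m: "1 < m" and int: "integrable (measure_pmf p) real"
    and mean: "measure_pmf.expectation p real = m"
    using assms by (auto simp: galton_watson_conditions_def)
  have "(\<integral>\<^sup>+j. of_nat j \<partial>p) = ennreal m"
    using nn_integral_eq_integral[OF int] mean by (simp add: ennreal_of_nat_eq_real_of_nat)
  then have mn: "(\<integral>\<^sup>+k. of_nat k \<partial>gw_pmf p n) = ennreal (m ^ n)"
    using m by (simp add: nn_integral_gw_pmf ennreal_power)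
  have "(\<integral>\<^sup>+x. ennreal (real (Z n x) / m ^ n) \<partial>M) = (\<integral>\<^sup>+k. ennreal (1 / m ^ n) * of_nat k \<partial>gw_pmf p n)"
    unfolding nn_integral_galton_watson[OF gw, where f = "\<lambda>k. ennreal (real k / m ^ n)"]
    using m by (intro nn_integral_cong) (simp add: ennreal_of_nat_eq_real_of_nat ennreal_mult'[symmetric])
  also have "\<dots> = ennreal (1 / m ^ n) * ennreal (m ^ n)"
    by (subst nn_integral_cmult) (simp_all add: mn)
  also have "\<dots> = 1" using m by (subst ennreal_mult'[symmetric]) auto
  finally show ?thesis .
qed

lemma (in prob_space) gw_limit_density_pos:
  assumes "gw_limit_density M Z m W \<omega>"
  shows "AE x in M. 0 < W x"
proof -
  have d: "distributed M lborel W (\<lambda>u. ennreal (indicator {0<..} u * \<omega> u))"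
    using assms by (simp add: gw_limit_density_def)
  have "emeasure M (W -` {..0} \<inter> space M) = (\<integral>\<^sup>+u. ennreal (indicator {0<..} u * \<omega> u) * indicator {..0} u \<partial>lborel)"
    by (rule distributed_emeasure[OF d]) simp
  also have "\<dots> = (\<integral>\<^sup>+u. 0 \<partial>(lborel :: real measure))"
    by (intro nn_integral_cong) (auto simp: indicator_def)
  finally have "emeasure M (W -` {..0} \<inter> space M) = 0" by simp
  moreover have "W -` {..0} \<inter> space M \<in> events"
    using distributed_measurable[OF d] by (intro measurable_sets[of W M lborel]) auto
  ultimately show ?thesis
    by (intro AE_I'[of "W -` {..0} \<inter> space M"]) (auto simp: null_sets_def not_less)
qed

text \<open>\<open>gw_pmf_negative_moment\<close> asks for a bound below 1 on E exp(-Z_n / m^n),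
  uniform in n. Each of these numbers is below 1, and so is their limit E exp(-W), because W > 0
  almost surely.\<close>

lemma (in prob_space) galton_watson_negative_moment:
  assumes gwc: "galton_watson_conditions M p Z m" and dens: "gw_limit_density M Z m W \<omega>"
    and \<gamma>: "pmf p 1 = m powr (- \<gamma>)" and r: "0 < r" "r < \<gamma>"
  shows "\<exists>B. \<forall>n. (\<integral>\<^sup>+x. ennreal ((real (Z n x) / m ^ n) powr (- r)) \<partial>M) \<le> ennreal B"
proof -
  have gw: "galton_watson M p Z" and m: "1 < m" and p0: "pmf p 0 = 0"
    using gwc by (auto simp: galton_watson_conditions_def)
  have Z[measurable]: "Z n \<in> measurable M (count_space UNIV)" for n
    using gw by (auto simp: galton_watson_def)
  have lim: "AE x in M. (\<lambda>n. real (Z n x) / m ^ n) \<longlonglongrightarrow> W x"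
    and W: "W \<in> borel_measurable M"
    using dens distributed_measurable[of M lborel W] by (auto simp: gw_limit_density_def)
  note W[measurable]
  let ?R = "\<lambda>n x. real (Z n x) / m ^ n"
  have [measurable]: "?R n \<in> borel_measurable M" for n by measurable
  have pgf_eq: "pgf (gw_pmf p n) (exp (- 1 / m ^ n)) = expectation (\<lambda>x. exp (- ?R n x))" for n
  proof -
    have "expectation (\<lambda>x. exp (- 1 / m ^ n) ^ Z n x) =
        integral\<^sup>L (distr M (count_space UNIV) (Z n)) (\<lambda>k. exp (- 1 / m ^ n) ^ k)"
      by (rule integral_distr[symmetric]) auto
    then have "pgf (gw_pmf p n) (exp (- 1 / m ^ n)) = expectation (\<lambda>x. exp (- 1 / m ^ n) ^ Z n x)"
      by (simp add: pgf_def distr_galton_watson[OF gw])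
    moreover have "exp (- 1 / m ^ n) ^ Z n x = exp (- ?R n x)" for x
      by (subst exp_of_nat_mult[symmetric]) simp
    ultimately show ?thesis by simp
  qed
  have "(\<lambda>n. expectation (\<lambda>x. exp (- ?R n x))) \<longlonglongrightarrow> expectation (\<lambda>x. exp (- W x))"
  proof (rule integral_dominated_convergence[where w = "\<lambda>_. 1"])
    show "AE x in M. (\<lambda>n. exp (- ?R n x)) \<longlonglongrightarrow> exp (- W x)"
      using lim by eventually_elim (intro tendsto_intros)
    show "AE x in M. norm (exp (- ?R n x)) \<le> 1" for n using m by auto
  qed auto
  moreover have "expectation (\<lambda>x. exp (- W x)) < 1"
  proof (rule expectation_less)
    show "integrable M (\<lambda>x. exp (- W x))"
      using gw_limit_density_pos[OF dens] by (intro integrable_const_bound[of _ 1]) auto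
    show "AE x in M. exp (- W x) < 1" using gw_limit_density_pos[OF dens] by eventually_elim simp
  qed
  moreover have "expectation (\<lambda>x. exp (- ?R n x)) < 1" for n
  proof -
    have s: "0 \<le> exp (- 1 / m ^ n)" "exp (- 1 / m ^ n) < 1" using m by auto
    \<comment> \<open>As p_0 = 0, the generating function lies below the identity, and iteration
      preserves this.\<close>
    have "(pgf p ^^ j) t \<le> t \<and> 0 \<le> (pgf p ^^ j) t" if t: "0 \<le> t" "t \<le> 1" for j t
    proof (induction j)
      case (Suc j)
      let ?t = "(pgf p ^^ j) t"
      have t1: "0 \<le> ?t" "?t \<le> 1" using Suc t by auto
      have "pgf p ?t \<le> ?t * (pmf p 1 + (1 - pmf p 1) * ?t)" by (rule pgf_le_quadratic[OF p0 t1])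
      also have "\<dots> \<le> ?t * (pmf p 1 + (1 - pmf p 1) * 1)"
        using t1 pmf_le_1[of p 1] by (intro mult_left_mono add_left_mono) auto
      finally show ?case using Suc pgf_bounds(1)[OF t1] by simp
    qed (use t in simp)
    then have "pgf (gw_pmf p n) (exp (- 1 / m ^ n)) \<le> exp (- 1 / m ^ n)"
      using s by (subst pgf_gw_pmf) auto
    then show ?thesis using s(2) pgf_eq[of n] by linarith
  qed
  ultimately have "\<exists>q<1. \<forall>n. expectation (\<lambda>x. exp (- ?R n x)) \<le> q" by (rule uniform_bound_below_limit)
  then obtain q where q: "q < 1" "\<And>n. expectation (\<lambda>x. exp (- ?R n x)) \<le> q" by blast
  have "pmf p 1 < m powr (- r)" unfolding \<gamma> using m r by (intro powr_less_mono) auto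
  then have "\<exists>B. \<forall>n. (\<integral>\<^sup>+k. ennreal ((real k / m ^ n) powr (- r)) \<partial>gw_pmf p n) \<le> ennreal B"
    by (rule gw_pmf_negative_moment[OF p0 m r(1) _ _ q(1)]) (simp only: pgf_eq q(2))
  then show ?thesis
    by (simp only: nn_integral_galton_watson[OF gw, where f = "\<lambda>k. ennreal ((real k / m ^ n) powr (- r))" for n])
qed

text \<open>Turns the integral constant into a moment of \<open>W\<close>, the form in which the
  limit of the expectations appears.\<close>

lemma (in prob_space) density_moment_eq_expectation:
  assumes "gw_limit_density M Z m W \<omega>"
  shows "density_moment \<omega> t = expectation (\<lambda>x. W x powr (1 - t))"
proof -
  have d: "distributed M lborel W (\<lambda>u. ennreal (indicator {0<..} u * \<omega> u))"
    and nonneg: "\<And>u. 0 < u \<Longrightarrow> 0 \<le> \<omega> u"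
    using assms by (auto simp: gw_limit_density_def)
  have "(\<integral>u. (indicator {0<..} u * \<omega> u) * u powr (1 - t) \<partial>lborel) = expectation (\<lambda>x. W x powr (1 - t))"
    by (rule distributed_integral[OF d]) (auto simp: indicator_def nonneg)
  then show ?thesis
    unfolding density_moment_def set_lebesgue_integral_def
    by (simp add: mult_ac)
qed

lemma powr_sum_le:
  fixes x y q :: real
  assumes "0 \<le> x" "0 \<le> y" "0 \<le> q"
  shows "(x + y) powr q \<le> 2 powr q * (x powr q + y powr q)"
proof -
  have "(x + y) powr q \<le> (2 * max x y) powr q" using assms by (intro powr_mono2) auto
  also have "\<dots> = 2 powr q * max x y powr q" by (simp add: powr_mult)
  also have "max x y powr q \<le> x powr q + y powr q" by (simp add: max_def)
  finally show ?thesis by simp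
qed

lemma ennreal_affine:
  assumes "0 \<le> c" "0 \<le> x" "0 \<le> y"
  shows "ennreal (c * (x + (1 + y))) = ennreal c * (ennreal x + (1 + ennreal y))"
  using assms by (simp add: ennreal_mult')

text \<open>\<open>W powr (1 - \<beta>)\<close> is the limit of \<open>P(S\<^sub>k \<ge> k \<epsilon>\<^sub>n) / rate n\<close> at \<open>k = Z\<^sub>n\<close>; the domination
  by \<open>(Z\<^sub>n / a\<^sub>n) powr (- r) + (Z\<^sub>n / a\<^sub>n) powr r'\<close> with \<open>r < \<gamma>\<close> and \<open>r' < 1\<close> leaves room for a
  moment of order \<open>q > 1\<close>.\<close>

lemma (in sum_large_deviation) expectation_tendsto:
  assumes gwc: "galton_watson_conditions M p Z m" and dens: "gw_limit_density M Z m W \<omega>"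
    and \<gamma>: "0 < \<gamma>" "pmf p 1 = m powr (- \<gamma>)" "\<beta> - 1 < \<gamma>" and a: "\<And>n. a n = m ^ n"
  shows "(\<lambda>n. expectation (\<lambda>x. prob {y \<in> space M. \<epsilon> n \<le> S (Z n x) y / real (Z n x)}) / rate n)
    \<longlonglongrightarrow> expectation (\<lambda>x. W x powr (1 - \<beta>))"
proof -
  have gw: "galton_watson M p Z" and m: "1 < m"
    using gwc by (auto simp: galton_watson_conditions_def)
  have Z[measurable]: "Z n \<in> measurable M (count_space UNIV)" for n
    using gw by (auto simp: galton_watson_def)
  have lim: "AE x in M. (\<lambda>n. real (Z n x) / a n) \<longlonglongrightarrow> W x"
    and W[measurable]: "W \<in> borel_measurable M"
    using dens distributed_measurable[of M lborel W] by (auto simp: gw_limit_density_def a)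
  \<comment> \<open>The jump rates require r > \<beta> - 1, the negative moments r < \<gamma>. The
    small-jump bound asks for r' \<ge> 1/2, and the first moment of \<open>Z\<close> for r' <
    1.\<close>
  obtain r where r: "max 0 (\<beta> - 1) < r" "r < \<gamma>" using dense[of "max 0 (\<beta> - 1)" \<gamma>] \<gamma> by auto
  obtain r' where r': "max (1 / 2) (1 - \<beta>) < r'" "r' < 1"
    using dense[of "max (1 / 2) (1 - \<beta>)" 1] index_pos by auto
  \<comment> \<open>This margin lets \<open>r * q\<close> and \<open>r' * q\<close>, the exponents
    after raising to the power \<open>q\<close>, remain within the available moments.\<close>
  have "1 < min (1 / r') (\<gamma> / r)" using r r' by (simp add: pos_less_divide_eq)
  then obtain q where "1 < q" "q < min (1 / r') (\<gamma> / r)" using dense by blast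
  then have q: "1 < q" "q < 1 / r'" "q < \<gamma> / r" by auto
  have rq: "0 < r * q" "r * q < \<gamma>" "r' * q \<le> 1" "0 \<le> r' * q"
    using q r r' by (auto simp: pos_less_divide_eq mult.commute)
  obtain B where B: "\<And>n. (\<integral>\<^sup>+x. ennreal ((real (Z n x) / m ^ n) powr (- (r * q))) \<partial>M) \<le> ennreal B"
    using galton_watson_negative_moment[OF gwc dens \<gamma>(2) rq(1,2)] by blast
  let ?Q = "\<lambda>n k. prob {y \<in> space M. \<epsilon> n \<le> S k y / real k}"
  \<comment> \<open>Division by 0 yields 0, so index 0 asks for \<open>\<epsilon> n \<le> 0\<close>,
    which is impossible.\<close>
  have Q0: "?Q n 0 = 0" for n using \<epsilon>_pos[of n] by (simp add: not_le)
  have Qk: "?Q n k = prob {y \<in> space M. real k * \<epsilon> n \<le> S k y}" if "1 \<le> k" for n k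
    using that by (intro arg_cong[where f = prob]) (auto simp: pos_le_divide_eq mult.commute)
  obtain C where C: "0 < C" and ev: "eventually (\<lambda>n. \<forall>k\<ge>1. prob {x \<in> space M. real k * \<epsilon> n \<le> S k x} / rate n
      \<le> C * ((real k / a n) powr (- r) + (real k / a n) powr r')) sequentially"
    using prob_mean_ge_dominated[of r r'] r r' by auto
  obtain N where N: "\<And>n k. N \<le> n \<Longrightarrow> 1 \<le> k \<Longrightarrow> prob {x \<in> space M. real k * \<epsilon> n \<le> S k x} / rate n
      \<le> C * ((real k / a n) powr (- r) + (real k / a n) powr r')"
    using ev unfolding eventually_sequentially by blast
  define Y where "Y n x = ?Q n (Z n x) / rate n" for n x
  have Ym[measurable]: "Y n \<in> borel_measurable M" for n
    unfolding Y_def by (rule measurable_compose[OF Z]) simp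
  have Y0: "0 \<le> Y n x" for n x
    unfolding Y_def by (intro divide_nonneg_pos rate_pos measure_nonneg)
  have Yq: "Y n x powr q \<le> (2 * C) powr q * ((real (Z n x) / m ^ n) powr (- (r * q)) + (1 + real (Z n x) / m ^ n))"
    if "N \<le> n" for n x
  proof (cases "1 \<le> Z n x")
    case True
    define R where "R = real (Z n x) / m ^ n"
    have R: "0 < R" using True m by (simp add: R_def)
    have "Y n x \<le> C * (R powr (- r) + R powr r')"
      using N[OF that True] Qk[OF True] by (simp add: Y_def R_def a)
    then have "Y n x powr q \<le> (C * (R powr (- r) + R powr r')) powr q"
      using Y0 q by (intro powr_mono2) auto
    also have "\<dots> = C powr q * (R powr (- r) + R powr r') powr q" by (rule powr_mult)
    also have "\<dots> \<le> C powr q * (2 powr q * ((R powr (- r)) powr q + (R powr r') powr q))"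
      using q by (intro mult_left_mono powr_sum_le) auto
    also have "\<dots> = (2 * C) powr q * (R powr (- (r * q)) + R powr (r' * q))"
      by (simp add: powr_mult powr_powr mult_ac)
    \<comment> \<open>With an exponent between 0 and 1 the power is at most 1 + R, and R has mean
      1.\<close>
    also have "\<dots> \<le> (2 * C) powr q * (R powr (- (r * q)) + (1 + R))"
      using powr_between[OF R, of 0 "r' * q" 1] rq R by (intro mult_left_mono add_left_mono) auto
    finally show ?thesis by (simp add: R_def)
  next
    case False
    then have "Z n x = 0" by simp
    then have "Y n x = 0" unfolding Y_def using Q0[of n] by (simp only: div_0)
    then have "Y n x powr q = 0" by simp
    moreover have "0 \<le> (2 * C) powr q * ((real (Z n x) / m ^ n) powr (- (r * q)) + (1 + real (Z n x) / m ^ n))"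
      using m by (intro mult_nonneg_nonneg add_nonneg_nonneg) auto
    ultimately show ?thesis by linarith
  qed
  define B' where "B' = max B 0"
  \<comment> \<open>The domination holds from \<open>N\<close> on, so the convergence theorem is
    applied to the shifted sequence.\<close>
  have YB: "(\<integral>\<^sup>+x. ennreal (Y (n + N) x powr q) \<partial>M) \<le> ennreal ((2 * C) powr q * (B' + (1 + 1)))" for n
  proof -
    let ?R = "\<lambda>x. real (Z (n + N) x) / m ^ (n + N)"
    have R: "?R \<in> borel_measurable M" "(\<lambda>x. ?R x powr (- (r * q))) \<in> borel_measurable M" by measurable
    have R0: "0 \<le> ?R x" for x using m by simp
    have "(\<integral>\<^sup>+x. ennreal (Y (n + N) x powr q) \<partial>M)
        \<le> (\<integral>\<^sup>+x. ennreal ((2 * C) powr q) * (ennreal (?R x powr (- (r * q))) + (1 + ennreal (?R x))) \<partial>M)"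
    proof (rule nn_integral_mono)
      fix x
      have "ennreal (Y (n + N) x powr q) \<le> ennreal ((2 * C) powr q * (?R x powr (- (r * q)) + (1 + ?R x)))"
        by (intro ennreal_leI Yq) simp
      also have "\<dots> = ennreal ((2 * C) powr q) * (ennreal (?R x powr (- (r * q))) + (1 + ennreal (?R x)))"
        by (rule ennreal_affine) (use R0 in auto)
      finally show "ennreal (Y (n + N) x powr q)
          \<le> ennreal ((2 * C) powr q) * (ennreal (?R x powr (- (r * q))) + (1 + ennreal (?R x)))" .
    qed
    also have "\<dots> = ennreal ((2 * C) powr q) * ((\<integral>\<^sup>+x. ennreal (?R x powr (- (r * q))) \<partial>M)
        + ((\<integral>\<^sup>+x. 1 \<partial>M) + (\<integral>\<^sup>+x. ennreal (?R x) \<partial>M)))"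
      using R by (simp add: nn_integral_cmult nn_integral_add del: of_nat_add)
    also have "\<dots> = ennreal ((2 * C) powr q) * ((\<integral>\<^sup>+x. ennreal (?R x powr (- (r * q))) \<partial>M) + (1 + 1))"
      by (simp only: galton_watson_mean[OF gwc]) (simp add: emeasure_space_1)
    also have "\<dots> \<le> ennreal ((2 * C) powr q) * (ennreal B' + (1 + 1))"
    proof (intro mult_left_mono add_right_mono)
      show "(\<integral>\<^sup>+x. ennreal (?R x powr (- (r * q))) \<partial>M) \<le> ennreal B'"
        by (rule order_trans[OF B]) (simp add: B'_def ennreal_leI)
    qed simp
    also have "\<dots> = ennreal ((2 * C) powr q * (B' + (1 + 1)))"
      by (subst ennreal_affine) (auto simp: B'_def)
    finally show ?thesis .
  qed
  have "AE x in M. (\<lambda>n. Y (n + N) x) \<longlonglongrightarrow> W x powr (1 - \<beta>)"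
    using lim gw_limit_density_pos[OF dens]
  proof eventually_elim
    case (elim x)
    have l: "(\<lambda>n. prob {y \<in> space M. real (Z n x) * \<epsilon> n \<le> S (Z n x) y} / rate n) \<longlonglongrightarrow> W x powr (1 - \<beta>)"
      by (rule prob_mean_ge_asymp[OF elim])
    have "eventually (\<lambda>n. 1 \<le> Z n x) sequentially"
      using k_top[OF elim] unfolding filterlim_at_top by blast
    then have "eventually (\<lambda>n. prob {y \<in> space M. real (Z n x) * \<epsilon> n \<le> S (Z n x) y} / rate n = Y n x) sequentially"
      by eventually_elim (simp only: Y_def Qk)
    then have "(\<lambda>n. Y n x) \<longlonglongrightarrow> W x powr (1 - \<beta>)" using l by (rule Lim_transform_eventually[rotated])
    then show ?case by (rule LIMSEQ_ignore_initial_segment)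
  qed
  then have "(\<lambda>n. expectation (Y (n + N))) \<longlonglongrightarrow> expectation (\<lambda>x. W x powr (1 - \<beta>))"
    using Y0 q(1) YB by (intro tendsto_expectation_bounded_moment[where q = q]) auto
  then have "(\<lambda>n. expectation (Y n)) \<longlonglongrightarrow> expectation (\<lambda>x. W x powr (1 - \<beta>))" by (rule LIMSEQ_offset)
  then show ?thesis by (simp add: Y_def[abs_def])
qed

theorem theorem1p5:
  fixes M :: "'a measure"
    and p :: "nat pmf" and Z :: "nat \<Rightarrow> 'a \<Rightarrow> nat" and m \<gamma> :: real
    and W :: "'a \<Rightarrow> real" and \<omega> :: "real \<Rightarrow> real"
    and X :: "nat \<Rightarrow> 'a \<Rightarrow> real" and \<epsilon> :: "nat \<Rightarrow> real"
    and \<alpha> \<beta> :: real and L b s :: "real \<Rightarrow> real" and \<nu> :: "real measure"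
  assumes "prob_space M"
    and "galton_watson_conditions M p Z m"
    and "gw_limit_density M Z m W \<omega>"
    and "0 < \<gamma>" and "pmf p 1 = m powr (- \<gamma>)"
    and "iid_sequence M X" and "indep_sequences M X Z"
    and "\<And>n. 0 < \<epsilon> n"
    and "assumption_A M X \<epsilon> \<alpha> \<beta> L b s \<nu>"
    and "assumption_B (distr M borel (X 0)) \<alpha> \<beta> b s \<nu>"
    and "0 < \<alpha>" and "\<alpha> < 1"
    and "filterlim (\<lambda>n. \<epsilon> n * m ^ n * inverse (b (m ^ n))) at_top sequentially"
    and "filterlim \<epsilon> at_top sequentially"
    and "\<gamma> > \<beta> - 1"
  shows "(\<lambda>n. m powr ((\<beta> - 1) * real n) * \<epsilon> n powr \<beta> * inverse (L (\<epsilon> n * m ^ n)) *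
            measure M {x \<in> space M. partial_sum X (Z n x) x / real (Z n x) \<ge> \<epsilon> n})
         \<longlonglongrightarrow> density_moment \<omega> \<beta>"
proof -
  interpret prob_space M by fact
  have gw: "galton_watson M p Z" and m: "1 < m"
    using assms(2) by (auto simp: galton_watson_conditions_def)
  have Z[measurable]: "Z n \<in> measurable M (count_space UNIV)" for n
    using gw by (auto simp: galton_watson_def)
  interpret iid_sums M X
  proof
    show "indep_vars (\<lambda>_. borel) X UNIV" using assms(6) by (simp add: iid_sequence_def)
    show "distr M borel (X i) = distr M borel (X 0)" for i
      using assms(6) unfolding iid_sequence_def by blast
  qed
  have tail: "tail_assumption (distr M borel (X 0)) \<beta> L" and nf: "norming_function \<alpha> b s"
    and "alpha_stable \<alpha> \<nu>"
    and conv: "weak_conv_m (\<lambda>k. distr M borel (\<lambda>x. partial_sum X k x / b (real k))) \<nu>"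
    using assms(9) by (auto simp: assumption_A_def stable_attraction_def)
  interpret regularly_varying_tail tail \<beta> by (rule tail_regularly_varying(2)[OF tail])
  interpret sum_large_deviation M X \<beta> "\<lambda>n. m ^ n" \<epsilon> b \<nu>
  proof (intro sum_large_deviation.intro sum_large_deviation_axioms.intro)
    show "real_distribution \<nu>" using \<open>alpha_stable \<alpha> \<nu>\<close> by (simp add: alpha_stable_def)
    show "0 < b (real j)" if "1 \<le> j" for j using that by (intro norming_function_pos[OF nf]) simp
    show "1 \<le> m ^ n" for n using m by simp
    show "filterlim (\<lambda>n. m ^ n) at_top sequentially" by (rule filterlim_power_at_top[OF m])
    show "filterlim (\<lambda>n. real (k n) * \<epsilon> n / b (real (k n))) at_top sequentially"
      if "(\<lambda>n. real (k n) / m ^ n) \<longlonglongrightarrow> u" "0 < u" for k u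
      by (rule level_comparable[OF nf filterlim_power_at_top[OF m] assms(8,13) that])
    show "\<exists>D. eventually (\<lambda>n. m ^ n \<le> \<epsilon> n powr D) sequentially"
      by (rule polynomial_level_of_norming[OF nf m assms(11,12,8,13)])
  qed (fact conv assms iid_sums_axioms regularly_varying_tail_axioms)+
  let ?y = "\<lambda>n. m ^ n * \<epsilon> n"
  let ?P = "\<lambda>n. prob {x \<in> space M. \<epsilon> n \<le> partial_sum X (Z n x) x / real (Z n x)}"
  have "(\<lambda>n. ?P n / rate n) \<longlonglongrightarrow> density_moment \<omega> \<beta>"
    using expectation_tendsto[OF assms(2,3,4,5) assms(15) refl]
    by (simp only: prob_random_index[OF assms(7) Z] density_moment_eq_expectation[OF assms(3)])
  \<comment> \<open>\<open>rate\<close> contains the tail itself; a factor tending to 1 exchanges it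
    for its equivalent in terms of \<open>L\<close>. The exponent (\<beta> - 1) n arises from m^(n
    \<beta>) and the factor m^n in \<open>rate\<close>.\<close>
  moreover have "(\<lambda>n. tail (?y n) / (?y n powr (- \<beta>) * L (?y n))) \<longlonglongrightarrow> 1"
    by (rule filterlim_compose[OF tail_regularly_varying(1)[OF tail] a_eps_top])
  ultimately have "(\<lambda>n. ?P n / rate n * (tail (?y n) / (?y n powr (- \<beta>) * L (?y n)))) \<longlonglongrightarrow> density_moment \<omega> \<beta> * 1"
    by (rule tendsto_mult)
  moreover have "?P n / rate n * (tail (?y n) / (?y n powr (- \<beta>) * L (?y n))) =
      m powr ((\<beta> - 1) * real n) * \<epsilon> n powr \<beta> * inverse (L (\<epsilon> n * m ^ n)) * ?P n" for n
  proof -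
    have mn: "0 < m ^ n" and \<epsilon>: "0 < \<epsilon> n" using m assms(8) by auto
    have "tail (?y n) / rate n = 1 / m ^ n" using pos[of "?y n"] by (simp add: rate_def)
    moreover have "1 / ?y n powr (- \<beta>) = (m ^ n) powr \<beta> * \<epsilon> n powr \<beta>"
      by (simp add: powr_minus powr_mult field_simps)
    moreover have "(m ^ n) powr \<beta> = m powr ((\<beta> - 1) * real n) * m ^ n"
    proof -
      have "m powr ((\<beta> - 1) * real n) = (m ^ n) powr (\<beta> - 1)"
        using m by (simp add: powr_realpow[symmetric] powr_powr mult.commute)
      then show ?thesis using mn by (simp add: powr_diff)
    qed
    ultimately have eq: "tail (?y n) / rate n * (1 / ?y n powr (- \<beta>)) = m powr ((\<beta> - 1) * real n) * \<epsilon> n powr \<beta>"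
      using mn by simp
    have "?P n / rate n * (tail (?y n) / (?y n powr (- \<beta>) * L (?y n))) =
        tail (?y n) / rate n * (1 / ?y n powr (- \<beta>)) * inverse (L (\<epsilon> n * m ^ n)) * ?P n"
      by (simp add: divide_inverse mult_ac)
    then show ?thesis by (simp only: eq)
  qed
  ultimately show ?thesis by simp
qed

end
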